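(* Let $H$ be a finitely generated subgroup of the amalgam $G=G_1\ast_A G_2$. Then, up to isomorphism (of pointed labelled graphs), there exists a unique reduced precover of $G$ determining $H$ (i.e. a unique reduced precover $(\Gamma,v_0)$ of $G$ with $Lab(\Gamma,v_0)=H$), and it is the normal core $(\Delta,H\cdot 1)$ of $Cayley(G,H)$.
   Context: Amalgam. $G_1=gp\langle X_1|R_1\rangle$, $G_2=gp\langle X_2|R_2\rangle$ are finitely presented groups given by fixed finite presentations with $X_1^{\pm}\cap X_2^{\pm}=\emptyset$; $A$ is a group with monomorphisms $\phi_i:A\to G_i$ ($i=1,2$); $G=G_1\ast_A G_2=gp\langle X_1,X_2\mid R_1,R_2,\phi_1(A)=\phi_2(A)\rangle$ is given by this finite presentation, $X=X_1\cup X_2$. $A$ is identified with its images in $G_1$, $G_2$ and $G$. Graphs. A graph $\Gamma$ has vertices $V(\Gamma)$, directed edges $E(\Gamma)$, an involution $e\mapsto\overline e\neq e$ on edges, initial vertex $\iota(e)$ and terminal vertex $\tau(e)=\iota(\overline e)$. It is labelled with $X^{\pm}$ if each edge has a label $lab(e)\in X^{\pm}$ with $lab(\overline e)=lab(e)^{-1}$; well-labelled if $\iota(e_1)=\iota(e_2)$, $lab(e_1)=lab(e_2)$ imply $e_1=e_2$. The label of a path is the word read along it. $Lab(\Gamma,v_0)$ is the subgroup of $G$ of all elements represented by labels of closed paths at $v_0$ (if $V(\Gamma)=\{v_0\}$, $E(\Gamma)=\emptyset$, it is $\{1\}$); $(\Gamma,v_0)$ is said to determine this subgroup. Morphisms of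 labelled graphs commute with $\iota,\tau$ and preserve labels; pointed ones preserve basepoints. $\Gamma$ is $G$-based if every path $p$ with $lab(p)=_G1$ is closed. $Cayley(G,S)$ (relative Cayley graph) has vertices the right cosets $Sg$ and, for each $x\in X^{\pm}$, an edge $(Sg,x)$ labelled $x$ from $Sg$ to $Sgx$; basepoint $S\cdot 1$. $Cayley(G_i,S)$ is defined similarly with $X_i$. A cover of $G_i$ is a labelled graph isomorphic to $Cayley(G_i,S)$ for some $S\le G_i$. Normal paths. A word $g_1g_2\cdots g_n$ is in normal form (normal) if each $g_k\neq_G1$ is a word lying in one of the factors, consecutive $g_k,g_{k+1}$ lie in different factors, and if $n\neq1$ then no $g_k$ is in $A$. A path $p$ with decomposition $p_1\cdots p_n$ into maximal monochromatic subpaths (labelled only by $X_1^{\pm}$ or only by $X_2^{\pm}$) is normal if $lab(p_1)\cdots lab(p_n)$ is in normal form. Normal core. A vertex of $Cayley(G,H)$ is essential if some normal path closed at $H\cdot1$ goes through it. The normal core $(\Delta,H\cdot1)$ of $Cayley(G,H)$ is its restriction to the essential vertices, understood as the union of all normal paths in $Cayley(G,H)$ closed at $H\cdot1$ (it is the single vertex $H\cdot 1$ with no edges if $H=\{1\}$). Precovers. An $X_i$-monochromatic component of $\Gamma$ is a maximal connected subgraph labelled with $X_i^{\pm}$ containing at least one edge. A vertex is bichromatic if edges with labels in $X_1^{\pm}$ and edges with labels in $X_2^{\pm}$ start at it; $VB(C)$ denotes the set of vertices of a component $C$ that are bichromatic in $\Gamma$. A precover of $G$ is a connected $G$-based graph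 (labelled with $X^\pm$) in which each $X_i$-monochromatic component is a cover of $G_i$ ($i=1,2$); a single vertex with no edges is also a precover. For a vertex $v$ of an $X_i$-monochromatic component $C$ of a precover and $a\in A$, $v\cdot a$ is the endpoint of the path in $C$ starting at $v$ labelled by a word in $X_i^{\pm}$ representing $a$; $A(v)=\{v\cdot a: a\in A\}$. An $X_i$-monochromatic component $C$ of a precover $(\Gamma,v_0)$ is redundant if either (1) $\Gamma=C$ and $Lab(C,v_0)=\{1\}$; or (2) $\Gamma$ has at least two distinct monochromatic components and, for $\vartheta\in VB(C)$ and $K=Lab(C,\vartheta)$: (i) $K\le A$, (ii) $VB(C)=A(\vartheta)$, (iii) either $v_0\notin V(C)$, or $v_0\in VB(C)$ and $K=\{1\}$. A precover $(\Gamma,v_0)$ is reduced if (1) it has no redundant monochromatic components, and (2) if there is an $X_i$-monochromatic component $C$ with $v_0\in V(C)$ and $K\cap A\neq\{1\}$, where $K=Lab(C,v_0)$, then there is an $X_j$-monochromatic component $D$ ($1\le i\neq j\le2$) with $v_0\in V(D)$ and $K\cap A=_G L\cap A$, where $L=Lab(D,v_0)$.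
   Formalization: Uniqueness is claimed only among reduced precovers with finitely many monochromatic components (the normal core is proved to be one); otherwise it fails: for Z/2*Z/2, A=1, H={1}, all of Cayley(G,H) is a reduced precover determining H but is not the one-vertex core. *)

theory Defs
  imports "HOL-Algebra.Coset" "HOL-Algebra.Generated_Groups"
begin

section \<open>Words and presented groups\<close>

text \<open>A letter over \<open>X\<close> is a generator \<open>x\<close> with a sign: \<open>(x, True)\<close> is \<open>x\<close> and \<open>(x, False)\<close> is
  the formal inverse of \<open>x\<close>; \<open>letters X\<close> is the alphabet usually written \<open>X\<^sup>\<plusminus>\<close>.\<close>

type_synonym 'x letter = "'x \<times> bool"
type_synonym 'x word = "'x letter list"

abbreviation letters :: "'x set \<Rightarrow> 'x letter set" where
  "letters X \<equiv> X \<times> UNIV"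

abbreviation words :: "'x set \<Rightarrow> 'x word set" where
  "words X \<equiv> lists (letters X)"

definition linv :: "'x letter \<Rightarrow> 'x letter" where
  "linv l = (fst l, \<not> snd l)"

definition winv :: "'x word \<Rightarrow> 'x word" where
  "winv w = rev (map linv w)"

inductive pres_eq :: "'x set \<Rightarrow> 'x word set \<Rightarrow> 'x word \<Rightarrow> 'x word \<Rightarrow> bool"
  for X :: "'x set" and R :: "'x word set" where
  refl: "w \<in> words X \<Longrightarrow> pres_eq X R w w"
| sym: "pres_eq X R u v \<Longrightarrow> pres_eq X R v u"
| trans: "pres_eq X R u v \<Longrightarrow> pres_eq X R v w \<Longrightarrow> pres_eq X R u w"
| cancel: "u \<in> words X \<Longrightarrow> v \<in> words X \<Longrightarrow> l \<in> letters X
    \<Longrightarrow> pres_eq X R (u @ [l, linv l] @ v) (u @ v)"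
| relator: "u \<in> words X \<Longrightarrow> v \<in> words X \<Longrightarrow> r \<in> R \<Longrightarrow> r \<in> words X
    \<Longrightarrow> pres_eq X R (u @ r @ v) (u @ v)"

definition pres_rel :: "'x set \<Rightarrow> 'x word set \<Rightarrow> ('x word \<times> 'x word) set" where
  "pres_rel X R = {(u, v). pres_eq X R u v}"

text \<open>The element of \<open>gp\<langle>X | R\<rangle>\<close> represented by the word \<open>w\<close>.\<close>

definition elt :: "'x set \<Rightarrow> 'x word set \<Rightarrow> 'x word \<Rightarrow> 'x word set" where
  "elt X R w = pres_rel X R `` {w}"

definition gp :: "'x set \<Rightarrow> 'x word set \<Rightarrow> 'x word set monoid" where
  "gp X R = \<lparr> carrier = words X // pres_rel X R,
              mult = (\<lambda>P Q. \<Union>u\<in>P. \<Union>v\<in>Q. elt X R (u @ v)),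
              one = elt X R [] \<rparr>"

definition finite_presentation :: "'x set \<Rightarrow> 'x word set \<Rightarrow> bool" where
  "finite_presentation X R \<longleftrightarrow> finite X \<and> finite R \<and> R \<subseteq> words X"

definition fin_gen :: "('g, 'b) monoid_scheme \<Rightarrow> 'g set \<Rightarrow> bool" where
  "fin_gen G H \<longleftrightarrow> (\<exists>S. finite S \<and> S \<subseteq> carrier G \<and> generate G S = H)"


section \<open>Amalgams given by finite presentations\<close>

datatype side = F1 | F2

fun other :: "side \<Rightarrow> side" where
  "other F1 = F2"
| "other F2 = F1"

text \<open>For \<open>i = F1, F2\<close>, \<open>gens i\<close> and \<open>rels i\<close> present the factor \<open>G\<^sub>i\<close> and \<open>emb i\<close> is the
  monomorphism \<open>\<phi>\<^sub>i : A \<rightarrow> G\<^sub>i\<close>. The relations \<open>\<phi>\<^sub>1(A) = \<phi>\<^sub>2(A)\<close> are imposed on a finite generating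
  set \<open>agens\<close> of \<open>A\<close>, using for each \<open>y\<close> in it a chosen word \<open>arep i y\<close> over \<open>gens i\<close> representing
  \<open>\<phi>\<^sub>i(y)\<close>; this keeps the presentation of the amalgam finite.\<close>

record ('x, 'a) amalgam_data =
  gens :: "side \<Rightarrow> 'x set"
  rels :: "side \<Rightarrow> 'x word set"
  amal :: "'a monoid"
  emb :: "side \<Rightarrow> 'a \<Rightarrow> 'x word set"
  agens :: "'a set"
  arep :: "side \<Rightarrow> 'a \<Rightarrow> 'x word"

definition factor :: "('x, 'a) amalgam_data \<Rightarrow> side \<Rightarrow> 'x word set monoid" where
  "factor D i = gp (gens D i) (rels D i)"

definition amalgam :: "('x, 'a) amalgam_data \<Rightarrow> bool" where
  "amalgam D \<longleftrightarrow>
     (\<forall>i. finite_presentation (gens D i) (rels D i)) \<and>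
     gens D F1 \<inter> gens D F2 = {} \<and>
     group (amal D) \<and>
     (\<forall>i. emb D i \<in> mon (amal D) (factor D i)) \<and>
     finite (agens D) \<and> agens D \<subseteq> carrier (amal D) \<and>
     generate (amal D) (agens D) = carrier (amal D) \<and>
     (\<forall>i. \<forall>y\<in>agens D. arep D i y \<in> words (gens D i) \<and>
        elt (gens D i) (rels D i) (arep D i y) = emb D i y)"

definition all_gens :: "('x, 'a) amalgam_data \<Rightarrow> 'x set" where
  "all_gens D = gens D F1 \<union> gens D F2"

definition all_rels :: "('x, 'a) amalgam_data \<Rightarrow> 'x word set" where
  "all_rels D = rels D F1 \<union> rels D F2 \<union> {arep D F1 y @ winv (arep D F2 y) | y. y \<in> agens D}"

definition amalg_gp :: "('x, 'a) amalgam_data \<Rightarrow> 'x word set monoid" where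
  "amalg_gp D = gp (all_gens D) (all_rels D)"

definition gelt :: "('x, 'a) amalgam_data \<Rightarrow> 'x word \<Rightarrow> 'x word set" where
  "gelt D w = elt (all_gens D) (all_rels D) w"

text \<open>The image of \<open>A\<close> in the amalgam. An element of a factor is a set of words, namely of all
  words over the alphabet of that factor that represent it.\<close>

definition amal_img :: "('x, 'a) amalgam_data \<Rightarrow> 'x word set set" where
  "amal_img D = {gelt D u | u i a. a \<in> carrier (amal D) \<and> u \<in> emb D i a}"


section \<open>Labelled graphs\<close>

record ('v, 'e, 'x) lgraph =
  verts :: "'v set"
  edges :: "'e set"
  ini :: "'e \<Rightarrow> 'v"
  erev :: "'e \<Rightarrow> 'e"
  lab :: "'e \<Rightarrow> 'x letter"

definition ter :: "('v, 'e, 'x) lgraph \<Rightarrow> 'e \<Rightarrow> 'v" where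
  "ter \<Gamma> e = ini \<Gamma> (erev \<Gamma> e)"

definition labelled_graph :: "'x set \<Rightarrow> ('v, 'e, 'x) lgraph \<Rightarrow> bool" where
  "labelled_graph X \<Gamma> \<longleftrightarrow>
     (\<forall>e\<in>edges \<Gamma>. ini \<Gamma> e \<in> verts \<Gamma> \<and> erev \<Gamma> e \<in> edges \<Gamma> \<and>
        erev \<Gamma> e \<noteq> e \<and> erev \<Gamma> (erev \<Gamma> e) = e \<and>
        lab \<Gamma> e \<in> letters X \<and> lab \<Gamma> (erev \<Gamma> e) = linv (lab \<Gamma> e))"

text \<open>A subgraph has literally the same structure maps as the ambient graph (also off its edge
  set), so that a subgraph is determined by its vertices and edges and sets of subgraphs can be
  counted.\<close>

definition subgraph :: "('v, 'e, 'x) lgraph \<Rightarrow> ('v, 'e, 'x) lgraph \<Rightarrow> bool" where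
  "subgraph C \<Gamma> \<longleftrightarrow> verts C \<subseteq> verts \<Gamma> \<and> edges C \<subseteq> edges \<Gamma> \<and>
     ini C = ini \<Gamma> \<and> erev C = erev \<Gamma> \<and> lab C = lab \<Gamma>"

fun path :: "('v, 'e, 'x) lgraph \<Rightarrow> 'v \<Rightarrow> 'e list \<Rightarrow> 'v \<Rightarrow> bool" where
  "path \<Gamma> u [] v \<longleftrightarrow> u \<in> verts \<Gamma> \<and> u = v"
| "path \<Gamma> u (e # p) v \<longleftrightarrow> e \<in> edges \<Gamma> \<and> ini \<Gamma> e = u \<and> path \<Gamma> (ter \<Gamma> e) p v"

definition path_verts :: "('v, 'e, 'x) lgraph \<Rightarrow> 'v \<Rightarrow> 'e list \<Rightarrow> 'v set" where
  "path_verts \<Gamma> u p = insert u (ter \<Gamma> ` set p)"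

abbreviation plab :: "('v, 'e, 'x) lgraph \<Rightarrow> 'e list \<Rightarrow> 'x word" where
  "plab \<Gamma> p \<equiv> map (lab \<Gamma>) p"

definition connected_graph :: "('v, 'e, 'x) lgraph \<Rightarrow> bool" where
  "connected_graph \<Gamma> \<longleftrightarrow> (\<forall>u\<in>verts \<Gamma>. \<forall>v\<in>verts \<Gamma>. \<exists>p. path \<Gamma> u p v)"

definition graph_morphism ::
  "('v \<Rightarrow> 'w) \<Rightarrow> ('e \<Rightarrow> 'f) \<Rightarrow> ('v, 'e, 'x) lgraph \<Rightarrow> ('w, 'f, 'x) lgraph \<Rightarrow> bool" where
  "graph_morphism f g \<Gamma> \<Gamma>' \<longleftrightarrow>
     f ` verts \<Gamma> \<subseteq> verts \<Gamma>' \<and> g ` edges \<Gamma> \<subseteq> edges \<Gamma>' \<and>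
     (\<forall>e\<in>edges \<Gamma>. ini \<Gamma>' (g e) = f (ini \<Gamma> e) \<and> ter \<Gamma>' (g e) = f (ter \<Gamma> e) \<and>
        g (erev \<Gamma> e) = erev \<Gamma>' (g e) \<and> lab \<Gamma>' (g e) = lab \<Gamma> e)"

definition graph_iso ::
  "('v \<Rightarrow> 'w) \<Rightarrow> ('e \<Rightarrow> 'f) \<Rightarrow> ('v, 'e, 'x) lgraph \<Rightarrow> ('w, 'f, 'x) lgraph \<Rightarrow> bool" where
  "graph_iso f g \<Gamma> \<Gamma>' \<longleftrightarrow> graph_morphism f g \<Gamma> \<Gamma>' \<and>
     bij_betw f (verts \<Gamma>) (verts \<Gamma>') \<and> bij_betw g (edges \<Gamma>) (edges \<Gamma>')"

definition isomorphic :: "('v, 'e, 'x) lgraph \<Rightarrow> ('w, 'f, 'x) lgraph \<Rightarrow> bool" where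
  "isomorphic \<Gamma> \<Gamma>' \<longleftrightarrow> (\<exists>f g. graph_iso f g \<Gamma> \<Gamma>')"

definition pointed_isomorphic ::
  "('v, 'e, 'x) lgraph \<Rightarrow> 'v \<Rightarrow> ('w, 'f, 'x) lgraph \<Rightarrow> 'w \<Rightarrow> bool" where
  "pointed_isomorphic \<Gamma> v0 \<Gamma>' v0' \<longleftrightarrow> (\<exists>f g. graph_iso f g \<Gamma> \<Gamma>' \<and> f v0 = v0')"

text \<open>The relative Cayley graph of \<open>gp\<langle>X | R\<rangle>\<close>; an edge is a pair of its initial vertex and its
  label.\<close>

definition cayley :: "'x set \<Rightarrow> 'x word set \<Rightarrow> 'x word set set
    \<Rightarrow> ('x word set set, 'x word set set \<times> 'x letter, 'x) lgraph" where
  "cayley X R S = \<lparr> verts = rcosets\<^bsub>gp X R\<^esub> S,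
                    edges = (rcosets\<^bsub>gp X R\<^esub> S) \<times> letters X,
                    ini = fst,
                    erev = (\<lambda>(V, l). (V #>\<^bsub>gp X R\<^esub> elt X R [l], linv l)),
                    lab = snd \<rparr>"

definition cayley_amalg :: "('x, 'a) amalgam_data \<Rightarrow> 'x word set set
    \<Rightarrow> ('x word set set, 'x word set set \<times> 'x letter, 'x) lgraph" where
  "cayley_amalg D H = cayley (all_gens D) (all_rels D) H"

definition basepoint :: "('x, 'a) amalgam_data \<Rightarrow> 'x word set set \<Rightarrow> 'x word set set" where
  "basepoint D H = H #>\<^bsub>amalg_gp D\<^esub> \<one>\<^bsub>amalg_gp D\<^esub>"

definition Lab :: "('x, 'a) amalgam_data \<Rightarrow> ('v, 'e, 'x) lgraph \<Rightarrow> 'v \<Rightarrow> 'x word set set" where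
  "Lab D \<Gamma> v = {gelt D (plab \<Gamma> p) | p. path \<Gamma> v p v}"

definition G_based :: "('x, 'a) amalgam_data \<Rightarrow> ('v, 'e, 'x) lgraph \<Rightarrow> bool" where
  "G_based D \<Gamma> \<longleftrightarrow> (\<forall>u p v. path \<Gamma> u p v \<longrightarrow> gelt D (plab \<Gamma> p) = \<one>\<^bsub>amalg_gp D\<^esub> \<longrightarrow> u = v)"


section \<open>Normal paths and the normal core\<close>

text \<open>A normal word is given as the list \<open>g\<^sub>1, \<dots>, g\<^sub>n\<close> of its syllables; the empty list (\<open>n = 0\<close>)
  is in normal form.\<close>

definition normal_form :: "('x, 'a) amalgam_data \<Rightarrow> 'x word list \<Rightarrow> bool" where
  "normal_form D gs \<longleftrightarrow>
     (\<forall>g\<in>set gs. (\<exists>i. g \<in> words (gens D i)) \<and> gelt D g \<noteq> \<one>\<^bsub>amalg_gp D\<^esub>) \<and>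
     successively (\<lambda>g g'. \<not> (\<exists>i. g \<in> words (gens D i) \<and> g' \<in> words (gens D i))) gs \<and>
     (length gs \<noteq> 1 \<longrightarrow> (\<forall>g\<in>set gs. gelt D g \<notin> amal_img D))"

definition mono_decomp ::
  "('x, 'a) amalgam_data \<Rightarrow> ('v, 'e, 'x) lgraph \<Rightarrow> 'e list \<Rightarrow> 'e list list \<Rightarrow> bool" where
  "mono_decomp D \<Gamma> p ps \<longleftrightarrow> concat ps = p \<and>
     (\<forall>q\<in>set ps. q \<noteq> [] \<and> (\<exists>i. plab \<Gamma> q \<in> words (gens D i))) \<and>
     successively (\<lambda>q q'. \<not> (\<exists>i. plab \<Gamma> q \<in> words (gens D i) \<and> plab \<Gamma> q' \<in> words (gens D i))) ps"

definition normal_path ::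
  "('x, 'a) amalgam_data \<Rightarrow> ('v, 'e, 'x) lgraph \<Rightarrow> 'v \<Rightarrow> 'e list \<Rightarrow> 'v \<Rightarrow> bool" where
  "normal_path D \<Gamma> u p v \<longleftrightarrow> path \<Gamma> u p v \<and>
     (\<exists>ps. mono_decomp D \<Gamma> p ps \<and> normal_form D (map (plab \<Gamma>) ps))"

definition essential :: "('x, 'a) amalgam_data \<Rightarrow> 'x word set set \<Rightarrow> 'x word set set \<Rightarrow> bool" where
  "essential D H v \<longleftrightarrow>
     (\<exists>p. normal_path D (cayley_amalg D H) (basepoint D H) p (basepoint D H) \<and>
        v \<in> path_verts (cayley_amalg D H) (basepoint D H) p)"

text \<open>The union of all normal paths of \<open>Cayley(G, H)\<close> closed at \<open>H\<cdot>1\<close>, which is in general not the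
  full subgraph on the essential vertices. The empty path is normal, so \<open>H\<cdot>1\<close> is always a vertex.\<close>

definition normal_core :: "('x, 'a) amalgam_data \<Rightarrow> 'x word set set
    \<Rightarrow> ('x word set set, 'x word set set \<times> 'x letter, 'x) lgraph" where
  "normal_core D H =
     (cayley_amalg D H)
       \<lparr> verts := {v. essential D H v},
         edges := {e. \<exists>p. normal_path D (cayley_amalg D H) (basepoint D H) p (basepoint D H) \<and>
                          (e \<in> set p \<or> e \<in> erev (cayley_amalg D H) ` set p)} \<rparr>"


section \<open>Precovers\<close>

definition is_cover :: "('x, 'a) amalgam_data \<Rightarrow> side \<Rightarrow> ('v, 'e, 'x) lgraph \<Rightarrow> bool" where
  "is_cover D i C \<longleftrightarrow>
     (\<exists>S. subgroup S (factor D i) \<and> isomorphic C (cayley (gens D i) (rels D i) S))"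

definition mono_connected ::
  "('x, 'a) amalgam_data \<Rightarrow> ('v, 'e, 'x) lgraph \<Rightarrow> side \<Rightarrow> ('v, 'e, 'x) lgraph \<Rightarrow> bool" where
  "mono_connected D \<Gamma> i C \<longleftrightarrow>
     subgraph C \<Gamma> \<and> labelled_graph (gens D i) C \<and> connected_graph C \<and> edges C \<noteq> {}"

definition mono_component ::
  "('x, 'a) amalgam_data \<Rightarrow> ('v, 'e, 'x) lgraph \<Rightarrow> side \<Rightarrow> ('v, 'e, 'x) lgraph \<Rightarrow> bool" where
  "mono_component D \<Gamma> i C \<longleftrightarrow> mono_connected D \<Gamma> i C \<and>
     (\<forall>C'. mono_connected D \<Gamma> i C' \<and> subgraph C C' \<longrightarrow> C' = C)"

definition mono_components ::
  "('x, 'a) amalgam_data \<Rightarrow> ('v, 'e, 'x) lgraph \<Rightarrow> ('v, 'e, 'x) lgraph set" where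
  "mono_components D \<Gamma> = {C. \<exists>i. mono_component D \<Gamma> i C}"

definition bichromatic :: "('x, 'a) amalgam_data \<Rightarrow> ('v, 'e, 'x) lgraph \<Rightarrow> 'v \<Rightarrow> bool" where
  "bichromatic D \<Gamma> v \<longleftrightarrow> v \<in> verts \<Gamma> \<and>
     (\<forall>i. \<exists>e\<in>edges \<Gamma>. ini \<Gamma> e = v \<and> lab \<Gamma> e \<in> letters (gens D i))"

definition VB :: "('x, 'a) amalgam_data \<Rightarrow> ('v, 'e, 'x) lgraph \<Rightarrow> ('v, 'e, 'x) lgraph \<Rightarrow> 'v set" where
  "VB D \<Gamma> C = {v \<in> verts C. bichromatic D \<Gamma> v}"

text \<open>\<open>A(v)\<close>, for a vertex \<open>v\<close> of a component \<open>C\<close> on side \<open>i\<close>.\<close>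

definition A_orbit ::
  "('x, 'a) amalgam_data \<Rightarrow> side \<Rightarrow> ('v, 'e, 'x) lgraph \<Rightarrow> 'v \<Rightarrow> 'v set" where
  "A_orbit D i C v = {w. \<exists>a\<in>carrier (amal D). \<exists>p. path C v p w \<and> plab C p \<in> emb D i a}"

text \<open>A single vertex without edges satisfies this definition.\<close>

definition precover :: "('x, 'a) amalgam_data \<Rightarrow> ('v, 'e, 'x) lgraph \<Rightarrow> 'v \<Rightarrow> bool" where
  "precover D \<Gamma> v0 \<longleftrightarrow>
     labelled_graph (all_gens D) \<Gamma> \<and> v0 \<in> verts \<Gamma> \<and> connected_graph \<Gamma> \<and> G_based D \<Gamma> \<and>
     (\<forall>i C. mono_component D \<Gamma> i C \<longrightarrow> is_cover D i C)"

text \<open>In a precover with at least two components \<open>VB D \<Gamma> C\<close> is nonempty, and the clauses below do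
  not depend on the choice of \<open>\<theta>\<close> in it.\<close>

definition redundant ::
  "('x, 'a) amalgam_data \<Rightarrow> ('v, 'e, 'x) lgraph \<Rightarrow> 'v \<Rightarrow> side \<Rightarrow> ('v, 'e, 'x) lgraph \<Rightarrow> bool" where
  "redundant D \<Gamma> v0 i C \<longleftrightarrow>
     (\<Gamma> = C \<and> Lab D C v0 = {\<one>\<^bsub>amalg_gp D\<^esub>}) \<or>
     ((\<exists>C1\<in>mono_components D \<Gamma>. \<exists>C2\<in>mono_components D \<Gamma>. C1 \<noteq> C2) \<and>
      (\<exists>\<theta>\<in>VB D \<Gamma> C.
         Lab D C \<theta> \<subseteq> amal_img D \<and>
         VB D \<Gamma> C = A_orbit D i C \<theta> \<and>
         (v0 \<notin> verts C \<or> v0 \<in> VB D \<Gamma> C \<and> Lab D C \<theta> = {\<one>\<^bsub>amalg_gp D\<^esub>})))"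

definition reduced_precover :: "('x, 'a) amalgam_data \<Rightarrow> ('v, 'e, 'x) lgraph \<Rightarrow> 'v \<Rightarrow> bool" where
  "reduced_precover D \<Gamma> v0 \<longleftrightarrow> precover D \<Gamma> v0 \<and>
     (\<forall>i C. mono_component D \<Gamma> i C \<longrightarrow> \<not> redundant D \<Gamma> v0 i C) \<and>
     (\<forall>i C. mono_component D \<Gamma> i C \<and> v0 \<in> verts C \<and>
        Lab D C v0 \<inter> amal_img D \<noteq> {\<one>\<^bsub>amalg_gp D\<^esub>} \<longrightarrow>
        (\<exists>E. mono_component D \<Gamma> (other i) E \<and> v0 \<in> verts E \<and>
             Lab D C v0 \<inter> amal_img D = Lab D E v0 \<inter> amal_img D))"

text \<open>Uniqueness of reduced precovers is meant among graphs with finitely many monochromatic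
  components; the components themselves may be infinite. For finite factors this says that the
  graph is finite. Without this condition a reduced precover determining \<open>H\<close> is not unique: in the
  free product of two groups of order two, the whole Cayley graph is a precover determining the
  trivial subgroup and has no redundant component, since each component has two bichromatic
  vertices and each orbit \<open>A(\<theta>)\<close> only one.\<close>

definition finite_type :: "('x, 'a) amalgam_data \<Rightarrow> ('v, 'e, 'x) lgraph \<Rightarrow> bool" where
  "finite_type D \<Gamma> \<longleftrightarrow> finite (mono_components D \<Gamma>)"

end

theory Submission
  imports Defs
begin

text \<open>
  The vertices of \<open>Cayley(G,H)\<close> are the cosets \<open>Hx\<close>, and its monochromatic components are the orbits
  \<open>Hx G\<^sub>i\<close> of the two factors. A pointed precover determining \<open>H\<close> embeds in \<open>Cayley(G,H)\<close>: a vertex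
  goes to \<open>H\<close> times the label of any path to it from the base vertex, which is well defined because
  closed paths have labels in \<open>H\<close>, and injective because the precover is \<open>G\<close>-based and every element
  of \<open>H\<close> is the label of a closed path (\<open>precover_graph_of_cosets\<close>). As components are covers, the
  image is a union of whole components. So a precover is nothing but a pair \<open>E F1\<close>, \<open>E F2\<close> of sets
  of cosets, \<open>E i\<close> being invariant under \<open>G\<^sub>i\<close>: those at which edges of side \<open>i\<close> start.
  Connectedness, the subgroup determined, the number of components and reducedness all become
  statements about this pair (\<open>connected_reachable\<close>, \<open>Lab_eq_iff\<close>, \<open>finite_type_iff\<close>,
  \<open>reduced_precover_iff\<close>). For the normal core, \<open>E i\<close> is the union \<open>core i\<close> of the orbits through
  which a syllable on side \<open>i\<close> of a normal spelling of an element of \<open>H\<close> passes: inserting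
  \<open>w w\<^sup>-\<^sup>1\<close> into that syllable leads through any edge of the orbit without changing the element
  (\<open>core_edge_normal_path\<close>).

  It remains to compare \<open>core\<close> with a reduced pair \<open>E\<close> that determines \<open>H\<close>. The core is contained in
  \<open>E\<close> by the normal form theorem: an element of \<open>H\<close> can be read along \<open>E\<close>, merging syllables along
  this walk makes it normal, and two normal spellings of one element run through the same orbits,
  since they differ by elements of \<open>A\<close> between syllables (\<open>walk_normalize\<close>, \<open>alternating_compare\<close>,
  \<open>walk_transfer\<close>, \<open>core_le\<close>). The exception is a single syllable in \<open>A\<close>, whose side is
  ambiguous; there the base condition of reducedness provides the component of the other side. The
  same inclusion, applied to the finitely many orbits visited by normal spellings of generators of
  \<open>H\<close>, shows that the core is of finite type. Conversely, if \<open>E\<close> had orbits outside the core, then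
  one at maximal distance from the base vertex would be redundant: another exit from it, or a loop
  in it outside \<open>A\<close>, would allow a closed normal walk through it and so put it in the core
  (\<open>system_eq_core\<close>). The maximum exists because \<open>E\<close> is of finite type.

  The normal form theorem itself is proved by van der Waerden's argument: the amalgam acts on formal
  normal forms, and an alternating sequence of \<open>n\<close> syllables moves the trivial form to one of
  length \<open>n\<close> (\<open>word_act_cong\<close>, \<open>normal_word_act\<close>).
\<close>

section \<open>Syllable sequences in an amalgamated product\<close>

lemma other_neq [simp]: "other i \<noteq> i" "i \<noteq> other i"
  by (cases i; simp)+

lemma other_other [simp]: "other (other i) = i"
  by (cases i) simp_all

lemma neq_iff_other: "j \<noteq> i \<longleftrightarrow> j = other i"
  by (cases i; cases j) simp_all

lemma other_eq_iff [simp]: "other i = other j \<longleftrightarrow> i = j"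
  by (cases i; cases j) simp_all

lemma side_ex: "(\<exists>i. P i) \<longleftrightarrow> P F1 \<or> P F2"
  by (metis side.exhaust)

lemma side_all: "(\<forall>i. P i) \<longleftrightarrow> P F1 \<and> P F2"
  by (metis side.exhaust)

text \<open>The group theory is separated from presentations and graphs. A syllable is a pair of a side and an
  element of that factor, and a sequence of syllables spells the product of its elements.\<close>

locale two_subgroups = group G for G (structure) +
  fixes F :: "side \<Rightarrow> 'a set" and A :: "'a set"
  assumes F_subgroup: "\<And>i. subgroup (F i) G"
    and A_subgroup: "subgroup A G"
    and A_le_F: "\<And>i. A \<subseteq> F i"
begin

primrec eval :: "(side \<times> 'a) list \<Rightarrow> 'a" where
  "eval [] = \<one>"
| "eval (s # p) = snd s \<otimes> eval p"

abbreviation syllables :: "(side \<times> 'a) set" where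
  "syllables \<equiv> Sigma UNIV F"

definition inv_seq :: "(side \<times> 'a) list \<Rightarrow> (side \<times> 'a) list" where
  "inv_seq p = rev (map (\<lambda>s. (fst s, inv (snd s))) p)"

text \<open>\<open>alternating\<close> sequences are the normal forms with all syllables outside \<open>A\<close>, whatever their length;
  they are closed under inversion and under subsequences of consecutive syllables. The normal
  forms of \<open>normal_form\<close> are these together with the single nontrivial syllables in \<open>A\<close>.\<close>

definition alternating :: "(side \<times> 'a) list \<Rightarrow> bool" where
  "alternating p \<longleftrightarrow> (\<forall>s\<in>set p. snd s \<in> F (fst s) \<and> snd s \<notin> A) \<and>
     successively (\<lambda>s t. fst s \<noteq> fst t) p"

definition normal_seq :: "(side \<times> 'a) list \<Rightarrow> bool" where
  "normal_seq p \<longleftrightarrow> alternating p \<or> (\<exists>i g. p = [(i, g)] \<and> g \<in> F i \<and> g \<noteq> \<one>)"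

lemma F_carrier [simp]: "g \<in> F i \<Longrightarrow> g \<in> carrier G"
  using F_subgroup subgroup.mem_carrier by fastforce

lemma A_F [simp]: "a \<in> A \<Longrightarrow> a \<in> F i"
  using A_le_F by auto

lemma A_carrier [simp]: "a \<in> A \<Longrightarrow> a \<in> carrier G"
  using A_F F_carrier by blast

lemma F_one [simp]: "\<one> \<in> F i"
  using F_subgroup subgroup.one_closed by fastforce

lemma A_one [simp]: "\<one> \<in> A"
  using A_subgroup subgroup.one_closed by fastforce

lemma F_mult [simp]: "g \<in> F i \<Longrightarrow> h \<in> F i \<Longrightarrow> g \<otimes> h \<in> F i"
  using F_subgroup subgroup.m_closed by fastforce

lemma A_mult [simp]: "g \<in> A \<Longrightarrow> h \<in> A \<Longrightarrow> g \<otimes> h \<in> A"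
  using A_subgroup subgroup.m_closed by fastforce

lemma F_inv [simp]: "g \<in> F i \<Longrightarrow> inv g \<in> F i"
  using F_subgroup subgroup.m_inv_closed by fastforce

lemma A_inv [simp]: "g \<in> A \<Longrightarrow> inv g \<in> A"
  using A_subgroup subgroup.m_inv_closed by fastforce

lemma A_inv_iff [simp]: "g \<in> carrier G \<Longrightarrow> inv g \<in> A \<longleftrightarrow> g \<in> A"
  by (metis A_inv inv_inv)

lemma A_mult_left [simp]:
  assumes "a \<in> A" "g \<in> carrier G"
  shows "a \<otimes> g \<in> A \<longleftrightarrow> g \<in> A"
proof
  assume "a \<otimes> g \<in> A"
  then have "inv a \<otimes> (a \<otimes> g) \<in> A" using assms by (metis A_mult A_inv)
  then show "g \<in> A" using assms by (simp add: m_assoc[symmetric])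
qed (use assms in auto)

lemma A_mult_right [simp]:
  assumes "a \<in> A" "g \<in> carrier G"
  shows "g \<otimes> a \<in> A \<longleftrightarrow> g \<in> A"
proof
  assume "g \<otimes> a \<in> A"
  then have "g \<otimes> a \<otimes> inv a \<in> A" using assms by (metis A_mult A_inv)
  then show "g \<in> A" using assms by (simp add: m_assoc)
qed (use assms in auto)

lemma eval_closed [simp]: "set p \<subseteq> syllables \<Longrightarrow> eval p \<in> carrier G"
  by (induction p) auto

lemma eval_append [simp]:
  "set p \<subseteq> syllables \<Longrightarrow> set q \<subseteq> syllables \<Longrightarrow> eval (p @ q) = eval p \<otimes> eval q"
  by (induction p) (auto simp: m_assoc)

lemma inv_seq_syllables [simp]: "set p \<subseteq> syllables \<Longrightarrow> set (inv_seq p) \<subseteq> syllables"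
  by (auto simp: inv_seq_def)

lemma eval_inv_seq [simp]: "set p \<subseteq> syllables \<Longrightarrow> eval (inv_seq p) = inv (eval p)"
proof (induction p)
  case Nil
  show ?case by (simp add: inv_seq_def)
next
  case (Cons s p)
  have "inv_seq (s # p) = inv_seq p @ [(fst s, inv (snd s))]"
    by (simp add: inv_seq_def)
  moreover have "set (inv_seq p) \<subseteq> syllables"
    using Cons.prems by simp
  moreover have "set [(fst s, inv (snd s))] \<subseteq> syllables"
    using Cons.prems by auto
  moreover have "snd s \<in> carrier G" "eval p \<in> carrier G"
    using Cons.prems by auto
  ultimately show ?case
    using Cons by (simp add: inv_mult_group)
qed

lemma alternating_syllables: "alternating p \<Longrightarrow> set p \<subseteq> syllables"
  unfolding alternating_def by (metis (no_types, lifting) SigmaI UNIV_I prod.collapse subsetI)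

lemma normal_seq_syllables: "normal_seq p \<Longrightarrow> set p \<subseteq> syllables"
  using alternating_syllables by (fastforce simp: normal_seq_def)

lemma alternating_Nil [simp]: "alternating []"
  by (simp add: alternating_def)

lemma alternating_single [simp]: "alternating [(i, g)] \<longleftrightarrow> g \<in> F i \<and> g \<notin> A"
  by (simp add: alternating_def)

lemma alternating_Cons_Cons:
  "alternating ((i, g) # (j, h) # p) \<longleftrightarrow> g \<in> F i \<and> g \<notin> A \<and> j = other i \<and> alternating ((j, h) # p)"
  by (auto simp: alternating_def neq_iff_other)

lemma alternating_Cons: "alternating ((i, g) # p) \<longleftrightarrow>
  g \<in> F i \<and> g \<notin> A \<and> alternating p \<and> (p = [] \<or> fst (hd p) = other i)"
  by (cases p) (auto simp: alternating_Cons_Cons)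

lemma alternating_append: "alternating (p @ q) \<longleftrightarrow>
  alternating p \<and> alternating q \<and> (p = [] \<or> q = [] \<or> fst (hd q) = other (fst (last p)))"
  by (auto simp: alternating_def successively_append_iff neq_iff_other[symmetric] eq_commute)

lemma alternating_inv_seq [simp]: "alternating p \<Longrightarrow> alternating (inv_seq p)"
  by (auto simp: alternating_def inv_seq_def successively_rev successively_map eq_commute)

lemma inv_seq_Nil_iff [simp]: "inv_seq p = [] \<longleftrightarrow> p = []"
  by (simp add: inv_seq_def)

lemma hd_inv_seq [simp]: "p \<noteq> [] \<Longrightarrow> fst (hd (inv_seq p)) = fst (last p)"
  by (simp add: inv_seq_def hd_rev last_map)

lemma last_inv_seq [simp]: "p \<noteq> [] \<Longrightarrow> fst (last (inv_seq p)) = fst (hd p)"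
  by (simp add: inv_seq_def last_rev hd_map)

text \<open>These are, syllable by syllable, the paths in the subgraph of \<open>Cayley(G,H)\<close> with edges of side
  \<open>i\<close> at the cosets in \<open>E i\<close>.\<close>

primrec walk :: "(side \<Rightarrow> 'a set set) \<Rightarrow> 'a set \<Rightarrow> (side \<times> 'a) list \<Rightarrow> bool" where
  "walk E v [] = True"
| "walk E v (s # p) = (v \<in> E (fst s) \<and> snd s \<in> F (fst s) \<and> walk E (v #> snd s) p)"

text \<open>Such an \<open>E\<close> encodes a union of full monochromatic components of the coset graph: \<open>E i\<close> is the set
  of vertices of its components of side \<open>i\<close>, hence a union of orbits of \<open>F i\<close>.\<close>

definition saturated :: "(side \<Rightarrow> 'a set set) \<Rightarrow> bool" where
  "saturated E \<longleftrightarrow> (\<forall>i. \<forall>v\<in>E i. v \<subseteq> carrier G \<and> (\<forall>g\<in>F i. v #> g \<in> E i))"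

lemma coset_closed [simp]: "v \<subseteq> carrier G \<Longrightarrow> g \<in> carrier G \<Longrightarrow> v #> g \<subseteq> carrier G"
  by (rule r_coset_subset_G)

lemma saturated_act: "saturated E \<Longrightarrow> v \<in> E i \<Longrightarrow> g \<in> F i \<Longrightarrow> v #> g \<in> E i"
  by (auto simp: saturated_def)

lemma saturated_act_iff:
  assumes "saturated E" "v \<subseteq> carrier G" "g \<in> F i"
  shows "v #> g \<in> E i \<longleftrightarrow> v \<in> E i"
proof
  assume "v #> g \<in> E i"
  then have "v #> g #> inv g \<in> E i"
    using assms by (meson saturated_act F_inv)
  moreover have "g \<in> carrier G" using assms by auto
  ultimately show "v \<in> E i"
    using assms by (simp add: coset_mult_assoc)
next
  assume "v \<in> E i"
  then show "v #> g \<in> E i"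
    using assms saturated_act by blast
qed

lemma walk_syllables: "walk E v p \<Longrightarrow> set p \<subseteq> syllables"
proof (induction p arbitrary: v)
  case (Cons s p)
  then show ?case by (cases s) auto
qed simp

lemma walk_append:
  assumes "v \<subseteq> carrier G"
  shows "walk E v (p @ q) \<longleftrightarrow> walk E v p \<and> walk E (v #> eval p) q"
  using assms
proof (induction p arbitrary: v)
  case (Cons s p)
  show ?case
  proof (cases "snd s \<in> F (fst s) \<and> walk E (v #> snd s) p")
    case True
    then have "set p \<subseteq> syllables" using walk_syllables by blast
    moreover have "snd s \<in> carrier G" using True by auto
    ultimately show ?thesis using True Cons by (simp add: coset_mult_assoc)
  next
    case False
    with Cons show ?thesis by auto
  qed
qed simp

text \<open>A syllable in \<open>A\<close> belongs to both factors, so it can be merged with the syllable after it. The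
  walk then starts a step earlier, but in the same orbit.\<close>

lemma walk_absorb:
  assumes "saturated E" "v \<subseteq> carrier G" "a \<in> A" "walk E (v #> a) ((j, h) # r)"
  shows "walk E v ((j, a \<otimes> h) # r)"
proof -
  have "a \<in> carrier G" "h \<in> carrier G" "a \<in> F j" "h \<in> F j"
    using assms by auto
  then show ?thesis
    using assms by (simp add: saturated_act_iff coset_mult_assoc)
qed

text \<open>Merging neighbours on the same side, and syllables in \<open>A\<close> with a neighbour, shortens a walk and
  keeps it inside \<open>E\<close>. It gets stuck only at an alternating sequence or at a single syllable of \<open>A\<close>.\<close>

lemma walk_normalize:
  assumes "saturated E" "v \<subseteq> carrier G" "walk E v p"
  shows "\<exists>q. walk E v q \<and> eval q = eval p \<and> length q \<le> length p \<and>
    (alternating q \<or> (\<exists>i. \<exists>a\<in>A. q = [(i, a)]))"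
  using assms(2,3)
proof (induction p arbitrary: v)
  case Nil
  then show ?case by (intro exI[of _ "[]"]) simp
next
  case (Cons s p)
  obtain i g where s: "s = (i, g)" by (cases s)
  from Cons.prems s have v: "v \<subseteq> carrier G" "v \<in> E i" "g \<in> F i" "walk E (v #> g) p"
    by auto
  then obtain q where q: "walk E (v #> g) q" "eval q = eval p" "length q \<le> length p"
    "alternating q \<or> (\<exists>i. \<exists>a\<in>A. q = [(i, a)])"
    using Cons.IH[of "v #> g"] by auto
  have sq: "set q \<subseteq> syllables" using q(1) by (rule walk_syllables)
  have single: "alternating [(i, x)] \<or> (\<exists>i'. \<exists>a\<in>A. [(i, x)] = [(i', a)])" if "x \<in> F i" for x
    using that by auto
  consider (a) j a where "a \<in> A" "q = [(j, a)]" | (nil) "q = []"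
    | (same) h r where "alternating q" "q = (i, h) # r"
    | (diff) h r where "alternating q" "q = (other i, h) # r"
  proof (cases "alternating q")
    case False
    then show thesis using q(4) a by blast
  next
    case True
    show thesis
    proof (cases q)
      case (Cons t r)
      obtain k h where "t = (k, h)" by (cases t)
      then show thesis using True Cons same diff neq_iff_other[of k i] by (cases "k = i") auto
    qed (rule nil)
  qed
  then show ?case
  proof cases
    case a
    have "g \<otimes> a \<in> F i" using a v by simp
    moreover from this have "walk E v [(i, g \<otimes> a)]" using v by simp
    moreover have "eval [(i, g \<otimes> a)] = eval (s # p)"
      using a v s by (auto simp: q(2)[symmetric] m_assoc)
    ultimately show ?thesis using single[of "g \<otimes> a"] a q(3)
      by (metis length_Cons list.size(3) Suc_leI le_SucI le_zero_eq not_less_eq_eq)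
  next
    case nil
    then show ?thesis using single[of g] v q s by (intro exI[of _ "[(i, g)]"]) auto
  next
    case diff
    show ?thesis
    proof (cases "g \<in> A")
      case True
      have "alternating ((other i, g \<otimes> h) # r)" using diff True by (auto simp: alternating_Cons)
      moreover have "walk E v ((other i, g \<otimes> h) # r)"
        using walk_absorb[OF assms(1) v(1) True] q(1) diff by simp
      moreover have "eval ((other i, g \<otimes> h) # r) = eval (s # p)"
        using q(2) sq s v diff by (auto simp: q(2)[symmetric] m_assoc)
      ultimately show ?thesis using q(3) diff by (intro exI[of _ "(other i, g \<otimes> h) # r"]) auto
    next
      case False
      then show ?thesis using q diff v s
        by (intro exI[of _ "(i, g) # q"]) (auto simp: alternating_Cons_Cons)
    qed
  next
    case same
    have h: "h \<in> F i" "h \<notin> A" and r: "set r \<subseteq> syllables" "walk E (v #> g #> h) r"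
      using same q(1) sq by (auto simp: alternating_Cons)
    have r': "walk E (v #> (g \<otimes> h)) r" using r v h by (simp add: coset_mult_assoc)
    have ev: "eval (s # p) = (g \<otimes> h) \<otimes> eval r"
      using q(2) same s v h r by (auto simp: q(2)[symmetric] m_assoc)
    show ?thesis
    proof (cases "g \<otimes> h \<in> A")
      case False
      then show ?thesis using same r' ev v h q(3)
        by (intro exI[of _ "(i, g \<otimes> h) # r"]) (auto simp: alternating_Cons)
    next
      case True
      show ?thesis
      proof (cases r)
        case Nil
        then show ?thesis using True r' ev v h q(3) same
          by (intro exI[of _ "[(i, g \<otimes> h)]"]) auto
      next
        case (Cons t r2)
        \<comment> \<open>the merged syllable fell into \<open>A\<close>, so it is absorbed by the next one\<close>
        obtain k x where t: "t = (k, x)" by (cases t)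
        have x: "x \<in> F k" "x \<notin> A" "alternating ((k, x) # r2)" using same Cons t
          by (auto simp: alternating_Cons)
        have "alternating ((k, (g \<otimes> h) \<otimes> x) # r2)" using x True by (auto simp: alternating_Cons)
        moreover have "walk E v ((k, (g \<otimes> h) \<otimes> x) # r2)"
          using walk_absorb[OF assms(1) v(1) True] r' Cons t by simp
        moreover have "eval ((k, (g \<otimes> h) \<otimes> x) # r2) = eval (s # p)"
          using ev Cons t x v h r by (auto simp: m_assoc)
        ultimately show ?thesis using q(3) same Cons
          by (intro exI[of _ "(k, (g \<otimes> h) \<otimes> x) # r2"]) auto
      qed
    qed
  qed
qed

end

section \<open>Normal forms and the core of a subgroup\<close>

text \<open>The first assumption is the normal form theorem. It implies that the intersection of the two
  factors is \<open>A\<close>.\<close>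

locale amalgamated_product = two_subgroups +
  assumes eval_alternating_neq_one: "\<And>p. alternating p \<Longrightarrow> p \<noteq> [] \<Longrightarrow> eval p \<noteq> \<one>"
    and spelling_exists: "\<And>g. g \<in> carrier G \<Longrightarrow> \<exists>p. set p \<subseteq> syllables \<and> eval p = g"
begin

text \<open>If the first syllables did not cancel up to an element of \<open>A\<close>, then the inverse of one spelling
  followed by the other would be alternating, nonempty, and trivial.\<close>

lemma alternating_compare:
  assumes p: "alternating ((i, g) # p)" and q: "alternating q" and a: "a \<in> A"
    and eq: "a \<otimes> eval ((i, g) # p) = eval q"
  shows "\<exists>h q'. q = (i, h) # q' \<and> inv h \<otimes> a \<otimes> g \<in> A"
proof -
  have g: "g \<in> F i" "g \<notin> A" "alternating p" and P: "set p \<subseteq> syllables"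
    using p alternating_syllables[of p] by (auto simp: alternating_Cons)
  have gc [simp]: "g \<in> carrier G" "a \<in> carrier G" "eval p \<in> carrier G" using g a P by auto
  have merged: "alternating ((i, x) # p)" if "x \<in> F i" "x \<notin> A" for x
    using p that by (auto simp: alternating_Cons)
  have ag: "a \<otimes> g \<in> F i" "a \<otimes> g \<notin> A" using g a by auto
  show ?thesis
  proof (cases q)
    case Nil
    then have "eval ((i, a \<otimes> g) # p) = \<one>" using eq by (simp add: m_assoc)
    then show ?thesis using eval_alternating_neq_one merged ag by blast
  next
    case (Cons t q')
    obtain j h where t: "t = (j, h)" by (cases t)
    have h: "h \<in> F j" "h \<notin> A" "alternating q'" and Q: "set q' \<subseteq> syllables" "set q \<subseteq> syllables"
      using q Cons t alternating_syllables[of q'] alternating_syllables[of q] by (auto simp: alternating_Cons)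
    have hc [simp]: "h \<in> carrier G" "eval q' \<in> carrier G" "eval q \<in> carrier G"
      using h Q by auto
    have eq': "a \<otimes> (g \<otimes> eval p) = h \<otimes> eval q'" using eq Cons t by simp
    show ?thesis
    proof (cases "j = i")
      case False
      have "alternating (inv_seq q @ (i, a \<otimes> g) # p)"
        using q merged[of "a \<otimes> g"] ag Cons t False by (auto simp: alternating_append neq_iff_other)
      moreover have "eval (inv_seq q @ (i, a \<otimes> g) # p) = inv (eval q) \<otimes> eval q"
        using Q P ag eq by (simp add: m_assoc del: inv_seq_syllables) (simp add: m_assoc)
      ultimately show ?thesis using eval_alternating_neq_one[of "inv_seq q @ (i, a \<otimes> g) # p"] by simp
    next
      case True
      have "inv h \<otimes> a \<otimes> g \<in> A"
      proof (rule ccontr)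
        assume x: "inv h \<otimes> a \<otimes> g \<notin> A"
        have xF: "inv h \<otimes> a \<otimes> g \<in> F i" using h g a True by auto
        have "alternating (inv_seq q' @ (i, inv h \<otimes> a \<otimes> g) # p)"
          using q Cons t True merged[OF xF x] h
          by (cases "q' = []") (auto simp: alternating_append alternating_Cons)
        moreover have "eval (inv_seq q' @ (i, inv h \<otimes> a \<otimes> g) # p)
            = inv (eval q') \<otimes> (inv h \<otimes> (a \<otimes> (g \<otimes> eval p)))"
          using Q P xF by (simp add: m_assoc)
        moreover have "\<dots> = \<one>"
          unfolding eq' by (simp add: m_assoc[symmetric])
        ultimately show False
          using eval_alternating_neq_one[of "inv_seq q' @ (i, inv h \<otimes> a \<otimes> g) # p"] by simp
      qed
      then show ?thesis using Cons t True by blast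
    qed
  qed
qed

lemma alternating_eval_in_A:
  assumes "alternating q" "eval q \<in> A"
  shows "q = []"
proof (cases q)
  case (Cons t r)
  obtain i g where t: "t = (i, g)" by (cases t)
  have "eval q \<in> carrier G" using assms by simp
  then have "inv (eval q) \<otimes> eval ((i, g) # r) = eval []"
    using Cons t by (metis eval.simps(1) l_inv)
  then show ?thesis
    using alternating_compare[of i g r "[]" "inv (eval q)"] assms Cons t by auto
qed simp

text \<open>Two alternating spellings of one element have the same sides, and their partial products differ
  by elements of \<open>A\<close> on the right, which do not lead out of an orbit. So if one of them stays in \<open>E\<close>,
  so does the other. The element \<open>a\<close> is the difference accumulated so far.\<close>

lemma walk_transfer:
  assumes "saturated E" "v \<subseteq> carrier G" "walk E v q" "alternating q" "alternating p" "a \<in> A"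
    "a \<otimes> eval p = eval q" "p \<noteq> []"
  shows "walk E (v #> a) p"
  using assms(2-)
proof (induction p arbitrary: v q a)
  case (Cons s p)
  obtain i g where s: "s = (i, g)" by (cases s)
  obtain h q' where q: "q = (i, h) # q'" and b: "inv h \<otimes> a \<otimes> g \<in> A"
    using alternating_compare[of i g p q a] Cons.prems s by auto
  define b where "b = inv h \<otimes> a \<otimes> g"
  have g: "g \<in> F i" "alternating p" and h: "h \<in> F i" "alternating q'" and vi: "v \<in> E i"
    and wq: "walk E (v #> h) q'"
    using Cons.prems s q by (auto simp: alternating_Cons)
  have P: "set p \<subseteq> syllables" "set q' \<subseteq> syllables" using g h alternating_syllables by auto
  have c [simp]: "g \<in> carrier G" "h \<in> carrier G" "a \<in> carrier G" "b \<in> carrier G"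
      "eval p \<in> carrier G" "eval q' \<in> carrier G"
    using g h Cons.prems b P by (auto simp: b_def)
  have e: "a \<otimes> (g \<otimes> eval p) = h \<otimes> eval q'" using Cons.prems s q by simp
  have "b \<otimes> eval p = inv h \<otimes> (a \<otimes> (g \<otimes> eval p))" by (simp add: b_def m_assoc)
  also have "\<dots> = eval q'" unfolding e by (simp add: m_assoc[symmetric])
  finally have eb: "b \<otimes> eval p = eval q'" .
  have hb: "h \<otimes> b = a \<otimes> g" by (simp add: b_def m_assoc[symmetric])
  have "walk E (v #> h #> b) p"
  proof (cases "p = []")
    case False
    then show ?thesis
      using Cons.IH[of "v #> h" q' b] Cons.prems wq h g b eb by (auto simp: b_def)
  qed simp
  then have "walk E (v #> a #> g) p"
    using Cons.prems by (simp add: coset_mult_assoc hb)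
  moreover have "v #> a \<in> E i"
    using assms(1) vi Cons.prems saturated_act by auto
  ultimately show ?case using s g by simp
qed simp

end

locale amalgam_with_subgroup = amalgamated_product +
  fixes H :: "'a set"
  assumes H_subgroup: "subgroup H G"
begin

lemma H_carrier [simp]: "H \<subseteq> carrier G"
  using H_subgroup subgroup.subset by blast

lemma H_mem_carrier [simp]: "h \<in> H \<Longrightarrow> h \<in> carrier G"
  using H_carrier by blast

lemma H_act_iff: "x \<in> carrier G \<Longrightarrow> H #> x = H \<longleftrightarrow> x \<in> H"
  using H_subgroup coset_join1 coset_join2 is_group by (metis H_carrier)

text \<open>The orbits of \<open>F i\<close> that are visited, by a syllable on side \<open>i\<close>, on a closed normal path at the
  coset \<open>H\<close>.\<close>

definition core :: "side \<Rightarrow> 'a set set" where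
  "core i = {H #> eval p #> b | p g q b.
     normal_seq (p @ (i, g) # q) \<and> eval (p @ (i, g) # q) \<in> H \<and> b \<in> F i}"

text \<open>The conditions for a reduced precover, expressed by orbits. The first one excludes redundancy of
  a component that is the whole graph. The second one excludes redundancy of the component
  \<open>v F\<^sub>i\<close> with bichromatic vertex \<open>v\<close>: the group \<open>Lab(C, v)\<close> is the stabilizer of \<open>v\<close> in \<open>F i\<close>, the
  set \<open>VB(C)\<close> is \<open>v F\<^sub>i \<inter> E (other i)\<close>, and \<open>A(v)\<close> is \<open>vA\<close>. In the third one,
  both \<open>K \<inter> A\<close> and \<open>L \<inter> A\<close> are \<open>H \<inter> A\<close>.\<close>

definition reduced_system :: "(side \<Rightarrow> 'a set set) \<Rightarrow> bool" where
  "reduced_system E \<longleftrightarrow>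
     (\<forall>i. H \<in> E i \<longrightarrow> E (other i) = {} \<longrightarrow> H \<inter> F i \<noteq> {\<one>}) \<and>
     (\<forall>i. \<forall>v \<in> E i \<inter> E (other i).
        {g \<in> F i. v #> g = v} \<subseteq> A \<longrightarrow>
        (\<forall>g\<in>F i. v #> g \<in> E (other i) \<longrightarrow> v #> g \<in> (#>) v ` A) \<longrightarrow>
        (\<exists>g\<in>F i. H = v #> g) \<and> (H \<in> E (other i) \<longrightarrow> {g \<in> F i. v #> g = v} \<noteq> {\<one>})) \<and>
     (\<forall>i. H \<in> E i \<longrightarrow> H \<inter> A \<noteq> {\<one>} \<longrightarrow> H \<in> E (other i))"

definition spans :: "(side \<Rightarrow> 'a set set) \<Rightarrow> bool" where
  "spans E \<longleftrightarrow> (\<forall>h\<in>H. \<exists>p. walk E H p \<and> eval p = h)"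

definition reachable :: "(side \<Rightarrow> 'a set set) \<Rightarrow> bool" where
  "reachable E \<longleftrightarrow> (\<forall>i. \<forall>v\<in>E i. \<exists>p. walk E H p \<and> H #> eval p = v)"

text \<open>A closed walk in \<open>E\<close> with the same value exists and can be normalized. If both spellings are
  alternating, the walk transfers. If \<open>p\<close> is a single syllable in \<open>A\<close>, the walk may use the other
  side, and the base condition provides the side of \<open>p\<close>.\<close>

lemma normal_seq_walk:
  assumes E: "saturated E" "spans E"
    and A: "\<And>i. H \<in> E i \<Longrightarrow> H \<inter> A \<noteq> {\<one>} \<Longrightarrow> H \<in> E (other i)"
    and p: "normal_seq p" "eval p \<in> H"
  shows "walk E H p"
proof -
  obtain q0 where q0: "walk E H q0" "eval q0 = eval p" using E p unfolding spans_def by metis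
  then obtain q where q: "walk E H q" "eval q = eval p"
      "alternating q \<or> (\<exists>i. \<exists>a\<in>A. q = [(i, a)])"
    using walk_normalize[OF E(1) H_carrier] by metis
  show ?thesis
  proof (cases "alternating p")
    case True
    show ?thesis
    proof (cases "alternating q")
      case q': True
      show ?thesis
      proof (cases "p = []")
        case False
        have "eval p \<in> carrier G" using True alternating_syllables by simp
        then have "walk E (H #> \<one>) p"
          using walk_transfer[OF E(1) H_carrier q(1) q' True, of \<one>] False q by simp
        then show ?thesis by simp
      qed simp
    next
      case False
      then obtain j a where "a \<in> A" "q = [(j, a)]" using q(3) by blast
      then have "eval p \<in> A" using q(2) by simp
      then show ?thesis using True alternating_eval_in_A by fastforce
    qed
  next
    case False
    then obtain i g where g: "p = [(i, g)]" "g \<in> F i" "g \<noteq> \<one>" using p unfolding normal_seq_def by blast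
    with False have "g \<in> A" by simp
    then have "g \<in> H \<inter> A" and "eval q = g" using g p q by auto
    then have HA: "H \<inter> A \<noteq> {\<one>}" using g by auto
    have "\<not> alternating q"
    proof
      assume "alternating q"
      then have "q = []" using alternating_eval_in_A \<open>eval q = g\<close> \<open>g \<in> A\<close> by blast
      then show False using \<open>eval q = g\<close> g by simp
    qed
    then obtain j a where "q = [(j, a)]" using q(3) by blast
    then have "H \<in> E j" using q(1) by simp
    then have "H \<in> E i" using A[OF _ HA, of j] neq_iff_other[of i j] by (cases "i = j") auto
    then show ?thesis using g by simp
  qed
qed

lemma core_le:
  assumes E: "saturated E" "spans E"
    and A: "\<And>i. H \<in> E i \<Longrightarrow> H \<inter> A \<noteq> {\<one>} \<Longrightarrow> H \<in> E (other i)"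
  shows "core i \<subseteq> E i"
proof
  fix v assume "v \<in> core i"
  then obtain p g q b where v: "normal_seq (p @ (i, g) # q)" "eval (p @ (i, g) # q) \<in> H" "b \<in> F i"
      "v = H #> eval p #> b"
    unfolding core_def by blast
  then have "walk E H (p @ (i, g) # q)" using normal_seq_walk E A by blast
  then have "H #> eval p \<in> E i" by (simp add: walk_append)
  then show "v \<in> E i" using v E saturated_act by simp
qed

text \<open>A normal spelling of an element of \<open>H\<close> stays in the core by construction; the statement is
  about all its suffixes to allow induction.\<close>

lemma normal_seq_core_walk:
  assumes "normal_seq r" "eval r \<in> H" "r = p @ q"
  shows "walk core (H #> eval p) q"
  using assms(3)
proof (induction q arbitrary: p)
  case (Cons s q)
  obtain i g where s: "s = (i, g)" by (cases s)
  have S: "set p \<subseteq> syllables" "g \<in> F i" using normal_seq_syllables[OF assms(1)] Cons.prems s by auto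
  have "H #> eval p \<subseteq> carrier G" using S by simp
  then have "H #> eval p \<in> core i"
    unfolding core_def using assms Cons.prems s S
    by (intro CollectI exI[of _ p] exI[of _ g] exI[of _ q] exI[of _ \<one>]) (simp add: coset_mult_one)
  moreover have "walk core (H #> eval (p @ [s])) q"
    using Cons.IH[of "p @ [s]"] Cons.prems by simp
  moreover have "g \<in> carrier G" "set [(i,g)] \<subseteq> syllables" using S by auto
  ultimately show ?case using s S by (simp add: coset_mult_assoc)
qed simp

lemma saturated_core: "saturated core"
  unfolding saturated_def
proof (intro allI ballI conjI)
  fix i v assume "v \<in> core i"
  then obtain p g q b where v: "normal_seq (p @ (i, g) # q)" "eval (p @ (i, g) # q) \<in> H" "b \<in> F i"
      "v = H #> eval p #> b"
    unfolding core_def by blast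
  have p: "eval p \<in> carrier G" using normal_seq_syllables[OF v(1)] by simp
  then show "v \<subseteq> carrier G" using v by simp
  fix c assume c: "c \<in> F i"
  then have "v #> c = H #> eval p #> (b \<otimes> c)" using v p by (simp add: coset_mult_assoc m_assoc)
  then show "v #> c \<in> core i"
    unfolding core_def using v c F_mult by blast
qed

lemma normal_spelling:
  assumes "g \<in> carrier G"
  obtains p where "normal_seq p" "eval p = g"
proof -
  obtain p0 where p0: "set p0 \<subseteq> syllables" "eval p0 = g" using spelling_exists assms by blast
  define E :: "side \<Rightarrow> 'a set set" where "E = (\<lambda>_. Pow (carrier G))"
  have E: "saturated E" unfolding saturated_def E_def by auto
  have "walk E v p" if "set p \<subseteq> syllables" "v \<subseteq> carrier G" for v p
    using that by (induction p arbitrary: v) (auto simp: E_def)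
  then have "walk E H p0" using p0 by simp
  then obtain q where "eval q = g" "alternating q \<or> (\<exists>i. \<exists>a\<in>A. q = [(i, a)])"
    using walk_normalize[OF E H_carrier] p0 by metis
  then show thesis
  proof (elim disjE exE bexE)
    fix i a assume a: "a \<in> A" "q = [(i, a)]"
    show thesis
    proof (cases "a = \<one>")
      case True
      then show thesis using that[of "[]"] a \<open>eval q = g\<close> by (simp add: normal_seq_def)
    next
      case False
      then show thesis using that[of q] a \<open>eval q = g\<close> by (simp add: normal_seq_def)
    qed
  qed (use that in \<open>auto simp: normal_seq_def\<close>)
qed

lemma spans_core: "spans core"
  unfolding spans_def
proof
  fix h assume h: "h \<in> H"
  then obtain p where "normal_seq p" "eval p = h" using normal_spelling H_mem_carrier by blast
  then show "\<exists>p. walk core H p \<and> eval p = h"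
    using normal_seq_core_walk[of p "[]" p] h by auto
qed

lemma reachable_core: "reachable core"
  unfolding reachable_def
proof (intro allI ballI)
  fix i v assume "v \<in> core i"
  then obtain p g q b where v: "normal_seq (p @ (i, g) # q)" "eval (p @ (i, g) # q) \<in> H" "b \<in> F i"
      "v = H #> eval p #> b"
    unfolding core_def by blast
  have S: "set p \<subseteq> syllables" using normal_seq_syllables[OF v(1)] by simp
  have "walk core H (p @ (i, g) # q)" using normal_seq_core_walk[OF v(1,2), of "[]"] by simp
  then have "walk core H (p @ [(i, b)])" using v by (simp add: walk_append)
  moreover have "set [(i, b)] \<subseteq> syllables" using v by simp
  then have "H #> eval (p @ [(i, b)]) = v" using v S by (simp add: coset_mult_assoc)
  ultimately show "\<exists>p. walk core H p \<and> H #> eval p = v" by blast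
qed

lemma single_core:
  assumes "g \<in> H" "g \<in> F i" "g \<noteq> \<one>"
  shows "H \<in> core i"
proof -
  have "normal_seq [(i, g)]" using assms by (simp add: normal_seq_def)
  then have "walk core H [(i, g)]"
    using normal_seq_core_walk[of "[(i, g)]" "[]" "[(i, g)]"] assms by simp
  then show ?thesis by simp
qed


lemma core_vertex:
  assumes "normal_seq r" "eval r \<in> H" "r = p @ (i, g) # q"
  shows "H #> eval p \<in> core i"
  using normal_seq_core_walk[OF assms] by simp

lemma core_vertex_next:
  assumes "normal_seq r" "eval r \<in> H" "r = p @ (i, g) # q" "q \<noteq> []"
  shows "H #> eval p #> g \<in> core (other i)"
proof -
  obtain j h q' where q: "q = (j, h) # q'" using assms(4) by (metis list.exhaust prod.exhaust)
  have "alternating r" using assms q by (auto simp: normal_seq_def)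
  then have "j = other i" using assms q by (simp add: alternating_append alternating_Cons)
  then show ?thesis using normal_seq_core_walk[OF assms(1-3)] q by simp
qed

lemma core_vertex_prev:
  assumes "normal_seq r" "eval r \<in> H" "r = p @ (i, g) # q" "p \<noteq> []"
  shows "H #> eval p \<in> core (other i)"
proof -
  obtain p' j h where p: "p = p' @ [(j, h)]" using assms(4) by (metis rev_exhaust prod.exhaust)
  have r: "r = p' @ (j, h) # (i, g) # q" using assms p by simp
  have "alternating r" using assms p by (auto simp: normal_seq_def)
  then have "j = other i" using r by (simp add: alternating_append alternating_Cons)
  moreover have "set p' \<subseteq> syllables" "set [(j, h)] \<subseteq> syllables" "h \<in> F j"
    using normal_seq_syllables[OF assms(1)] r by auto
  moreover from this have "H #> eval p = H #> eval p' #> h"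
    using p by (simp add: coset_mult_assoc)
  ultimately show ?thesis
    using saturated_act[OF saturated_core core_vertex[OF assms(1,2) r]] by simp
qed

text \<open>Let \<open>g\<close> be a syllable of a closed normal sequence that passes through the orbit of \<open>v\<close>, from \<open>x\<close> to
  \<open>xg\<close>. Each of the two ends is bichromatic unless it is an end of the whole sequence, and is then
  \<open>H\<close>. If all bichromatic vertices of the orbit form \<open>vA\<close> and the stabilizer is in \<open>A\<close>, then two
  bichromatic ends force \<open>g \<in> A\<close>. This is impossible for an inner syllable, and for the only
  syllable of a sequence it contradicts a trivial stabilizer.\<close>

lemma reduced_core: "reduced_system core"
  unfolding reduced_system_def
proof (intro conjI allI impI ballI)
  fix i assume H: "H \<in> core i" and empty: "core (other i) = {}"
  obtain p g q where r: "normal_seq (p @ (i, g) # q)" "eval (p @ (i, g) # q) \<in> H"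
    using H unfolding core_def by blast
  have "p = []" "q = []"
    using core_vertex_prev[OF r HOL.refl] core_vertex_next[OF r HOL.refl] empty by auto
  then have "g \<in> F i" "g \<in> H" "g \<noteq> \<one>" using r by (auto simp: normal_seq_def)
  then show "H \<inter> F i \<noteq> {\<one>}" by blast
next
  fix i assume H: "H \<in> core i" and A: "H \<inter> A \<noteq> {\<one>}"
  have "\<one> \<in> H \<inter> A" using H_subgroup subgroup.one_closed by auto
  then obtain a where "a \<in> H" "a \<in> A" "a \<noteq> \<one>" using A by blast
  then show "H \<in> core (other i)" using single_core by auto
next
  fix i v assume v: "v \<in> core i \<inter> core (other i)"
    and VB: "\<forall>g\<in>F i. v #> g \<in> core (other i) \<longrightarrow> v #> g \<in> (#>) v ` A"
    and stab: "{g \<in> F i. v #> g = v} \<subseteq> A"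
  obtain p g q b where r: "normal_seq (p @ (i, g) # q)" "eval (p @ (i, g) # q) \<in> H" and b: "b \<in> F i"
    and vb: "v = H #> eval p #> b"
    using v unfolding core_def by blast
  define x where "x = H #> eval p"
  have S: "set p \<subseteq> syllables" "set q \<subseteq> syllables" "g \<in> F i" using normal_seq_syllables[OF r(1)] by auto
  then have c [simp]: "g \<in> carrier G" "b \<in> carrier G" "x \<subseteq> carrier G" "v \<subseteq> carrier G"
      "eval p \<in> carrier G"
    using b vb by (auto simp: x_def)
  have x: "x = v #> inv b" using vb by (simp add: x_def[symmetric] coset_mult_assoc)
  have xg: "x #> g = v #> (inv b \<otimes> g)" using x by (simp add: coset_mult_assoc)
  have F: "inv b \<in> F i" "inv b \<otimes> g \<in> F i" using b S by auto
  have x_end: "x = H" if "p = []" using that by (simp add: x_def)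
  have xg_end: "x #> g = H" if "q = []"
  proof -
    have "eval p \<otimes> g \<in> H" using r(2) that S by simp
    then show ?thesis using H_act_iff by (simp add: x_def coset_mult_assoc)
  qed
  have g_stab: "\<exists>a\<in>A. \<exists>c\<in>A. v #> (a \<otimes> g \<otimes> c) = v \<and> x = v #> a \<and> x #> g = v #> inv c"
    if bi: "x \<in> core (other i)" "x #> g \<in> core (other i)"
  proof -
    obtain a where a: "a \<in> A" "x = v #> a" using bspec[OF VB F(1)] bi(1) unfolding x by blast
    obtain c where c: "c \<in> A" "x #> g = v #> c" using bspec[OF VB F(2)] bi(2) unfolding xg by blast
    have "v #> (a \<otimes> g \<otimes> inv c) = v #> a #> g #> inv c"
      using a(1) c(1) by (simp add: coset_mult_assoc)
    also have "\<dots> = v #> c #> inv c" unfolding a(2)[symmetric] c(2) ..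
    also have "\<dots> = v" using c(1) by (simp add: coset_mult_assoc)
    finally show ?thesis using a c by (intro bexI[of _ a] bexI[of _ "inv c"]) auto
  qed
  have gA: "g \<in> A" if bi: "x \<in> core (other i)" "x #> g \<in> core (other i)"
  proof -
    obtain a c where ac: "a \<in> A" "c \<in> A" "v #> (a \<otimes> g \<otimes> c) = v" using g_stab[OF bi] by blast
    then have "a \<otimes> g \<otimes> c \<in> {g \<in> F i. v #> g = v}" using S by simp
    then have "a \<otimes> g \<otimes> c \<in> A" using stab by (rule rev_subsetD)
    then show ?thesis using ac by simp
  qed
  have short: "p = [] \<and> q = []" if "g \<in> A"
  proof -
    have "\<not> alternating (p @ (i, g) # q)" using that by (simp add: alternating_append alternating_Cons)
    then show ?thesis using r(1) by (auto simp: normal_seq_def append_eq_Cons_conv)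
  qed
  show "\<exists>g\<in>F i. H = v #> g"
  proof (rule ccontr)
    assume no: "\<not> ?thesis"
    have "p \<noteq> []"
    proof
      assume "p = []"
      then have "H = v #> inv b" using x_end x by simp
      with no F show False by blast
    qed
    moreover have "q \<noteq> []"
    proof
      assume "q = []"
      then have "H = v #> (inv b \<otimes> g)" using xg_end xg by simp
      with no F show False by blast
    qed
    ultimately have pq: "p \<noteq> []" "q \<noteq> []" by simp_all
    then have "g \<in> A"
      using gA core_vertex_prev[OF r HOL.refl] core_vertex_next[OF r HOL.refl] by (auto simp: x_def)
    with short pq show False by blast
  qed
  show "{g \<in> F i. v #> g = v} \<noteq> {\<one>}" if H: "H \<in> core (other i)"
  proof
    assume triv: "{g \<in> F i. v #> g = v} = {\<one>}"
    have bi: "x \<in> core (other i)" "x #> g \<in> core (other i)"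
      using H x_end core_vertex_prev[OF r HOL.refl] xg_end core_vertex_next[OF r HOL.refl]
      unfolding x_def by metis+
    have pq: "p = []" "q = []" using short gA[OF bi] by auto
    obtain a where a: "a \<in> A" "x = v #> a" using g_stab[OF bi] by blast
    have "v #> (a \<otimes> g \<otimes> inv a) = v #> a #> g #> inv a"
      using a(1) by (simp add: coset_mult_assoc)
    also have "\<dots> = v #> a #> inv a"
      unfolding a(2)[symmetric] using xg_end[OF pq(2)] x_end[OF pq(1)] by simp
    also have "\<dots> = v" using a(1) by (simp add: coset_mult_assoc)
    finally have "a \<otimes> g \<otimes> inv a = \<one>" using triv S a by auto
    moreover have "g = inv a \<otimes> (a \<otimes> g \<otimes> inv a) \<otimes> a"
      using a by (simp add: m_assoc) (simp add: m_assoc[symmetric])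
    ultimately have "g = \<one>" using a by simp
    then show False using r(1) pq by (auto simp: normal_seq_def)
  qed
qed

definition finite_orbits :: "(side \<Rightarrow> 'a set set) \<Rightarrow> bool" where
  "finite_orbits E \<longleftrightarrow> (\<forall>i. finite ((\<lambda>v. (#>) v ` F i) ` E i))"

lemma orbit_act:
  assumes "v \<subseteq> carrier G" "b \<in> F i"
  shows "(#>) (v #> b) ` F i = (#>) v ` F i"
proof -
  have "v #> b #> c \<in> (#>) v ` F i" if "c \<in> F i" for c
    using that assms by (auto simp: coset_mult_assoc)
  moreover have "v #> c \<in> (#>) (v #> b) ` F i" if "c \<in> F i" for c
  proof -
    have "v #> c = v #> b #> (inv b \<otimes> c)"
      using that assms by (simp add: coset_mult_assoc m_assoc[symmetric])
    then show ?thesis using that assms by (intro image_eqI[of _ _ "inv b \<otimes> c"]) simp_all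
  qed
  ultimately show ?thesis by auto
qed

lemma walk_inv_seq:
  assumes "saturated E" "v \<subseteq> carrier G" "walk E v p"
  shows "walk E (v #> eval p) (inv_seq p)"
  using assms(2,3)
proof (induction p arbitrary: v)
  case (Cons s p)
  obtain i g where s: "s = (i, g)" by (cases s)
  have g: "v \<in> E i" "g \<in> F i" "walk E (v #> g) p" using Cons.prems s by auto
  have p: "set p \<subseteq> syllables" using g walk_syllables by blast
  have c: "g \<in> carrier G" "eval p \<in> carrier G" using g p by auto
  have "walk E (v #> g #> eval p) (inv_seq p)" using Cons.IH[of "v #> g"] g Cons.prems c by simp
  moreover have "v #> g #> eval p #> eval (inv_seq p) = v #> g"
    using c p Cons.prems by (simp add: coset_mult_assoc m_assoc)
  moreover have "v #> g \<in> E i" using saturated_act assms(1) g by blast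
  moreover have "inv_seq (s # p) = inv_seq p @ [(i, inv g)]" by (simp add: inv_seq_def s)
  ultimately show ?case
    using g s c Cons.prems by (simp add: walk_append coset_mult_assoc)
qed (simp add: inv_seq_def)

text \<open>The orbits visited by normal spellings of finitely many generators already span \<open>H\<close>, so the core
  lies in their union.\<close>

lemma finite_orbits_core:
  assumes "fin_gen G H"
  shows "finite_orbits core"
proof -
  obtain S where S: "finite S" "S \<subseteq> carrier G" "generate G S = H"
    using assms unfolding fin_gen_def by blast
  have "\<forall>s\<in>S. \<exists>p. normal_seq p \<and> eval p = s" using S normal_spelling by blast
  then obtain P where P: "\<And>s. s \<in> S \<Longrightarrow> normal_seq (P s) \<and> eval (P s) = s" by metis
  \<comment> \<open>start vertices of the syllables of the chosen spellings, given by prefixes; the empty prefix gives the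
    orbits of \<open>H\<close> on both sides, so that the base condition of \<open>core_le\<close> holds\<close>
  define Q where "Q = insert [] (\<Union>s\<in>S. (\<lambda>n. take n (P s)) ` {..length (P s)})"
  have Q: "p \<in> Q" if "s \<in> S" "P s = p @ q" for s p q
  proof -
    have "p = take (length p) (P s)" "length p \<le> length (P s)" using that by simp_all
    then show ?thesis unfolding Q_def using that(1) by blast
  qed
  have "finite Q" using S by (auto simp: Q_def)
  have Qs: "set p \<subseteq> syllables" if "p \<in> Q" for p
    using that P normal_seq_syllables unfolding Q_def by (auto dest!: in_set_takeD)
  define E where "E i = {H #> eval p #> b | p b. p \<in> Q \<and> b \<in> F i}" for i
  have sat: "saturated E"
    unfolding saturated_def
  proof (intro allI ballI conjI)
    fix i v assume "v \<in> E i"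
    then obtain p b where v: "p \<in> Q" "b \<in> F i" "v = H #> eval p #> b" unfolding E_def by blast
    have p: "eval p \<in> carrier G" using Qs v by simp
    then show "v \<subseteq> carrier G" using v by simp
    fix c assume c: "c \<in> F i"
    have "v #> c = H #> eval p #> (b \<otimes> c)" using v c p by (simp add: coset_mult_assoc m_assoc)
    then show "v #> c \<in> E i" unfolding E_def using v c F_mult by blast
  qed
  have EQ: "H #> eval p \<in> E i" if "p \<in> Q" for p i
    unfolding E_def using that Qs coset_mult_one[of "H #> eval p"]
    by (intro CollectI exI[of _ p] exI[of _ \<one>]) simp
  have "walk E (H #> eval p) q" if "s \<in> S" "P s = p @ q" for s p q
    using that
  proof (induction q arbitrary: p)
    case (Cons t q)
    obtain i g where t: "t = (i, g)" by (cases t)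
    have g: "set p \<subseteq> syllables" "g \<in> F i" "set [(i, g)] \<subseteq> syllables"
      using normal_seq_syllables[of "P s"] P[OF Cons.prems(1)] Cons.prems(2) t by auto
    have "walk E (H #> eval (p @ [t])) q" using Cons.IH[of "p @ [t]"] Cons.prems by simp
    moreover have "H #> eval p \<in> E i" using EQ Q Cons.prems by blast
    ultimately show ?case using g t by (simp add: coset_mult_assoc)
  qed simp
  from this[of _ "[]"] have walkS: "walk E H (P s)" if "s \<in> S" for s using that by simp
  have "\<exists>p. walk E H p \<and> eval p = h" if "h \<in> generate G S" for h
    using that
  proof induction
    case one
    show ?case by (intro exI[of _ "[]"]) simp
  next
    case (incl h)
    then show ?case using walkS P by blast
  next
    case (inv h)
    have "walk E (H #> h) (inv_seq (P h))" "eval (inv_seq (P h)) = inv h"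
      using walk_inv_seq[OF sat H_carrier walkS[OF inv]] P[OF inv] normal_seq_syllables by auto
    moreover have "H #> h = H" using inv S generate.incl H_act_iff by (metis subsetD)
    ultimately show ?case by auto
  next
    case (eng h1 h2)
    then obtain p1 p2 where p: "walk E H p1" "eval p1 = h1" "walk E H p2" "eval p2 = h2" by blast
    have "H #> h1 = H" using eng S H_act_iff by auto
    then have "walk E H (p1 @ p2)" using p by (simp add: walk_append)
    moreover have "eval (p1 @ p2) = h1 \<otimes> h2" using p walk_syllables by simp
    ultimately show ?case by blast
  qed
  then have "spans E" using S unfolding spans_def by blast
  moreover have "H \<in> E i" for i using EQ[of "[]" i] by (simp add: Q_def)
  ultimately have le: "core i \<subseteq> E i" for i using core_le sat by blast
  show ?thesis
    unfolding finite_orbits_def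
  proof
    fix i
    have "(\<lambda>v. (#>) v ` F i) ` core i \<subseteq> (\<lambda>p. (#>) (H #> eval p) ` F i) ` Q"
    proof
      fix O' assume "O' \<in> (\<lambda>v. (#>) v ` F i) ` core i"
      then obtain p b where "p \<in> Q" "b \<in> F i" "O' = (#>) (H #> eval p #> b) ` F i"
        using le[of i] unfolding E_def by blast
      then show "O' \<in> (\<lambda>p. (#>) (H #> eval p) ` F i) ` Q" using Qs orbit_act by simp
    qed
    then show "finite ((\<lambda>v. (#>) v ` F i) ` core i)"
      using \<open>finite Q\<close> finite_surj by blast
  qed
qed



section \<open>Reduced systems of orbits\<close>

definition dist :: "(side \<Rightarrow> 'a set set) \<Rightarrow> 'a set set \<Rightarrow> nat" where
  "dist E O' = (LEAST n. \<exists>p. walk E H p \<and> length p = n \<and> H #> eval p \<in> O')"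

lemma dist_le: "walk E H p \<Longrightarrow> H #> eval p \<in> O' \<Longrightarrow> dist E O' \<le> length p"
  unfolding dist_def by (rule Least_le) blast

text \<open>A shortest walk to the orbit of \<open>v\<close> is alternating, since it could be normalized otherwise, and
  enters the orbit from the other side, since a last step inside the orbit could be omitted.\<close>

lemma shortest_walk:
  assumes E: "saturated E" "reachable E" and v: "v \<in> E i"
  obtains p where "walk E H p" "alternating p" "length p = dist E ((#>) v ` F i)"
    "H #> eval p \<in> (#>) v ` F i" "p \<noteq> [] \<Longrightarrow> fst (last p) = other i"
proof -
  let ?O = "(#>) v ` F i"
  have vc: "v \<subseteq> carrier G" using E(1) v unfolding saturated_def by blast
  have closed: "w #> g \<in> ?O" if w: "w \<in> ?O" and g: "g \<in> F i" for w g
  proof -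
    obtain b where "b \<in> F i" "w = v #> b" using w by blast
    then have "w #> g = v #> (b \<otimes> g)" "b \<otimes> g \<in> F i" using g vc by (simp_all add: coset_mult_assoc)
    then show ?thesis by simp
  qed
  have "v \<in> ?O" using vc coset_mult_one[of v] F_one by (metis image_eqI)
  moreover obtain p0 where "walk E H p0" "H #> eval p0 = v"
    using E(2) v unfolding reachable_def by metis
  ultimately have "\<exists>n p. walk E H p \<and> length p = n \<and> H #> eval p \<in> ?O" by metis
  from LeastI_ex[OF this] have "\<exists>p. walk E H p \<and> length p = dist E ?O \<and> H #> eval p \<in> ?O"
    unfolding dist_def .
  then obtain p1 where p1: "walk E H p1" "length p1 = dist E ?O" "H #> eval p1 \<in> ?O" by blast
  obtain p where p: "walk E H p" "eval p = eval p1" "length p \<le> length p1"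
      "alternating p \<or> (\<exists>i. \<exists>a\<in>A. p = [(i, a)])"
    using walk_normalize[OF E(1) H_carrier p1(1)] by blast
  have len: "length p = dist E ?O" using dist_le[OF p(1), of ?O] p(2,3) p1 by simp
  have end': "H #> eval p \<in> ?O" using p(2) p1(3) by simp
  have "alternating p"
  proof (rule ccontr)
    assume "\<not> alternating p"
    then obtain k a where a: "a \<in> A" "p = [(k, a)]" using p(4) by blast
    have "H #> a \<in> ?O" using end' a by simp
    then have "H #> a #> inv a \<in> ?O" using closed a by simp
    then have "H \<in> ?O" using a by (simp add: coset_mult_assoc)
    then have "dist E ?O \<le> 0" using dist_le[of E "[]"] by simp
    then show False using len a by simp
  qed
  moreover have "fst (last p) = other i" if ne: "p \<noteq> []"
  proof (rule ccontr)
    assume "fst (last p) \<noteq> other i"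
    then have "fst (last p) = i" using neq_iff_other[of "fst (last p)" "other i"] by simp
    then obtain q g where q: "p = q @ [(i, g)]"
      using ne by (metis append_butlast_last_id prod.collapse)
    have g: "g \<in> F i" "set q \<subseteq> syllables" "set [(i, g)] \<subseteq> syllables" "walk E H q"
      using p(1) q walk_syllables[OF p(1)] by (auto simp: walk_append)
    have "H #> eval p #> inv g \<in> ?O" by (rule closed[OF end' F_inv[OF g(1)]])
    then have "H #> eval q \<in> ?O" using g q by (simp add: coset_mult_assoc m_assoc)
    then have "dist E ?O \<le> length q" using dist_le g by blast
    then show False using len q by simp
  qed
  ultimately show thesis using that p(1) len end' by blast
qed

lemma closed_alternating_core:
  assumes "alternating (p @ (i, g) # q)" "eval (p @ (i, g) # q) \<in> H"
  shows "H #> eval p \<in> core i"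
  using core_vertex[OF _ assms(2) HOL.refl] assms(1) by (simp add: normal_seq_def)

text \<open>Among the orbits of \<open>E\<close> outside the core, let that of \<open>\<theta>\<close>, on side \<open>i\<close>, have maximal distance from
  \<open>H\<close>, where \<open>p\<close> is a shortest walk to \<open>\<theta>\<close>. As \<open>E\<close> is reduced, this orbit has an exit \<open>\<theta>g\<close> to the
  other side with \<open>g \<notin> A\<close> (a loop outside \<open>A\<close> would give the closed normal walk \<open>p g p\<^sup>-\<^sup>1\<close>). The orbit
  behind this exit is in the core: otherwise its distance is not larger, so a shortest walk \<open>q\<close> to
  it does not come through the orbit of \<open>\<theta>\<close>, and \<open>p g h q\<^sup>-\<^sup>1\<close> is a closed normal walk through \<open>\<theta>\<close> for some
  \<open>h\<close>. But then a closed normal walk reaches that orbit, and its initial part, in place of \<open>q\<close>, again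
  closes up to one through \<open>\<theta>\<close>.\<close>

lemma system_eq_core:
  assumes E: "saturated E" "spans E" "reachable E" "finite_orbits E"
    and red: "reduced_system E"
  shows "E = core"
proof -
  have red1: "H \<inter> F i \<noteq> {\<one>}" if "H \<in> E i" "E (other i) = {}" for i
    using red that unfolding reduced_system_def by blast
  have red2: "(\<exists>g\<in>F i. H = v #> g) \<and> (H \<in> E (other i) \<longrightarrow> {g \<in> F i. v #> g = v} \<noteq> {\<one>})"
    if "v \<in> E i" "v \<in> E (other i)" "{g \<in> F i. v #> g = v} \<subseteq> A"
      "\<forall>g\<in>F i. v #> g \<in> E (other i) \<longrightarrow> v #> g \<in> (#>) v ` A" for i v
    using red that unfolding reduced_system_def by blast
  have red3: "H \<in> E (other i)" if "H \<in> E i" "H \<inter> A \<noteq> {\<one>}" for i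
    using red that unfolding reduced_system_def by blast
  have core_sub: "core i \<subseteq> E i" for i using core_le[OF E(1,2) red3] .
  have "E i \<subseteq> core i" for i
  proof (rule ccontr)
    assume "\<not> E i \<subseteq> core i"
    then obtain v0 where v0: "v0 \<in> E i - core i" by blast
    \<comment> \<open>the distance depends on the orbit only, so it takes finitely many values\<close>
    define d where "d = (\<lambda>(i, v). dist E ((#>) v ` F i))"
    define B where "B = (SIGMA i:UNIV. E i - core i)"
    have "d ` B \<subseteq> (\<Union>i\<in>{F1, F2}. dist E ` (\<lambda>v. (#>) v ` F i) ` E i)"
    proof
      fix n assume "n \<in> d ` B"
      then obtain i v where "v \<in> E i" "n = dist E ((#>) v ` F i)" by (auto simp: d_def B_def)
      then show "n \<in> (\<Union>i\<in>{F1, F2}. dist E ` (\<lambda>v. (#>) v ` F i) ` E i)"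
        by (cases i) auto
    qed
    moreover have "finite (\<Union>i\<in>{F1, F2}. dist E ` (\<lambda>v. (#>) v ` F i) ` E i)"
      using E(4) unfolding finite_orbits_def by blast
    ultimately have fin: "finite (d ` B)" by (rule finite_subset)
    have "(i, v0) \<in> B" using v0 by (simp add: B_def)
    then have "Max (d ` B) \<in> d ` B" using fin by (intro Max_in) auto
    then obtain i v where iv: "(i, v) \<in> B" "d (i, v) = Max (d ` B)" by auto
    have max: "d (j, w) \<le> d (i, v)" if "w \<in> E j" "w \<notin> core j" for j w
      unfolding iv(2) using fin that by (intro Max_ge) (auto simp: B_def)
    have v: "v \<in> E i" "v \<notin> core i" using iv by (auto simp: B_def)
    have vc: "v \<subseteq> carrier G" using E(1) v unfolding saturated_def by blast
    obtain p where p: "walk E H p" "alternating p" "length p = d (i, v)"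
        "H #> eval p \<in> (#>) v ` F i" and last_p: "p \<noteq> [] \<Longrightarrow> fst (last p) = other i"
      using shortest_walk[OF E(1,3) v(1)] by (auto simp: d_def)
    define \<theta> where "\<theta> = H #> eval p"
    have Sp: "set p \<subseteq> syllables" and pc [simp]: "eval p \<in> carrier G"
      using alternating_syllables[OF p(2)] by auto
    have \<theta>c [simp]: "\<theta> \<subseteq> carrier G" by (simp add: \<theta>_def)
    obtain b where b: "b \<in> F i" "\<theta> = v #> b" using p(4) by (auto simp: \<theta>_def)
    have orbit: "(#>) \<theta> ` F i = (#>) v ` F i" using orbit_act[OF vc] b by simp
    have \<theta>: "\<theta> \<in> E i" "\<theta> \<notin> core i"
      using saturated_act_iff[OF E(1) vc b(1)] saturated_act_iff[OF saturated_core vc b(1)] v b by auto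
    have not_core: False if "w \<in> core i" "w = \<theta> #> g" "g \<in> F i" for w g
      using saturated_act_iff[OF saturated_core \<theta>c, of g i] that \<theta> by simp
    have no_shorter: "length p \<le> length q" if "walk E H q" "H #> eval q = \<theta> #> g" "g \<in> F i" for q g
    proof -
      have "H #> eval q \<in> (#>) v ` F i" using that orbit by auto
      then show ?thesis using dist_le[OF that(1)] p(3) by (simp add: d_def)
    qed
    have H_orbit: "p = []" if "H = \<theta> #> g" "g \<in> F i" for g
      using no_shorter[of "[]" g] that by simp
    \<comment> \<open>the exit; the last clause says that the base vertex is not behind the exit already, up to \<open>A\<close>;
      it has content if \<open>H\<close> lies in the orbit of \<open>\<theta>\<close>, that is for empty \<open>p\<close>\<close>
    have "\<exists>g\<in>F i. g \<notin> A \<and> \<theta> #> g \<in> E (other i) \<and> H \<notin> (#>) (\<theta> #> g) ` A"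
    proof (cases "p = []")
      case False
      obtain q j x where q: "p = q @ [(j, x)]"
        using False by (metis rev_exhaust prod.exhaust)
      then have j: "j = other i" using last_p by simp
      have x: "x \<in> F j" "H #> eval q \<in> E j" using p(1) q by (auto simp: walk_append)
      have "set q \<subseteq> syllables" "set [(j, x)] \<subseteq> syllables" using Sp q by auto
      then have "\<theta> = H #> eval q #> x" using q x by (simp add: \<theta>_def coset_mult_assoc)
      then have \<theta>j: "\<theta> \<in> E (other i)" using saturated_act[OF E(1) x(2,1)] j by simp
      have "{g \<in> F i. \<theta> #> g = \<theta>} \<subseteq> A"
      proof (rule ccontr)
        assume "\<not> ?thesis"
        then obtain g where g: "g \<in> F i" "\<theta> #> g = \<theta>" "g \<notin> A" by blast
        have "alternating (p @ (i, g) # inv_seq p)"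
          using p(2) g False last_p by (simp add: alternating_append alternating_Cons)
        moreover have "eval (p @ (i, g) # inv_seq p) \<in> H"
        proof -
          have "H #> (eval p \<otimes> g \<otimes> inv (eval p)) = \<theta> #> g #> inv (eval p)"
            using g(1) by (simp add: \<theta>_def coset_mult_assoc m_assoc)
          also have "\<dots> = H" unfolding g(2) by (simp add: \<theta>_def coset_mult_assoc)
          finally have "eval p \<otimes> g \<otimes> inv (eval p) \<in> H" using g(1) H_act_iff by simp
          then show ?thesis using Sp g(1) by (simp add: m_assoc)
        qed
        ultimately show False
          using closed_alternating_core \<theta>(2) unfolding \<theta>_def by blast
      qed
      then obtain g where g: "g \<in> F i" "\<theta> #> g \<in> E (other i)" "\<theta> #> g \<notin> (#>) \<theta> ` A"
        using red2[OF \<theta>(1) \<theta>j] H_orbit False by blast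
      have "H \<noteq> \<theta> #> g #> a" if "a \<in> A" for a
        using H_orbit[of "g \<otimes> a"] False that g by (auto simp: coset_mult_assoc)
      then show ?thesis using g by blast
    next
      case True
      then have \<theta>H: "\<theta> = H" by (simp add: \<theta>_def)
      have "\<one> \<in> H" using H_subgroup subgroup.one_closed by auto
      then have triv: "H \<inter> F i = {\<one>}" using single_core[of _ i] \<theta>(2) \<theta>H by auto
      have stab_iff: "g \<in> {g \<in> F i. H #> g = H} \<longleftrightarrow> g \<in> H \<inter> F i" for g
        by (cases "g \<in> F i") (simp_all add: H_act_iff)
      have stab: "{g \<in> F i. H #> g = H} = {\<one>}"
        unfolding triv[symmetric] by (rule Set.set_eqI) (rule stab_iff)
      have "\<exists>g\<in>F i. g \<notin> A \<and> H #> g \<in> E (other i)"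
      proof (cases "H \<in> E (other i)")
        case True
        have HE: "H \<in> E i" using \<theta>(1) \<theta>H by simp
        show ?thesis
        proof (rule ccontr)
          assume "\<not> ?thesis"
          then have "\<forall>g\<in>F i. H #> g \<in> E (other i) \<longrightarrow> H #> g \<in> (#>) H ` A" by auto
          moreover have "{g \<in> F i. H #> g = H} \<subseteq> A" unfolding stab by simp
          ultimately show False using red2[OF HE True] True stab by metis
        qed
      next
        case False
        have "\<exists>g\<in>F i. H #> g \<in> E (other i)"
        proof (rule ccontr)
          assume no: "\<not> ?thesis"
          \<comment> \<open>without an exit a walk from \<open>H\<close> never leaves the orbit of \<open>H\<close>\<close>
          have stay: "\<exists>c\<in>F i. H #> (b \<otimes> eval r) = H #> c" if "walk E (H #> b) r" "b \<in> F i" for b r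
            using that
          proof (induction r arbitrary: b)
            case Nil
            then show ?case by auto
          next
            case (Cons s r)
            obtain k x where s: "s = (k, x)" by (cases s)
            have "k = i" using Cons.prems s no neq_iff_other[of k i] by auto
            moreover have "set r \<subseteq> syllables" using Cons.prems(1) walk_syllables by fastforce
            moreover from calculation Cons.prems s have x: "x \<in> F i" by simp
            moreover have "walk E (H #> (b \<otimes> x)) r"
              using Cons.prems s x by (simp add: coset_mult_assoc)
            ultimately have "\<exists>c\<in>F i. H #> (b \<otimes> x \<otimes> eval r) = H #> c"
              using Cons.IH[of "b \<otimes> x"] Cons.prems(2) by simp
            then show ?case
              using Cons.prems(2) s x \<open>set r \<subseteq> syllables\<close> by (simp add: m_assoc)
          qed
          have "E (other i) = {}"
          proof (rule ccontr)
            assume "E (other i) \<noteq> {}"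
            then obtain w q where q: "w \<in> E (other i)" "walk E H q" "H #> eval q = w"
              using E(3) unfolding reachable_def by blast
            have "set q \<subseteq> syllables" using q walk_syllables by blast
            then obtain c where "c \<in> F i" "w = H #> c" using stay[of \<one> q] q by auto
            then show False using no q(1) by metis
          qed
          then show False using red1[of i] \<theta> \<theta>H triv by simp
        qed
        then obtain g where g: "g \<in> F i" "H #> g \<in> E (other i)" by blast
        then have "g \<notin> A" using saturated_act_iff[OF E(1) H_carrier, of g "other i"] False by auto
        then show ?thesis using g by blast
      qed
      then obtain g where g: "g \<in> F i" "g \<notin> A" "H #> g \<in> E (other i)" by blast
      have "H \<noteq> H #> g #> a" if "a \<in> A" for a
      proof
        assume "H = H #> g #> a"
        then have "g \<otimes> a \<in> H" using g that by (simp add: coset_mult_assoc H_act_iff[symmetric])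
        then have "g \<otimes> a \<in> H \<inter> F i" using g that by simp
        then have "g \<otimes> a = \<one>" unfolding triv by simp
        then have "g \<otimes> a \<in> A" by simp
        then show False using g that by simp
      qed
      then show ?thesis using g \<theta>H by blast
    qed
    then obtain g where g: "g \<in> F i" "g \<notin> A" "\<theta> #> g \<in> E (other i)"
      and Hg: "\<And>a. a \<in> A \<Longrightarrow> H \<noteq> \<theta> #> g #> a" by blast
    define s where "s = p @ [(i, g)]"
    have s: "alternating s" using p(2) g last_p by (cases "p = []") (auto simp: s_def alternating_append)
    have Ss: "set s \<subseteq> syllables" using alternating_syllables[OF s] .
    have sc: "eval s = eval p \<otimes> g" using Sp g by (simp add: s_def)
    have H_s: "H #> eval s = \<theta> #> g" using g by (simp add: sc \<theta>_def coset_mult_assoc)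
    \<comment> \<open>a walk \<open>r\<close> to the orbit behind the exit that ends properly there, not at \<open>A(\<theta>g)\<close>, closes
      \<open>p g\<close> up to a normal walk through \<open>\<theta>\<close>\<close>
    have close_up: False if r: "alternating r" "r = [] \<or> fst (last r) = i" and h: "h \<in> F (other i)" "h \<notin> A"
      and eq: "H #> eval r = \<theta> #> g #> h" for r h
    proof -
      have Sr: "set r \<subseteq> syllables" using r alternating_syllables by blast
      have "alternating (p @ (i, g) # (other i, h) # inv_seq r)"
        using p(2) g last_p r h
        by (cases "r = []"; cases "p = []") (auto simp: alternating_append alternating_Cons)
      moreover have "eval (p @ (i, g) # (other i, h) # inv_seq r) \<in> H"
      proof -
        have rc: "eval r \<in> carrier G" using Sr by simp
        have "H #> (eval p \<otimes> g \<otimes> h \<otimes> inv (eval r)) = \<theta> #> g #> h #> inv (eval r)"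
          using rc g h by (simp add: \<theta>_def coset_mult_assoc m_assoc)
        also have "\<dots> = H" using rc unfolding eq[symmetric] by (simp add: coset_mult_assoc)
        finally have "eval p \<otimes> g \<otimes> h \<otimes> inv (eval r) \<in> H"
          using rc g h H_act_iff by simp
        then show ?thesis using Sp Sr g h by (simp add: m_assoc)
      qed
      ultimately show False
        using closed_alternating_core \<theta>(2) unfolding \<theta>_def by blast
    qed
    have "\<theta> #> g \<in> core (other i)"
    proof (rule ccontr)
      assume out: "\<theta> #> g \<notin> core (other i)"
      obtain q where q: "walk E H q" "alternating q" "length q = d (other i, \<theta> #> g)"
          "H #> eval q \<in> (#>) (\<theta> #> g) ` F (other i)" "q \<noteq> [] \<Longrightarrow> fst (last q) = i"
        using shortest_walk[OF E(1,3) g(3)] by (auto simp: d_def)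
      obtain h where h: "h \<in> F (other i)" "H #> eval q = \<theta> #> g #> h" using q(4) by blast
      have "h \<in> A" using close_up[OF q(2) _ h(1) _ h(2)] q(5) by blast
      have len: "length q \<le> length p" using max[OF g(3) out] q(3) p(3) by simp
      show False
      proof (cases "q = []")
        case True
        then show False using h Hg[OF \<open>h \<in> A\<close>] by simp
      next
        case False
        then obtain r x where r: "q = r @ [(i, x)]"
          using q(5) by (metis append_butlast_last_id prod.collapse)
        have x: "x \<in> F i" "walk E H r" "set r \<subseteq> syllables" "set [(i, x)] \<subseteq> syllables"
          using q(1) r walk_syllables[OF q(1)] by (auto simp: walk_append)
        have "H #> eval r = H #> eval q #> inv x" using x r by (simp add: coset_mult_assoc m_assoc)
        also have "\<dots> = \<theta> #> (g \<otimes> h \<otimes> inv x)"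
          unfolding h(2) using g x \<open>h \<in> A\<close> by (simp add: coset_mult_assoc m_assoc)
        \<comment> \<open>the last step of \<open>q\<close> is in the orbit of \<open>\<theta>\<close>, which \<open>q\<close> thus reaches too early\<close>
        finally have "length p \<le> length r" using no_shorter[OF x(2)] g x \<open>h \<in> A\<close> by simp
        then show False using len r by simp
      qed
    qed
    then obtain q1 h q2 b where q: "normal_seq (q1 @ (other i, h) # q2)" "eval (q1 @ (other i, h) # q2) \<in> H"
        "b \<in> F (other i)" "\<theta> #> g = H #> eval q1 #> b"
      unfolding core_def by blast
    have S1: "set q1 \<subseteq> syllables" using normal_seq_syllables[OF q(1)] by simp
    have x: "H #> eval q1 = \<theta> #> g #> inv b" unfolding q(4) using q(3) S1 by (simp add: coset_mult_assoc m_assoc)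
    have q1: "alternating q1" "q1 = [] \<or> fst (last q1) = i"
      using q(1) by (auto simp: normal_seq_def alternating_append append_eq_Cons_conv)
    have "inv b \<in> A" using close_up[OF q1 F_inv[OF q(3)] _ x] by blast
    show False
    proof (cases "q1 = []")
      case True
      then show False using x Hg[OF \<open>inv b \<in> A\<close>] by simp
    next
      case False
      then obtain r y where r: "q1 = r @ [(i, y)]"
        using q1(2) by (metis append_butlast_last_id prod.collapse)
      have y: "y \<in> F i" "set r \<subseteq> syllables" "set [(i, y)] \<subseteq> syllables" using S1 r by auto
      \<comment> \<open>here the closed walk enters through \<open>A(\<theta>g)\<close>, so its previous syllable is in the orbit of \<open>\<theta>\<close>\<close>
      have "H #> eval r \<in> core i"
        using core_vertex[OF q(1,2), of r i y] r by simp
      moreover have "H #> eval r = H #> eval q1 #> inv y"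
        using y r by (simp add: coset_mult_assoc m_assoc)
      moreover have "\<dots> = \<theta> #> (g \<otimes> inv b \<otimes> inv y)"
        unfolding x using g y q(3) by (simp add: coset_mult_assoc m_assoc)
      moreover have "g \<otimes> inv b \<otimes> inv y \<in> F i" using g y \<open>inv b \<in> A\<close> by simp
      ultimately show False using not_core by metis
    qed
  qed
  then show ?thesis using core_sub by blast
qed

end


section \<open>Van der Waerden's action on normal forms\<close>

text \<open>Here \<open>A\<close> is the amalgamated group itself and \<open>\<phi> i\<close> its embedding in the factor \<open>K i\<close>. A formal
  normal form is an element of \<open>A\<close> followed by transversal elements of \<open>A\<close> in the factors, on
  alternating sides.\<close>

locale amalgam_of_groups = A: group A for A (structure) +
  fixes K :: "side \<Rightarrow> ('g, 'm) monoid_scheme" and \<phi> :: "side \<Rightarrow> 'a \<Rightarrow> 'g"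
  assumes K_group: "\<And>i. group (K i)"
    and \<phi>_mon: "\<And>i. \<phi> i \<in> mon A (K i)"
begin

sublocale K: group "K i" for i by (rule K_group)

lemma \<phi>_closed [simp]: "a \<in> carrier A \<Longrightarrow> \<phi> i a \<in> carrier (K i)"
  using \<phi>_mon[of i] by (auto simp: mon_def hom_def)

lemma \<phi>_mult [simp]:
  "a \<in> carrier A \<Longrightarrow> b \<in> carrier A \<Longrightarrow> \<phi> i (a \<otimes> b) = \<phi> i a \<otimes>\<^bsub>K i\<^esub> \<phi> i b"
  using \<phi>_mon[of i] by (auto simp: mon_def hom_def)

lemma \<phi>_inj: "inj_on (\<phi> i) (carrier A)"
  using \<phi>_mon[of i] by (auto simp: mon_def)

lemma \<phi>_one [simp]: "\<phi> i \<one> = \<one>\<^bsub>K i\<^esub>"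
  using K.l_cancel_one[of "\<phi> i \<one>" i "\<phi> i \<one>"] \<phi>_mult[of \<one> \<one> i] by simp

lemma \<phi>_inv_mult [simp]:
  "a \<in> carrier A \<Longrightarrow> g \<in> carrier (K i) \<Longrightarrow> \<phi> i (inv a) \<otimes>\<^bsub>K i\<^esub> (\<phi> i a \<otimes>\<^bsub>K i\<^esub> g) = g"
  by (simp add: K.m_assoc[symmetric] flip: \<phi>_mult)

lemma \<phi>_mult_inv [simp]:
  "a \<in> carrier A \<Longrightarrow> g \<in> carrier (K i) \<Longrightarrow> \<phi> i a \<otimes>\<^bsub>K i\<^esub> (\<phi> i (inv a) \<otimes>\<^bsub>K i\<^esub> g) = g"
  by (simp add: K.m_assoc[symmetric] flip: \<phi>_mult)

definition img :: "side \<Rightarrow> 'g set" where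
  "img i = \<phi> i ` carrier A"

lemma \<phi>_img: "a \<in> carrier A \<Longrightarrow> \<phi> i a \<in> img i"
  by (simp add: img_def)

lemma img_left [simp]:
  assumes "a \<in> carrier A" "g \<in> carrier (K i)"
  shows "\<phi> i a \<otimes>\<^bsub>K i\<^esub> g \<in> img i \<longleftrightarrow> g \<in> img i"
proof
  assume "\<phi> i a \<otimes>\<^bsub>K i\<^esub> g \<in> img i"
  then obtain b where "b \<in> carrier A" "\<phi> i a \<otimes>\<^bsub>K i\<^esub> g = \<phi> i b" by (auto simp: img_def)
  then have "g = \<phi> i (inv a \<otimes> b)" using \<phi>_inv_mult[OF assms] assms by simp
  then show "g \<in> img i" using \<open>b \<in> carrier A\<close> assms \<phi>_img by (metis A.inv_closed A.m_closed)
next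
  assume "g \<in> img i"
  then obtain b where "b \<in> carrier A" "g = \<phi> i b" by (auto simp: img_def)
  then have "\<phi> i a \<otimes>\<^bsub>K i\<^esub> g = \<phi> i (a \<otimes> b)" using assms by simp
  then show "\<phi> i a \<otimes>\<^bsub>K i\<^esub> g \<in> img i"
    using \<open>b \<in> carrier A\<close> assms \<phi>_img by (metis A.m_closed)
qed

lemma img_right:
  assumes "a \<in> carrier A" "g \<in> carrier (K i)" "g \<notin> img i"
  shows "g \<otimes>\<^bsub>K i\<^esub> \<phi> i a \<notin> img i"
proof
  assume "g \<otimes>\<^bsub>K i\<^esub> \<phi> i a \<in> img i"
  then obtain b where b: "b \<in> carrier A" "g \<otimes>\<^bsub>K i\<^esub> \<phi> i a = \<phi> i b" by (auto simp: img_def)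
  have "g = g \<otimes>\<^bsub>K i\<^esub> \<phi> i a \<otimes>\<^bsub>K i\<^esub> \<phi> i (inv a)"
    using assms by (simp add: K.m_assoc flip: \<phi>_mult)
  also have "\<dots> = \<phi> i (b \<otimes> inv a)" using b assms by simp
  finally show False using assms b \<phi>_img by (metis A.inv_closed A.m_closed)
qed

definition rep :: "side \<Rightarrow> 'g \<Rightarrow> 'g" where
  "rep i g = (SOME t. t \<in> (\<lambda>a. \<phi> i a \<otimes>\<^bsub>K i\<^esub> g) ` carrier A)"

lemma rep_eq: "g \<in> carrier (K i) \<Longrightarrow> \<exists>a\<in>carrier A. rep i g = \<phi> i a \<otimes>\<^bsub>K i\<^esub> g"
proof -
  assume "g \<in> carrier (K i)"
  have "rep i g \<in> (\<lambda>a. \<phi> i a \<otimes>\<^bsub>K i\<^esub> g) ` carrier A"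
    unfolding rep_def by (rule someI[of _ "\<phi> i \<one> \<otimes>\<^bsub>K i\<^esub> g"]) (rule imageI, simp)
  then show ?thesis by auto
qed

lemma rep_left [simp]:
  assumes "a \<in> carrier A" "g \<in> carrier (K i)"
  shows "rep i (\<phi> i a \<otimes>\<^bsub>K i\<^esub> g) = rep i g"
proof -
  have "\<phi> i b \<otimes>\<^bsub>K i\<^esub> (\<phi> i a \<otimes>\<^bsub>K i\<^esub> g) \<in> (\<lambda>a. \<phi> i a \<otimes>\<^bsub>K i\<^esub> g) ` carrier A" if "b \<in> carrier A" for b
    using that assms by (intro image_eqI[of _ _ "b \<otimes> a"]) (simp_all add: K.m_assoc)
  moreover have "\<phi> i b \<otimes>\<^bsub>K i\<^esub> g \<in> (\<lambda>b. \<phi> i b \<otimes>\<^bsub>K i\<^esub> (\<phi> i a \<otimes>\<^bsub>K i\<^esub> g)) ` carrier A" if "b \<in> carrier A" for b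
    using that assms by (intro image_eqI[of _ _ "b \<otimes> inv a"]) (simp_all add: K.m_assoc)
  ultimately have "(\<lambda>b. \<phi> i b \<otimes>\<^bsub>K i\<^esub> (\<phi> i a \<otimes>\<^bsub>K i\<^esub> g)) ` carrier A = (\<lambda>a. \<phi> i a \<otimes>\<^bsub>K i\<^esub> g) ` carrier A"
    by (auto simp only: subset_antisym image_subset_iff)
  then show ?thesis unfolding rep_def by simp
qed

text \<open>The representatives of the cosets of \<open>A\<close> other than \<open>A\<close> itself.\<close>

definition transversal :: "side \<Rightarrow> 'g set" where
  "transversal i = {t \<in> carrier (K i). t \<notin> img i \<and> rep i t = t}"

lemma factor_cases:
  assumes "g \<in> carrier (K i)"
  obtains a where "a \<in> carrier A" "g = \<phi> i a" "g \<in> img i"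
  | a t where "a \<in> carrier A" "t \<in> transversal i" "g = \<phi> i a \<otimes>\<^bsub>K i\<^esub> t" "g \<notin> img i"
proof (cases "g \<in> img i")
  case True
  then show thesis using that(1) by (auto simp: img_def)
next
  case False
  obtain a where a: "a \<in> carrier A" "rep i g = \<phi> i a \<otimes>\<^bsub>K i\<^esub> g" using rep_eq assms by blast
  have "rep i (rep i g) = rep i g" unfolding a(2) using a(1) assms a(2) by simp
  then have "rep i g \<in> transversal i" using a assms False by (simp add: transversal_def)
  moreover have "g = \<phi> i (inv a) \<otimes>\<^bsub>K i\<^esub> rep i g" using a assms by simp
  ultimately show thesis using that(2)[of "inv a" "rep i g"] a False by simp
qed

definition coord :: "side \<Rightarrow> 'g \<Rightarrow> 'a" where
  "coord i g = inv_into (carrier A) (\<phi> i) g"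

text \<open>For each side \<open>i\<close>, \<open>pop i\<close> merges the element of \<open>A\<close> with a leading syllable on side \<open>i\<close> and thus
  identifies the normal forms with the pairs of an element of \<open>K i\<close> and a form not starting on side
  \<open>i\<close>; \<open>push i\<close> is the inverse. Left multiplication on these pairs is the action of \<open>K i\<close>.\<close>

definition push :: "side \<Rightarrow> 'g \<times> (side \<times> 'g) list \<Rightarrow> 'a \<times> (side \<times> 'g) list" where
  "push i = (\<lambda>(g, w). if g \<in> img i then (coord i g, w)
     else (coord i (g \<otimes>\<^bsub>K i\<^esub> inv\<^bsub>K i\<^esub> rep i g), (i, rep i g) # w))"

definition pop :: "side \<Rightarrow> 'a \<times> (side \<times> 'g) list \<Rightarrow> 'g \<times> (side \<times> 'g) list" where
  "pop i = (\<lambda>(a, w). case w of [] \<Rightarrow> (\<phi> i a, [])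
     | (j, t) # w' \<Rightarrow> if j = i then (\<phi> i a \<otimes>\<^bsub>K i\<^esub> t, w') else (\<phi> i a, w))"

definition act :: "side \<Rightarrow> 'g \<Rightarrow> 'a \<times> (side \<times> 'g) list \<Rightarrow> 'a \<times> (side \<times> 'g) list" where
  "act i g \<omega> = push i (g \<otimes>\<^bsub>K i\<^esub> fst (pop i \<omega>), snd (pop i \<omega>))"

definition tails :: "side \<Rightarrow> (side \<times> 'g) list set" where
  "tails i = {w. (\<forall>s\<in>set w. snd s \<in> transversal (fst s)) \<and>
     successively (\<lambda>s t. fst s \<noteq> fst t) w \<and> (w = [] \<or> fst (hd w) \<noteq> i)}"

definition nforms :: "('a \<times> (side \<times> 'g) list) set" where
  "nforms = carrier A \<times> (tails F1 \<union> tails F2)"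

lemma coord_\<phi> [simp]: "a \<in> carrier A \<Longrightarrow> coord i (\<phi> i a) = a"
  unfolding coord_def using \<phi>_inj by (rule inv_into_f_f)

lemma push_img [simp]: "a \<in> carrier A \<Longrightarrow> push i (\<phi> i a, w) = (a, w)"
  by (simp add: push_def img_def)

lemma push_transversal [simp]:
  assumes "a \<in> carrier A" "t \<in> transversal i"
  shows "push i (\<phi> i a \<otimes>\<^bsub>K i\<^esub> t, w) = (a, (i, t) # w)"
  using assms by (simp add: push_def transversal_def K.m_assoc)

lemma nforms_cases:
  assumes "\<omega> \<in> nforms"
  obtains a w where "a \<in> carrier A" "w \<in> tails i" "\<omega> = (a, w)"
  | a t w where "a \<in> carrier A" "t \<in> transversal i" "w \<in> tails i" "\<omega> = (a, (i, t) # w)"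
proof -
  obtain a w where \<omega>: "\<omega> = (a, w)" "a \<in> carrier A" "w \<in> tails F1 \<union> tails F2"
    using assms by (auto simp: nforms_def)
  show thesis
  proof (cases "w \<in> tails i")
    case True
    then show thesis using that(1) \<omega> by blast
  next
    case False
    then obtain t w' where w: "w = (i, t) # w'" using \<omega>(3)
      by (cases w) (auto simp: tails_def)
    then have "t \<in> transversal i" "w' \<in> tails i"
      using \<omega>(3) by (auto simp: tails_def successively_Cons)
    then show thesis using that(2) \<omega> w by blast
  qed
qed

lemma pop_tail [simp]: "w \<in> tails i \<Longrightarrow> pop i (a, w) = (\<phi> i a, w)"
  by (auto simp: pop_def tails_def split: list.split)

lemma pop_Cons [simp]: "pop i (a, (i, t) # w) = (\<phi> i a \<otimes>\<^bsub>K i\<^esub> t, w)"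
  by (simp add: pop_def)

lemma transversal_carrier [simp]: "t \<in> transversal i \<Longrightarrow> t \<in> carrier (K i)"
  by (simp add: transversal_def)

lemma pop_closed:
  assumes "\<omega> \<in> nforms"
  shows "fst (pop i \<omega>) \<in> carrier (K i)" "snd (pop i \<omega>) \<in> tails i"
  by (rule nforms_cases[OF assms, of i]; simp)+

lemma push_pop [simp]: "\<omega> \<in> nforms \<Longrightarrow> push i (pop i \<omega>) = \<omega>"
  by (rule nforms_cases[of \<omega> i]) auto

lemma tails_nforms: "a \<in> carrier A \<Longrightarrow> w \<in> tails i \<Longrightarrow> (a, w) \<in> nforms"
  by (cases i) (auto simp: nforms_def)

lemma tails_Cons: "t \<in> transversal i \<Longrightarrow> w \<in> tails i \<Longrightarrow> (i, t) # w \<in> tails (other i)"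
  by (auto simp: tails_def successively_Cons)

lemma push_closed:
  assumes "g \<in> carrier (K i)" "w \<in> tails i"
  shows "push i (g, w) \<in> nforms" "pop i (push i (g, w)) = (g, w)"
  using factor_cases[OF assms(1)] assms(2) tails_nforms tails_Cons
  by (metis push_img push_transversal pop_tail pop_Cons)+

lemma act_closed:
  assumes "\<omega> \<in> nforms" "g \<in> carrier (K i)"
  shows "act i g \<omega> \<in> nforms"
  using assms unfolding act_def by (intro push_closed) (auto simp: pop_closed)

lemma act_mult:
  assumes "\<omega> \<in> nforms" "g \<in> carrier (K i)" "h \<in> carrier (K i)"
  shows "act i g (act i h \<omega>) = act i (g \<otimes>\<^bsub>K i\<^esub> h) \<omega>"
  using assms unfolding act_def by (simp add: push_closed pop_closed K.m_assoc)

lemma act_one: "\<omega> \<in> nforms \<Longrightarrow> act i \<one>\<^bsub>K i\<^esub> \<omega> = \<omega>"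
  unfolding act_def by (simp add: pop_closed)

text \<open>Both factors restrict to the same action of \<open>A\<close>, since \<open>A\<close> multiplies the first entry of a
  normal form and leaves the transversal elements alone.\<close>

lemma act_\<phi>:
  assumes "(b, w) \<in> nforms" "a \<in> carrier A"
  shows "act i (\<phi> i a) (b, w) = (a \<otimes> b, w)"
proof (rule nforms_cases[OF assms(1), of i])
  fix b' w' assume "b' \<in> carrier A" "w' \<in> tails i" "(b, w) = (b', w')"
  then show ?thesis using assms(2) unfolding act_def by (simp flip: \<phi>_mult)
next
  fix b' t w' assume "b' \<in> carrier A" "t \<in> transversal i" "w' \<in> tails i" "(b, w) = (b', (i, t) # w')"
  then show ?thesis using assms(2) unfolding act_def
    by (simp add: K.m_assoc[symmetric] flip: \<phi>_mult)
qed

text \<open>An element outside \<open>A\<close> adds a syllable if its side differs from that of the first one.\<close>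

lemma act_grows:
  assumes "g \<in> carrier (K i)" "g \<notin> img i" "a \<in> carrier A" "w \<in> tails i"
  shows "\<exists>b\<in>carrier A. \<exists>t\<in>transversal i. act i g (a, w) = (b, (i, t) # w)"
proof -
  have g: "g \<otimes>\<^bsub>K i\<^esub> \<phi> i a \<in> carrier (K i)" "g \<otimes>\<^bsub>K i\<^esub> \<phi> i a \<notin> img i"
    using assms img_right by auto
  then show ?thesis
    by (rule_tac factor_cases[OF g(1)]) (use assms in \<open>auto simp: act_def\<close>)
qed

end

section \<open>Presented groups\<close>

(* membership of a word in a set of words is used as an atom throughout *)
declare in_listsD [rule del] in_listsI [rule del]

lemma linv_letters [simp]: "linv l \<in> letters X \<longleftrightarrow> l \<in> letters X"
  by (cases l) (simp add: linv_def)

lemma linv_linv [simp]: "linv (linv l) = l"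
  by (simp add: linv_def)

lemma winv_words [simp]: "winv w \<in> words X \<longleftrightarrow> w \<in> words X"
  by (auto simp: winv_def in_lists_conv_set)

lemma winv_Nil [simp]: "winv [] = []"
  by (simp add: winv_def)

lemma winv_Cons: "winv (l # w) = winv w @ [linv l]"
  by (simp add: winv_def)

lemma winv_winv [simp]: "winv (winv w) = w"
  by (simp add: winv_def rev_map comp_def)

lemma pres_eq_words: "pres_eq X R u v \<Longrightarrow> u \<in> words X \<and> v \<in> words X"
  by (induction rule: pres_eq.induct) auto

text \<open>The congruence generated by cancellations and relators is compatible with concatenation because
  both rules allow a context.\<close>

lemma pres_eq_context:
  "pres_eq X R u v \<Longrightarrow> x \<in> words X \<Longrightarrow> y \<in> words X \<Longrightarrow> pres_eq X R (x @ u @ y) (x @ v @ y)"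
proof (induction rule: pres_eq.induct)
  case (cancel u v l)
  then show ?case using pres_eq.cancel[of "x @ u" X "v @ y" l R] by simp
next
  case (relator u v r)
  then show ?case using pres_eq.relator[of "x @ u" X "v @ y" r R] by simp
next
  case (refl w)
  then show ?case by (intro pres_eq.refl) auto
next
  case (sym u v)
  from pres_eq.sym[OF sym.IH[OF sym.prems]] show ?case .
next
  case (trans u v w)
  from pres_eq.trans[OF trans.IH(1)[OF trans.prems] trans.IH(2)[OF trans.prems]] show ?case .
qed

lemma pres_eq_append:
  assumes "pres_eq X R u u'" "pres_eq X R v v'"
  shows "pres_eq X R (u @ v) (u' @ v')"
proof -
  have "pres_eq X R (u @ v) (u' @ v)"
    using pres_eq_context[OF assms(1), of "[]" v] pres_eq_words[OF assms(2)] by simp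
  moreover have "pres_eq X R (u' @ v) (u' @ v')"
    using pres_eq_context[OF assms(2), of u' "[]"] pres_eq_words[OF assms(1)] by simp
  ultimately show ?thesis by (rule pres_eq.trans)
qed

lemma pres_eq_winv: "w \<in> words X \<Longrightarrow> pres_eq X R (w @ winv w) []"
proof (induction w)
  case Nil
  then show ?case by (simp add: pres_eq.refl)
next
  case (Cons l w)
  then have "pres_eq X R ([l] @ (w @ winv w) @ [linv l]) ([l] @ [] @ [linv l])"
    by (intro pres_eq_context) auto
  moreover have "pres_eq X R ([] @ [l, linv l] @ []) ([] @ [])"
    using Cons by (intro pres_eq.cancel) auto
  ultimately show ?case by (auto simp: winv_Cons intro: pres_eq.trans)
qed

lemma mem_elt_iff: "v \<in> elt X R u \<longleftrightarrow> pres_eq X R u v"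
  by (simp add: elt_def pres_rel_def)

lemma elt_eq_iff:
  assumes "u \<in> words X"
  shows "elt X R u = elt X R v \<longleftrightarrow> pres_eq X R u v"
proof
  assume "elt X R u = elt X R v"
  then have "u \<in> elt X R v" using assms pres_eq.refl by (metis mem_elt_iff)
  then show "pres_eq X R u v" by (metis mem_elt_iff pres_eq.sym)
next
  assume "pres_eq X R u v"
  then have "pres_eq X R u w \<longleftrightarrow> pres_eq X R v w" for w
    by (metis pres_eq.sym pres_eq.trans)
  then show "elt X R u = elt X R v" by (auto simp: mem_elt_iff)
qed

lemma carrier_gp: "carrier (gp X R) = elt X R ` words X"
  by (auto simp: gp_def quotient_def elt_def)

lemma elt_closed [simp]: "w \<in> words X \<Longrightarrow> elt X R w \<in> carrier (gp X R)"
  by (simp add: carrier_gp)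

lemma one_gp: "\<one>\<^bsub>gp X R\<^esub> = elt X R []"
  by (simp add: gp_def)

lemma mult_gp [simp]:
  assumes "u \<in> words X" "v \<in> words X"
  shows "elt X R u \<otimes>\<^bsub>gp X R\<^esub> elt X R v = elt X R (u @ v)"
proof -
  have eq: "elt X R (u' @ v') = elt X R (u @ v)" if "u' \<in> elt X R u" "v' \<in> elt X R v" for u' v'
  proof -
    have "pres_eq X R (u @ v) (u' @ v')"
      using that by (intro pres_eq_append) (auto simp: mem_elt_iff)
    then show ?thesis using assms by (simp add: elt_eq_iff[symmetric])
  qed
  have ne: "u \<in> elt X R u" "v \<in> elt X R v"
    using assms by (auto simp: mem_elt_iff intro: pres_eq.refl)
  have "elt X R u \<otimes>\<^bsub>gp X R\<^esub> elt X R v = (\<Union>u'\<in>elt X R u. \<Union>v'\<in>elt X R v. elt X R (u' @ v'))"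
    by (simp add: gp_def)
  also have "\<dots> = (\<Union>u'\<in>elt X R u. \<Union>v'\<in>elt X R v. elt X R (u @ v))"
    using eq by (intro SUP_cong HOL.refl)
  also have "\<dots> = elt X R (u @ v)"
    using ne by (metis UN_constant empty_iff)
  finally show ?thesis .
qed

lemma group_gp: "group (gp X R)"
proof (rule groupI)
  fix P assume "P \<in> carrier (gp X R)"
  then obtain w where w: "w \<in> words X" "P = elt X R w" by (auto simp: carrier_gp)
  have "pres_eq X R (winv w @ w) []" using pres_eq_winv[of "winv w" X R] w by simp
  then have "elt X R (winv w) \<otimes>\<^bsub>gp X R\<^esub> P = \<one>\<^bsub>gp X R\<^esub>"
    using w by (simp add: one_gp elt_eq_iff)
  then show "\<exists>Q\<in>carrier (gp X R). Q \<otimes>\<^bsub>gp X R\<^esub> P = \<one>\<^bsub>gp X R\<^esub>"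
    using w by (intro bexI[of _ "elt X R (winv w)"]) auto
qed (auto simp: carrier_gp one_gp)

lemma inv_gp: "w \<in> words X \<Longrightarrow> inv\<^bsub>gp X R\<^esub> elt X R w = elt X R (winv w)"
  using pres_eq_winv[of "winv w" X R]
  by (intro group.inv_equality[OF group_gp]) (auto simp: one_gp elt_eq_iff)


section \<open>The normal form theorem for the presented amalgam\<close>

locale presented_amalgam =
  fixes D :: "('x, 'a) amalgam_data"
  assumes amalgam: "amalgam D"
begin

abbreviation GG where "GG \<equiv> amalg_gp D"

abbreviation coset_act (infixl "\<cdot>" 60) where "v \<cdot> g \<equiv> v #>\<^bsub>GG\<^esub> g"

abbreviation gmult (infixl "\<odot>" 70) where "g \<odot> h \<equiv> g \<otimes>\<^bsub>GG\<^esub> h"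

definition FF :: "side \<Rightarrow> 'x word set set" where
  "FF i = gelt D ` words (gens D i)"

lemma gens_disjoint: "gens D F1 \<inter> gens D F2 = {}"
  using amalgam by (simp add: amalgam_def)

lemma letter_sides: "l \<in> letters (gens D i) \<Longrightarrow> l \<in> letters (gens D j) \<Longrightarrow> i = j"
  using gens_disjoint by (cases i; cases j) auto

lemma letters_all: "l \<in> letters (all_gens D) \<longleftrightarrow> (\<exists>i. l \<in> letters (gens D i))"
proof -
  have "(\<exists>i. l \<in> letters (gens D i)) \<longleftrightarrow> l \<in> letters (gens D F1) \<or> l \<in> letters (gens D F2)"
    using side.exhaust by metis
  then show ?thesis by (auto simp: all_gens_def)
qed

lemma words_all: "w \<in> words (gens D i) \<Longrightarrow> w \<in> words (all_gens D)"
  using letters_all by (auto simp: in_lists_conv_set)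

lemma word_sides: "w \<in> words (gens D i) \<Longrightarrow> w \<in> words (gens D j) \<Longrightarrow> w \<noteq> [] \<Longrightarrow> i = j"
  using letter_sides by (cases w) (simp, metis Cons_in_lists_iff)

lemma rels_all: "rels D i \<subseteq> all_rels D"
  unfolding all_rels_def by (cases i) auto

sublocale GG: group GG
  unfolding amalg_gp_def by (rule group_gp)

lemma gelt_closed [simp]: "w \<in> words (all_gens D) \<Longrightarrow> gelt D w \<in> carrier GG"
  unfolding amalg_gp_def gelt_def by simp

lemma carrier_GG: "carrier GG = gelt D ` words (all_gens D)"
  unfolding amalg_gp_def gelt_def[abs_def] by (rule carrier_gp)

lemma gelt_Nil: "gelt D [] = \<one>\<^bsub>GG\<^esub>"
  unfolding amalg_gp_def gelt_def by (simp add: one_gp)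

lemma gelt_append:
  "u \<in> words (all_gens D) \<Longrightarrow> v \<in> words (all_gens D) \<Longrightarrow> gelt D (u @ v) = gelt D u \<odot> gelt D v"
  unfolding amalg_gp_def gelt_def by simp

lemma gelt_winv: "w \<in> words (all_gens D) \<Longrightarrow> gelt D (winv w) = inv\<^bsub>GG\<^esub> gelt D w"
  unfolding amalg_gp_def gelt_def by (simp add: inv_gp)

lemma gelt_eq_iff:
  "u \<in> words (all_gens D) \<Longrightarrow>
    gelt D u = gelt D v \<longleftrightarrow> pres_eq (all_gens D) (all_rels D) u v"
  unfolding gelt_def by (rule elt_eq_iff)

lemma pres_eq_factor:
  "pres_eq (gens D i) (rels D i) u v \<Longrightarrow> gelt D u = gelt D v"
proof -
  assume "pres_eq (gens D i) (rels D i) u v"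
  then have "pres_eq (all_gens D) (all_rels D) u v"
  proof (induction rule: pres_eq.induct)
    case (refl w)
    then show ?case by (intro pres_eq.refl words_all)
  next
    case (sym u v)
    from pres_eq.sym[OF sym.IH] show ?case .
  next
    case (trans u v w)
    from pres_eq.trans[OF trans.IH] show ?case .
  next
    case (cancel u v l)
    show ?case
    proof (rule pres_eq.cancel)
      show "l \<in> letters (all_gens D)" using cancel letters_all[of l] by blast
    qed (use cancel words_all in simp_all)
  next
    case (relator u v r)
    show ?case
    proof (rule pres_eq.relator)
      show "r \<in> all_rels D" using relator rels_all[of i] by blast
    qed (use relator words_all in simp_all)
  qed
  then show ?thesis
    using gelt_eq_iff pres_eq_words[of "all_gens D" "all_rels D" u v] by simp
qed

lemma elt_factor: "u \<in> words (gens D i) \<Longrightarrow> elt (gens D i) (rels D i) u = elt (gens D i) (rels D i) v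
    \<Longrightarrow> gelt D u = gelt D v"
  using elt_eq_iff pres_eq_factor by metis

sublocale vdW: amalgam_of_groups "amal D" "factor D" "emb D"
  using amalgam group_gp unfolding amalgam_def amalgam_of_groups_def amalgam_of_groups_axioms_def factor_def
  by metis

lemma emb_word:
  assumes "a \<in> carrier (amal D)"
  obtains u where "u \<in> words (gens D i)" "u \<in> emb D i a"
    "emb D i a = elt (gens D i) (rels D i) u"
proof -
  have "emb D i a \<in> carrier (factor D i)" using assms by simp
  then obtain u where u: "u \<in> words (gens D i)" "emb D i a = elt (gens D i) (rels D i) u"
    unfolding factor_def carrier_gp by blast
  then have "u \<in> emb D i a" by (simp add: mem_elt_iff pres_eq.refl)
  then show thesis using that u by blast
qed

lemma emb_memD:
  assumes "a \<in> carrier (amal D)" "u \<in> emb D i a"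
  shows "u \<in> words (gens D i)" "emb D i a = elt (gens D i) (rels D i) u"
proof -
  obtain v where v: "v \<in> words (gens D i)" "emb D i a = elt (gens D i) (rels D i) v"
    using emb_word[OF assms(1)] by metis
  then have "pres_eq (gens D i) (rels D i) v u" using assms(2) by (simp add: mem_elt_iff)
  then show "u \<in> words (gens D i)" "emb D i a = elt (gens D i) (rels D i) u"
    using v pres_eq_words[of "gens D i" "rels D i" v u] by (simp_all add: elt_eq_iff)
qed

lemma emb_same_side:
  assumes "a \<in> carrier (amal D)" "u \<in> emb D i a" "v \<in> emb D i a"
  shows "gelt D u = gelt D v"
  using emb_memD[OF assms(1)] assms elt_factor by metis

lemma agens_agree:
  assumes "y \<in> agens D"
  shows "gelt D (arep D F1 y) = gelt D (arep D F2 y)"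
proof -
  have w: "arep D i y \<in> words (gens D i)" for i using amalgam assms by (simp add: amalgam_def)
  then have w': "arep D i y \<in> words (all_gens D)" for i using words_all by blast
  have "pres_eq (all_gens D) (all_rels D) ([] @ (arep D F1 y @ winv (arep D F2 y)) @ []) ([] @ [])"
    using assms w' by (intro pres_eq.relator) (auto simp: all_rels_def)
  then have "gelt D (arep D F1 y @ winv (arep D F2 y)) = gelt D []"
    using w' by (subst gelt_eq_iff) auto
  then have "gelt D (arep D F1 y) \<odot> inv\<^bsub>GG\<^esub> gelt D (arep D F2 y) = \<one>\<^bsub>GG\<^esub>"
    using w' by (simp add: gelt_append gelt_winv gelt_Nil)
  then show ?thesis
    using w' by (metis GG.inv_closed GG.inv_equality GG.inv_inv gelt_closed)
qed

text \<open>The relations identify the two images of \<open>A\<close> only on generators; as both embeddings are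
  homomorphisms, they agree on \<open>A\<close>.\<close>

lemma emb_agree_ex:
  assumes "a \<in> carrier (amal D)"
  shows "\<exists>u\<in>emb D F1 a. \<exists>v\<in>emb D F2 a. gelt D u = gelt D v"
proof -
  have base: "\<exists>u\<in>emb D F1 y. \<exists>v\<in>emb D F2 y. gelt D u = gelt D v" if "y \<in> agens D" for y
  proof -
    have "arep D i y \<in> emb D i y" for i
      using amalgam that unfolding amalgam_def by (metis mem_elt_iff pres_eq.refl)
    then show ?thesis using agens_agree[OF that] by blast
  qed
  have sub: "agens D \<subseteq> carrier (amal D)" and gen: "generate (amal D) (agens D) = carrier (amal D)"
    using amalgam by (auto simp: amalgam_def)
  have "a \<in> generate (amal D) (agens D)" using assms gen by simp
  then show ?thesis
  proof induction
    case one
    have "[] \<in> emb D i \<one>\<^bsub>amal D\<^esub>" for i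
      using vdW.\<phi>_one[of i] by (simp add: factor_def one_gp mem_elt_iff pres_eq.refl)
    then show ?case by blast
  next
    case (incl y)
    then show ?case by (rule base)
  next
    case (inv y)
    then have y: "y \<in> carrier (amal D)" using sub by blast
    obtain u v where u: "u \<in> emb D F1 y" "v \<in> emb D F2 y" "gelt D u = gelt D v"
      using base inv by blast
    have "winv w \<in> emb D i (inv\<^bsub>amal D\<^esub> y)" if "w \<in> emb D i y" for w i
    proof -
      have w: "w \<in> words (gens D i)" "emb D i y = elt (gens D i) (rels D i) w"
        using emb_memD[OF y that] by auto
      have "emb D i (inv\<^bsub>amal D\<^esub> y) \<otimes>\<^bsub>factor D i\<^esub> emb D i y = \<one>\<^bsub>factor D i\<^esub>"
        using y by (metis vdW.A.inv_closed vdW.A.l_inv vdW.\<phi>_mult vdW.\<phi>_one)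
      then have "emb D i (inv\<^bsub>amal D\<^esub> y) = inv\<^bsub>factor D i\<^esub> emb D i y"
        using y by (metis vdW.A.inv_closed vdW.K.inv_equality vdW.\<phi>_closed)
      also have "\<dots> = elt (gens D i) (rels D i) (winv w)"
        using w by (simp add: factor_def inv_gp)
      finally show ?thesis using w by (simp add: mem_elt_iff pres_eq.refl)
    qed
    moreover have "gelt D (winv u) = gelt D (winv v)"
      using u emb_memD[OF y] words_all by (metis gelt_winv)
    ultimately show ?case using u by blast
  next
    case (eng a b)
    then have ab: "a \<in> carrier (amal D)" "b \<in> carrier (amal D)" using gen by auto
    obtain u v u' v' where u: "u \<in> emb D F1 a" "v \<in> emb D F2 a" "gelt D u = gelt D v"
       "u' \<in> emb D F1 b" "v' \<in> emb D F2 b" "gelt D u' = gelt D v'"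
      using eng by blast
    have "w @ w' \<in> emb D i (a \<otimes>\<^bsub>amal D\<^esub> b)" if "w \<in> emb D i a" "w' \<in> emb D i b" for w w' i
    proof -
      have w: "w \<in> words (gens D i)" "emb D i a = elt (gens D i) (rels D i) w"
         "w' \<in> words (gens D i)" "emb D i b = elt (gens D i) (rels D i) w'"
        using emb_memD[OF ab(1) that(1)] emb_memD[OF ab(2) that(2)] by auto
      have "emb D i (a \<otimes>\<^bsub>amal D\<^esub> b) = elt (gens D i) (rels D i) (w @ w')"
        using w ab by (simp add: factor_def)
      then show ?thesis using w by (simp add: mem_elt_iff pres_eq.refl)
    qed
    moreover have "gelt D (u @ u') = gelt D (v @ v')"
      using u emb_memD[OF ab(1)] emb_memD[OF ab(2)] words_all by (metis gelt_append)
    ultimately show ?case using u by blast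
  qed
qed

lemma emb_agree:
  assumes "a \<in> carrier (amal D)" "u \<in> emb D i a" "v \<in> emb D j a"
  shows "gelt D u = gelt D v"
proof -
  obtain u' v' where "u' \<in> emb D F1 a" "v' \<in> emb D F2 a" "gelt D u' = gelt D v'"
    using emb_agree_ex[OF assms(1)] by blast
  then show ?thesis using assms emb_same_side[OF assms(1)] by (cases i; cases j) metis+
qed

lemma amal_img_iff:
  "g \<in> amal_img D \<longleftrightarrow> (\<exists>a\<in>carrier (amal D). \<exists>u\<in>emb D i a. g = gelt D u)"
proof
  assume "g \<in> amal_img D"
  then obtain u j a where a: "a \<in> carrier (amal D)" "u \<in> emb D j a" "g = gelt D u"
    unfolding amal_img_def by blast
  obtain v where "v \<in> emb D i a" using emb_word[OF a(1)] by metis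
  then show "\<exists>a\<in>carrier (amal D). \<exists>u\<in>emb D i a. g = gelt D u"
    using a emb_agree by metis
qed (unfold amal_img_def, blast)

lemma subgroup_FF: "subgroup (FF i) GG"
proof (rule GG.subgroupI)
  show "FF i \<subseteq> carrier GG" using words_all by (auto simp: FF_def)
  show "FF i \<noteq> {}" by (auto simp: FF_def)
  show "inv\<^bsub>GG\<^esub> g \<in> FF i" if g: "g \<in> FF i" for g
  proof -
    obtain u where "u \<in> words (gens D i)" "g = gelt D u" using g by (auto simp: FF_def)
    then show ?thesis unfolding FF_def
      by (intro image_eqI[of _ _ "winv u"]) (simp_all add: gelt_winv words_all)
  qed
  show "g \<odot> h \<in> FF i" if g: "g \<in> FF i" and h: "h \<in> FF i" for g h
  proof -
    obtain u v where "u \<in> words (gens D i)" "g = gelt D u" "v \<in> words (gens D i)" "h = gelt D v"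
      using g h by (auto simp: FF_def)
    then show ?thesis unfolding FF_def
      by (intro image_eqI[of _ _ "u @ v"]) (simp_all add: gelt_append words_all)
  qed
qed

lemma amal_img_FF: "amal_img D \<subseteq> FF i"
  using amal_img_iff[of _ i] emb_memD by (fastforce simp: FF_def)

lemma subgroup_amal_img: "subgroup (amal_img D) GG"
proof (rule GG.subgroupI)
  show "amal_img D \<subseteq> carrier GG" using amal_img_FF subgroup_FF subgroup.subset by blast
  obtain u where "u \<in> emb D F1 \<one>\<^bsub>amal D\<^esub>" using emb_word[OF vdW.A.one_closed] by metis
  then show "amal_img D \<noteq> {}" using amal_img_iff[of _ F1] by blast
  have closed: "g \<odot> h \<in> amal_img D" if g: "g \<in> amal_img D" and h: "h \<in> amal_img D" for g h
  proof -
    obtain a u where a: "a \<in> carrier (amal D)" "u \<in> emb D F1 a" "g = gelt D u"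
      using g amal_img_iff[of g F1] by blast
    obtain b v where b: "b \<in> carrier (amal D)" "v \<in> emb D F1 b" "h = gelt D v"
      using h amal_img_iff[of h F1] by blast
    have w: "u \<in> words (gens D F1)" "v \<in> words (gens D F1)"
      using emb_memD a b by metis+
    have "emb D F1 (a \<otimes>\<^bsub>amal D\<^esub> b) = elt (gens D F1) (rels D F1) (u @ v)"
      using a b w emb_memD(2)[OF a(1,2)] emb_memD(2)[OF b(1,2)] by (simp add: factor_def)
    then have "u @ v \<in> emb D F1 (a \<otimes>\<^bsub>amal D\<^esub> b)"
      using w by (simp add: mem_elt_iff pres_eq.refl)
    moreover have "g \<odot> h = gelt D (u @ v)"
      using a b w by (simp add: gelt_append words_all)
    ultimately show ?thesis using amal_img_iff[of _ F1] a b by blast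
  qed
  then show "g \<odot> h \<in> amal_img D" if "g \<in> amal_img D" "h \<in> amal_img D" for g h using that .
  show "inv\<^bsub>GG\<^esub> g \<in> amal_img D" if g: "g \<in> amal_img D" for g
  proof -
    obtain a u where a: "a \<in> carrier (amal D)" "u \<in> emb D F1 a" "g = gelt D u"
      using g amal_img_iff[of g F1] by blast
    obtain v where v: "v \<in> emb D F1 (inv\<^bsub>amal D\<^esub> a)" using emb_word a by (metis vdW.A.inv_closed)
    have w: "u \<in> words (gens D F1)" "v \<in> words (gens D F1)"
      using emb_memD a v by (metis vdW.A.inv_closed)+
    have "elt (gens D F1) (rels D F1) (v @ u) = emb D F1 (inv\<^bsub>amal D\<^esub> a \<otimes>\<^bsub>amal D\<^esub> a)"
      using a(1) w emb_memD(2)[OF a(1,2)] emb_memD(2)[OF vdW.A.inv_closed v]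
      unfolding vdW.\<phi>_mult[OF vdW.A.inv_closed[OF a(1)] a(1)] by (simp add: factor_def)
    also have "\<dots> = elt (gens D F1) (rels D F1) []"
      using a vdW.\<phi>_one[of F1] by (simp add: factor_def one_gp)
    finally have "gelt D (v @ u) = gelt D []" using w elt_factor by (metis append_in_lists_conv)
    then have "gelt D v \<odot> g = \<one>\<^bsub>GG\<^esub>"
      using w a by (simp add: gelt_append gelt_Nil words_all)
    then have "inv\<^bsub>GG\<^esub> g = gelt D v" using w a
      by (intro GG.inv_equality) (simp_all add: words_all)
    then show ?thesis using v a amal_img_iff[of _ F1] by (metis vdW.A.inv_closed)
  qed
qed

sublocale two_subgroups GG FF "amal_img D"
  by (intro two_subgroups.intro two_subgroups_axioms.intro GG.group_axioms
      subgroup_FF subgroup_amal_img amal_img_FF)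

definition side_of :: "'x letter \<Rightarrow> side" where
  "side_of l = (if l \<in> letters (gens D F1) then F1 else F2)"

lemma side_of_eq: "l \<in> letters (gens D i) \<Longrightarrow> side_of l = i"
  using letter_sides[of l F1 i] unfolding side_of_def by (cases i) auto

lemma side_of_letter: "l \<in> letters (all_gens D) \<Longrightarrow> l \<in> letters (gens D (side_of l))"
  using letters_all side_of_eq by metis

primrec word_act :: "'x word \<Rightarrow> 'a \<times> (side \<times> 'x word set) list \<Rightarrow> 'a \<times> (side \<times> 'x word set) list" where
  "word_act [] \<omega> = \<omega>"
| "word_act (l # w) \<omega> =
    vdW.act (side_of l) (elt (gens D (side_of l)) (rels D (side_of l)) [l]) (word_act w \<omega>)"

lemma word_act_append: "word_act (u @ v) \<omega> = word_act u (word_act v \<omega>)"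
  by (induction u) simp_all

lemma elt_factor_closed [simp]:
  "u \<in> words (gens D i) \<Longrightarrow> elt (gens D i) (rels D i) u \<in> carrier (factor D i)"
  by (simp add: factor_def)

lemma factor_one: "\<one>\<^bsub>factor D i\<^esub> = elt (gens D i) (rels D i) []"
  by (simp add: factor_def one_gp)

lemma word_act_closed:
  "w \<in> words (all_gens D) \<Longrightarrow> \<omega> \<in> vdW.nforms \<Longrightarrow> word_act w \<omega> \<in> vdW.nforms"
  by (induction w) (use side_of_letter in \<open>auto intro!: vdW.act_closed\<close>)

lemma word_act_factor:
  assumes "w \<in> words (gens D i)" "\<omega> \<in> vdW.nforms"
  shows "word_act w \<omega> = vdW.act i (elt (gens D i) (rels D i) w) \<omega>"
  using assms
proof (induction w)
  case Nil
  then show ?case using vdW.act_one[of \<omega> i] by (simp add: factor_one)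
next
  case (Cons l w)
  then have l: "l \<in> letters (gens D i)" "w \<in> words (gens D i)" by auto
  then have "side_of l = i" by (simp only: side_of_eq)
  moreover have "elt (gens D i) (rels D i) [l] \<otimes>\<^bsub>factor D i\<^esub> elt (gens D i) (rels D i) w
      = elt (gens D i) (rels D i) (l # w)"
    using mult_gp[of "[l]" "gens D i" w "rels D i"] l by (simp add: factor_def)
  ultimately show ?case using Cons l vdW.act_mult[of \<omega> _ i] by simp
qed

text \<open>Relators of a factor represent its unit. A relator that identifies two images of \<open>y\<close> acts
  trivially because the two factors act in the same way on \<open>A\<close>.\<close>

lemma word_act_relator:
  assumes "r \<in> all_rels D" "r \<in> words (all_gens D)" "\<omega> \<in> vdW.nforms"
  shows "word_act r \<omega> = \<omega>"
proof -
  have factor_rel: "word_act r \<omega> = \<omega>" if r: "r \<in> rels D i" for i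
  proof -
    have w: "r \<in> words (gens D i)"
      using amalgam r unfolding amalgam_def finite_presentation_def by blast
    have "pres_eq (gens D i) (rels D i) ([] @ r @ []) ([] @ [])"
      using r w by (intro pres_eq.relator) auto
    then have "elt (gens D i) (rels D i) r = elt (gens D i) (rels D i) []"
      using w by (simp add: elt_eq_iff)
    then show ?thesis
      using word_act_factor[OF w assms(3)] word_act_factor[of "[]" i, OF _ assms(3)] by simp
  qed
  consider i where "r \<in> rels D i" | y where "y \<in> agens D" "r = arep D F1 y @ winv (arep D F2 y)"
    using assms(1) unfolding all_rels_def by blast
  then show ?thesis
  proof cases
    case 1
    then show ?thesis by (rule factor_rel)
  next
    case 2
    have y: "y \<in> carrier (amal D)" using amalgam 2 unfolding amalgam_def by blast
    have w: "arep D i y \<in> words (gens D i)" "elt (gens D i) (rels D i) (arep D i y) = emb D i y" for i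
      using amalgam 2 by (auto simp: amalgam_def)
    define \<omega>' where "\<omega>' = word_act (winv (arep D F2 y)) \<omega>"
    have w2: "winv (arep D F2 y) \<in> words (gens D F2)" using w by simp
    then have \<omega>': "\<omega>' \<in> vdW.nforms"
      unfolding \<omega>'_def using word_act_closed assms(3) words_all by metis
    have "word_act (arep D F2 y) \<omega>' = word_act (arep D F2 y @ winv (arep D F2 y)) \<omega>"
      by (simp add: word_act_append \<omega>'_def)
    also have "\<dots> = word_act [] \<omega>"
    proof -
      have "elt (gens D F2) (rels D F2) (arep D F2 y @ winv (arep D F2 y)) = elt (gens D F2) (rels D F2) []"
        using w[of F2] w2 pres_eq_winv[of "arep D F2 y"] by (simp add: elt_eq_iff)
      then show ?thesis
        using word_act_factor[OF _ assms(3), of _ F2] w[of F2] w2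
        by (metis append_in_lists_conv lists.Nil)
    qed
    finally have "word_act (arep D F2 y) \<omega>' = \<omega>" by simp
    moreover have "word_act (arep D F1 y) \<omega>' = word_act (arep D F2 y) \<omega>'"
      using word_act_factor[OF w(1) \<omega>'] w(2) vdW.act_\<phi> y \<omega>' by (metis prod.exhaust)
    ultimately show ?thesis using 2 by (simp add: word_act_append \<omega>'_def)
  qed
qed

lemma word_act_cong:
  assumes "pres_eq (all_gens D) (all_rels D) u v" "\<omega> \<in> vdW.nforms"
  shows "word_act u \<omega> = word_act v \<omega>"
  using assms
proof (induction arbitrary: \<omega> rule: pres_eq.induct)
  case (cancel u v l)
  let ?i = "side_of l"
  have l: "[l, linv l] \<in> words (gens D ?i)" using side_of_letter[OF cancel(3)] by simp
  have "pres_eq (gens D ?i) (rels D ?i) ([] @ [l, linv l] @ []) ([] @ [])"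
    using l by (intro pres_eq.cancel) auto
  then have "elt (gens D ?i) (rels D ?i) [l, linv l] = elt (gens D ?i) (rels D ?i) []"
    using l by (simp add: elt_eq_iff)
  then have "word_act [l, linv l] \<omega>' = word_act [] \<omega>'" if "\<omega>' \<in> vdW.nforms" for \<omega>'
    using word_act_factor[OF _ that, of _ ?i] l by (metis lists.Nil)
  then have "word_act [l, linv l] (word_act v \<omega>) = word_act v \<omega>"
    using word_act_closed cancel by (metis word_act.simps(1))
  then show ?case unfolding word_act_append by (rule arg_cong)
next
  case (relator u v r)
  then show ?case using word_act_relator word_act_closed by (simp add: word_act_append)
qed simp_all

text \<open>Each syllable, applied from the right end on, adds one entry to the normal form, because it is
  outside \<open>A\<close> and on another side than the entry added before.\<close>

lemma normal_word_act:
  assumes "\<And>s. s \<in> set ss \<Longrightarrow> snd s \<in> words (gens D (fst s)) \<and> gelt D (snd s) \<notin> amal_img D"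
    and "successively (\<lambda>s t. fst s \<noteq> fst t) ss"
  shows "\<exists>a\<in>carrier (amal D). \<exists>w. word_act (concat (map snd ss)) (\<one>\<^bsub>amal D\<^esub>, []) = (a, w) \<and>
    map fst w = map fst ss \<and> (\<forall>i. ss = [] \<or> fst (hd ss) \<noteq> i \<longrightarrow> w \<in> vdW.tails i)"
  using assms
proof (induction ss)
  case Nil
  show ?case by (auto simp: vdW.tails_def)
next
  case (Cons s ss)
  obtain i u where s: "s = (i, u)" by (cases s)
  have "successively (\<lambda>s t. fst s \<noteq> fst t) ss"
    using Cons.prems(2) by (auto simp: successively_Cons)
  then have "\<exists>a\<in>carrier (amal D). \<exists>w. word_act (concat (map snd ss)) (\<one>\<^bsub>amal D\<^esub>, []) = (a, w) \<and>
    map fst w = map fst ss \<and> (\<forall>i. ss = [] \<or> fst (hd ss) \<noteq> i \<longrightarrow> w \<in> vdW.tails i)"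
    using Cons.prems(1) by (intro Cons.IH) simp_all
  then obtain a w where IH: "a \<in> carrier (amal D)"
    "word_act (concat (map snd ss)) (\<one>\<^bsub>amal D\<^esub>, []) = (a, w)" "map fst w = map fst ss"
    "\<And>i. ss = [] \<or> fst (hd ss) \<noteq> i \<Longrightarrow> w \<in> vdW.tails i"
    by blast
  have u: "u \<in> words (gens D i)" "gelt D u \<notin> amal_img D" using Cons.prems(1)[of s] s by auto
  have "elt (gens D i) (rels D i) u \<notin> vdW.img i"
  proof
    assume "elt (gens D i) (rels D i) u \<in> vdW.img i"
    then obtain a where "a \<in> carrier (amal D)" "emb D i a = elt (gens D i) (rels D i) u"
      unfolding vdW.img_def by (metis imageE)
    moreover have "u \<in> elt (gens D i) (rels D i) u" using u by (simp add: mem_elt_iff pres_eq.refl)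
    ultimately show False using u amal_img_iff[of _ i] by metis
  qed
  moreover have "ss = [] \<or> fst (hd ss) \<noteq> i" using Cons.prems(2) s by (cases ss) auto
  then have t: "w \<in> vdW.tails i" by (rule IH(4))
  ultimately obtain b t where bt: "b \<in> carrier (amal D)" "t \<in> vdW.transversal i"
    "vdW.act i (elt (gens D i) (rels D i) u) (a, w) = (b, (i, t) # w)"
    using vdW.act_grows[OF elt_factor_closed[OF u(1)] _ IH(1)] by metis
  have "word_act (concat (map snd (s # ss))) (\<one>\<^bsub>amal D\<^esub>, []) = (b, (i, t) # w)"
    using s IH(2) bt(3) word_act_factor[OF u(1) vdW.tails_nforms[OF IH(1) t]]
    by (simp add: word_act_append)
  moreover have "(i, t) # w \<in> vdW.tails j" if "i \<noteq> j" for j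
    using vdW.tails_Cons[OF bt(2) t] that neq_iff_other[of j i] by simp
  ultimately show ?case using bt IH(3) s by auto
qed

text \<open>Passage from syllables given by words to syllables given by elements of the amalgam.\<close>

definition spelled :: "(side \<times> 'x word) list \<Rightarrow> (side \<times> 'x word set) list" where
  "spelled ss = map (\<lambda>s. (fst s, gelt D (snd s))) ss"

lemma eval_spelled:
  assumes "\<And>s. s \<in> set ss \<Longrightarrow> snd s \<in> words (gens D (fst s))"
  shows "concat (map snd ss) \<in> words (all_gens D)"
    and "eval (spelled ss) = gelt D (concat (map snd ss))"
proof -
  have "concat (map snd ss) \<in> words (all_gens D) \<and> eval (spelled ss) = gelt D (concat (map snd ss))"
    using assms
  proof (induction ss)
    case (Cons s ss)
    have "snd s \<in> words (all_gens D)" using Cons.prems[of s] words_all by simp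
    moreover have "concat (map snd ss) \<in> words (all_gens D) \<and>
        eval (spelled ss) = gelt D (concat (map snd ss))"
      using Cons.prems by (intro Cons.IH) simp
    ultimately show ?case by (simp add: spelled_def gelt_append)
  qed (simp add: spelled_def gelt_Nil)
  then show "concat (map snd ss) \<in> words (all_gens D)"
    and "eval (spelled ss) = gelt D (concat (map snd ss))" by simp_all
qed

lemma spell:
  assumes "set p \<subseteq> syllables"
  obtains ss where "spelled ss = p" "\<And>s. s \<in> set ss \<Longrightarrow> snd s \<in> words (gens D (fst s))"
proof -
  have "\<exists>ss. spelled ss = p \<and> (\<forall>s\<in>set ss. snd s \<in> words (gens D (fst s)))"
    using assms
  proof (induction p)
    case (Cons s p)
    obtain i g where s: "s = (i, g)" by (cases s)
    obtain ss where ss: "spelled ss = p" "\<forall>s\<in>set ss. snd s \<in> words (gens D (fst s))"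
      using Cons by auto
    obtain u where u: "u \<in> words (gens D i)" "g = gelt D u"
      using Cons.prems s by (auto simp: FF_def)
    show ?case using ss u s by (intro exI[of _ "(i, u) # ss"]) (simp add: spelled_def)
  qed (simp add: spelled_def)
  then show thesis using that by blast
qed

lemma eval_alternating_neq_one:
  assumes "alternating p" "p \<noteq> []"
  shows "eval p \<noteq> \<one>\<^bsub>GG\<^esub>"
proof
  assume one: "eval p = \<one>\<^bsub>GG\<^esub>"
  obtain ss where ss: "spelled ss = p" and words: "\<And>s. s \<in> set ss \<Longrightarrow> snd s \<in> words (gens D (fst s))"
    using spell[OF alternating_syllables[OF assms(1)]] by blast
  have "concat (map snd ss) \<in> words (all_gens D)" "gelt D (concat (map snd ss)) = \<one>\<^bsub>GG\<^esub>"
    using eval_spelled[of ss] words one ss by simp_all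
  then have "pres_eq (all_gens D) (all_rels D) (concat (map snd ss)) []"
    by (simp add: gelt_eq_iff[symmetric] gelt_Nil)
  moreover have "(\<one>\<^bsub>amal D\<^esub>, []) \<in> vdW.nforms" by (simp add: vdW.nforms_def vdW.tails_def)
  ultimately have "word_act (concat (map snd ss)) (\<one>\<^bsub>amal D\<^esub>, []) = (\<one>\<^bsub>amal D\<^esub>, [])"
    using word_act_cong by fastforce
  moreover have "\<And>s. s \<in> set ss \<Longrightarrow> snd s \<in> words (gens D (fst s)) \<and> gelt D (snd s) \<notin> amal_img D"
    using assms(1) words unfolding ss[symmetric] alternating_def spelled_def by auto
  moreover have "successively (\<lambda>s t. fst s \<noteq> fst t) ss"
    using assms(1) unfolding ss[symmetric] alternating_def spelled_def by (simp add: successively_map)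
  ultimately have "ss = []" using normal_word_act[of ss] by auto
  then show False using assms(2) ss by (simp add: spelled_def)
qed

lemma letter_FF: "l \<in> letters (gens D i) \<Longrightarrow> gelt D [l] \<in> FF i"
  unfolding FF_def by simp

lemma gelt_Cons: "l \<in> letters (all_gens D) \<Longrightarrow> w \<in> words (all_gens D) \<Longrightarrow>
  gelt D (l # w) = gelt D [l] \<odot> gelt D w"
  using gelt_append[of "[l]" w] by simp

lemma spelled_syllables:
  assumes "\<And>s. s \<in> set ss \<Longrightarrow> snd s \<in> words (gens D (fst s))"
  shows "set (spelled ss) \<subseteq> syllables"
proof
  fix t assume "t \<in> set (spelled ss)"
  then obtain s where "s \<in> set ss" "t = (fst s, gelt D (snd s))" by (auto simp: spelled_def)
  then show "t \<in> syllables" using assms by (simp add: FF_def)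
qed

lemma eval_letters:
  assumes "w \<in> words (all_gens D)"
  shows "\<exists>p. set p \<subseteq> syllables \<and> eval p = gelt D w"
proof -
  let ?ss = "map (\<lambda>l. (side_of l, [l])) w"
  have words: "snd s \<in> words (gens D (fst s))" if "s \<in> set ?ss" for s
  proof -
    from that obtain l where "l \<in> set w" "s = (side_of l, [l])" by auto
    then show ?thesis using assms side_of_letter by (auto simp: in_lists_conv_set)
  qed
  have concat: "concat (map snd ?ss) = w" by (induction w) simp_all
  show ?thesis
  proof (intro exI conjI)
    show "set (spelled ?ss) \<subseteq> syllables" by (rule spelled_syllables[OF words])
    have "eval (spelled ?ss) = gelt D (concat (map snd ?ss))"
      by (rule eval_spelled(2)) (rule words)
    then show "eval (spelled ?ss) = gelt D w" by (simp only: concat)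
  qed
qed

sublocale amalgamated_product GG FF "amal_img D"
proof unfold_locales
  show "eval p \<noteq> \<one>\<^bsub>GG\<^esub>" if "alternating p" "p \<noteq> []" for p using that by (rule eval_alternating_neq_one)
  show "\<exists>p. set p \<subseteq> syllables \<and> eval p = g" if g: "g \<in> carrier GG" for g
  proof -
    obtain w where "w \<in> words (all_gens D)" "g = gelt D w" using g unfolding carrier_GG by blast
    then show ?thesis using eval_letters by simp
  qed
qed

end


section \<open>Paths and monochromatic components\<close>

lemma path_in_verts: "path \<Gamma> u p v \<Longrightarrow> labelled_graph X \<Gamma> \<Longrightarrow> u \<in> verts \<Gamma> \<and> v \<in> verts \<Gamma>"
  by (induction p arbitrary: u) (auto simp: labelled_graph_def)

lemma ter_in_verts: "labelled_graph X \<Gamma> \<Longrightarrow> e \<in> edges \<Gamma> \<Longrightarrow> ter \<Gamma> e \<in> verts \<Gamma>"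
  by (simp add: labelled_graph_def ter_def)

lemma path_append:
  assumes "labelled_graph X \<Gamma>"
  shows "path \<Gamma> u (p @ q) v \<longleftrightarrow> (\<exists>w. path \<Gamma> u p w \<and> path \<Gamma> w q v)"
  using assms path_in_verts by (induction p arbitrary: u) fastforce+

lemma path_words: "labelled_graph X \<Gamma> \<Longrightarrow> path \<Gamma> u p v \<Longrightarrow> plab \<Gamma> p \<in> words X"
  by (induction p arbitrary: u) (auto simp: labelled_graph_def)

definition path_rev :: "('v, 'e, 'x) lgraph \<Rightarrow> 'e list \<Rightarrow> 'e list" where
  "path_rev \<Gamma> p = rev (map (erev \<Gamma>) p)"

lemma path_path_rev:
  assumes "labelled_graph X \<Gamma>"
  shows "path \<Gamma> u p v \<Longrightarrow> path \<Gamma> v (path_rev \<Gamma> p) u"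
proof (induction p arbitrary: u)
  case Nil
  then show ?case by (auto simp: path_rev_def)
next
  case (Cons e p)
  then have e: "e \<in> edges \<Gamma>" "ini \<Gamma> e = u" "path \<Gamma> v (path_rev \<Gamma> p) (ter \<Gamma> e)" by auto
  then have "erev \<Gamma> e \<in> edges \<Gamma>" "ini \<Gamma> (erev \<Gamma> e) = ter \<Gamma> e" "ter \<Gamma> (erev \<Gamma> e) = u" "u \<in> verts \<Gamma>"
    using assms by (auto simp: labelled_graph_def ter_def)
  then have "path \<Gamma> (ter \<Gamma> e) [erev \<Gamma> e] u" by simp
  then show ?case using e by (auto simp: path_rev_def path_append[OF assms])
qed

lemma plab_path_rev:
  assumes "labelled_graph X \<Gamma>"
  shows "path \<Gamma> u p v \<Longrightarrow> plab \<Gamma> (path_rev \<Gamma> p) = winv (plab \<Gamma> p)"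
proof (induction p arbitrary: u)
  case (Cons e p)
  then have "lab \<Gamma> (erev \<Gamma> e) = linv (lab \<Gamma> e)" using assms by (auto simp: labelled_graph_def)
  then show ?case using Cons by (auto simp: path_rev_def winv_Cons)
qed (simp add: path_rev_def)

definition has_edge :: "'x set \<Rightarrow> ('v, 'e, 'x) lgraph \<Rightarrow> 'v \<Rightarrow> bool" where
  "has_edge X \<Gamma> v \<longleftrightarrow> (\<exists>e\<in>edges \<Gamma>. ini \<Gamma> e = v \<and> lab \<Gamma> e \<in> letters X)"

definition reach :: "'x set \<Rightarrow> ('v, 'e, 'x) lgraph \<Rightarrow> 'v \<Rightarrow> 'v set" where
  "reach X \<Gamma> v = {u. \<exists>p. path \<Gamma> v p u \<and> plab \<Gamma> p \<in> words X}"

text \<open>If \<open>X\<close> is the alphabet of one side, this is the monochromatic component of \<open>v\<close>. The structure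
  maps are kept, as \<open>subgraph\<close> requires.\<close>

definition mono_part :: "'x set \<Rightarrow> ('v, 'e, 'x) lgraph \<Rightarrow> 'v \<Rightarrow> ('v, 'e, 'x) lgraph" where
  "mono_part X \<Gamma> v = \<Gamma>\<lparr>verts := reach X \<Gamma> v,
     edges := {e \<in> edges \<Gamma>. ini \<Gamma> e \<in> reach X \<Gamma> v \<and> lab \<Gamma> e \<in> letters X}\<rparr>"

lemma mono_part_simps [simp]:
  "verts (mono_part X \<Gamma> v) = reach X \<Gamma> v"
  "edges (mono_part X \<Gamma> v) = {e \<in> edges \<Gamma>. ini \<Gamma> e \<in> reach X \<Gamma> v \<and> lab \<Gamma> e \<in> letters X}"
  "ini (mono_part X \<Gamma> v) = ini \<Gamma>" "erev (mono_part X \<Gamma> v) = erev \<Gamma>" "lab (mono_part X \<Gamma> v) = lab \<Gamma>"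
  "ter (mono_part X \<Gamma> v) = ter \<Gamma>"
  by (auto simp: mono_part_def ter_def fun_eq_iff)

lemma reach_self: "v \<in> verts \<Gamma> \<Longrightarrow> v \<in> reach X \<Gamma> v"
  unfolding reach_def by (intro CollectI exI[of _ "[]"]) simp

context
  fixes Y :: "'x set" and \<Gamma> :: "('v, 'e, 'x) lgraph"
  assumes lg: "labelled_graph Y \<Gamma>"
begin

lemma reach_path:
  assumes "u \<in> reach X \<Gamma> v" "path \<Gamma> u p w" "plab \<Gamma> p \<in> words X"
  shows "w \<in> reach X \<Gamma> v"
proof -
  obtain q where "path \<Gamma> v q u" "plab \<Gamma> q \<in> words X" using assms(1) by (auto simp: reach_def)
  then show ?thesis using assms path_append[OF lg]
    unfolding reach_def by (intro CollectI exI[of _ "q @ p"]) auto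
qed

lemma reach_sym:
  assumes "u \<in> reach X \<Gamma> v"
  shows "v \<in> reach X \<Gamma> u"
proof -
  obtain p where "path \<Gamma> v p u" "plab \<Gamma> p \<in> words X" using assms by (auto simp: reach_def)
  then have "path \<Gamma> u (path_rev \<Gamma> p) v" "plab \<Gamma> (path_rev \<Gamma> p) \<in> words X"
    using path_path_rev[OF lg] by (simp_all add: plab_path_rev[OF lg])
  then show ?thesis unfolding reach_def by blast
qed

lemma reach_eq:
  assumes "u \<in> reach X \<Gamma> v"
  shows "reach X \<Gamma> u = reach X \<Gamma> v"
proof -
  have "w \<in> reach X \<Gamma> v" if "u \<in> reach X \<Gamma> v" "w \<in> reach X \<Gamma> u" for u v w
    using that reach_path unfolding reach_def[of X \<Gamma> u] by blast
  then show ?thesis using assms reach_sym by blast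
qed

lemma comp_eq: "u \<in> reach X \<Gamma> v \<Longrightarrow> mono_part X \<Gamma> u = mono_part X \<Gamma> v"
  by (simp add: mono_part_def reach_eq)

lemma reach_verts: "reach X \<Gamma> v \<subseteq> verts \<Gamma>"
  using path_in_verts[OF _ lg] by (auto simp: reach_def)

lemma ter_reach:
  assumes "ini \<Gamma> e \<in> reach X \<Gamma> v" "e \<in> edges \<Gamma>" "lab \<Gamma> e \<in> letters X"
  shows "ter \<Gamma> e \<in> reach X \<Gamma> v"
  using reach_path[OF assms(1), of "[e]"] assms ter_in_verts[OF lg] by simp

lemma path_comp_iff:
  assumes "u \<in> reach X \<Gamma> v"
  shows "path (mono_part X \<Gamma> v) u p w \<longleftrightarrow> path \<Gamma> u p w \<and> plab \<Gamma> p \<in> words X"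
  using assms
proof (induction p arbitrary: u)
  case Nil
  then show ?case using reach_verts by auto
next
  case (Cons e p)
  show ?case
  proof (cases "e \<in> edges \<Gamma> \<and> ini \<Gamma> e = u \<and> lab \<Gamma> e \<in> letters X")
    case True
    then have "ter \<Gamma> e \<in> reach X \<Gamma> v" using ter_reach Cons.prems by simp
    then show ?thesis using Cons True by simp
  next
    case False
    then show ?thesis by auto
  qed
qed

lemma labelled_comp: "labelled_graph X (mono_part X \<Gamma> v)"
  unfolding labelled_graph_def
proof (intro ballI)
  fix e assume "e \<in> edges (mono_part X \<Gamma> v)"
  then have e: "e \<in> edges \<Gamma>" "ini \<Gamma> e \<in> reach X \<Gamma> v" "lab \<Gamma> e \<in> letters X" by auto
  have g: "erev \<Gamma> e \<in> edges \<Gamma>" "erev \<Gamma> e \<noteq> e" "erev \<Gamma> (erev \<Gamma> e) = e"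
      "lab \<Gamma> (erev \<Gamma> e) = linv (lab \<Gamma> e)"
    using lg e(1) unfolding labelled_graph_def by metis+
  have "ini \<Gamma> (erev \<Gamma> e) \<in> reach X \<Gamma> v" using ter_reach[OF e(2,1,3)] by (simp add: ter_def)
  then show "ini (mono_part X \<Gamma> v) e \<in> verts (mono_part X \<Gamma> v) \<and>
        erev (mono_part X \<Gamma> v) e \<in> edges (mono_part X \<Gamma> v) \<and> erev (mono_part X \<Gamma> v) e \<noteq> e \<and>
        erev (mono_part X \<Gamma> v) (erev (mono_part X \<Gamma> v) e) = e \<and> lab (mono_part X \<Gamma> v) e \<in> letters X \<and>
        lab (mono_part X \<Gamma> v) (erev (mono_part X \<Gamma> v) e) = linv (lab (mono_part X \<Gamma> v) e)"
    using e g linv_letters[of "lab \<Gamma> e" X] by simp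
qed

lemma connected_comp: "connected_graph (mono_part X \<Gamma> v)"
  unfolding connected_graph_def
proof (intro ballI)
  fix u w assume "u \<in> verts (mono_part X \<Gamma> v)" "w \<in> verts (mono_part X \<Gamma> v)"
  then have u: "u \<in> reach X \<Gamma> v" and "w \<in> reach X \<Gamma> u" using reach_eq by auto
  then show "\<exists>p. path (mono_part X \<Gamma> v) u p w"
    unfolding reach_def[of X \<Gamma> u] using path_comp_iff[OF u] by blast
qed

lemma subgraph_comp: "subgraph (mono_part X \<Gamma> v) \<Gamma>"
  unfolding subgraph_def using reach_verts by auto

lemma mono_connected_comp:
  assumes "v \<in> verts \<Gamma>" "has_edge (gens D i) \<Gamma> v"
  shows "mono_connected D \<Gamma> i (mono_part (gens D i) \<Gamma> v)"
proof -
  obtain e where "e \<in> edges \<Gamma>" "ini \<Gamma> e = v" "lab \<Gamma> e \<in> letters (gens D i)"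
    using assms(2) unfolding has_edge_def by metis
  then have "e \<in> edges (mono_part (gens D i) \<Gamma> v)" using reach_self[OF assms(1)] by simp
  then show ?thesis
    unfolding mono_connected_def
    by (intro conjI labelled_comp connected_comp subgraph_comp) auto
qed

lemma subgraph_path:
  "subgraph C \<Gamma> \<Longrightarrow> path C u p v \<Longrightarrow> path \<Gamma> u p v"
  by (induction p arbitrary: u) (auto simp: subgraph_def ter_def)

lemma mono_connected_le_comp:
  assumes C: "mono_connected D \<Gamma> i C" and v: "v \<in> verts C"
  shows "subgraph C (mono_part (gens D i) \<Gamma> v)"
proof -
  have sub: "subgraph C \<Gamma>" and C': "labelled_graph (gens D i) C" "connected_graph C"
    using C by (auto simp: mono_connected_def)
  have lab_eq: "lab C = lab \<Gamma>" "ini C = ini \<Gamma>" "erev C = erev \<Gamma>" using sub by (auto simp: subgraph_def)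
  have reach: "u \<in> reach (gens D i) \<Gamma> v" if uC: "u \<in> verts C" for u
  proof -
    obtain p where p: "path C v p u" using C'(2) v uC unfolding connected_graph_def by metis
    then have "path \<Gamma> v p u" "plab C p \<in> words (gens D i)"
      using subgraph_path[OF sub] path_words[OF C'(1)] by auto
    then show ?thesis using lab_eq by (auto simp: reach_def)
  qed
  have "e \<in> edges \<Gamma> \<and> ini \<Gamma> e \<in> reach (gens D i) \<Gamma> v \<and> lab \<Gamma> e \<in> letters (gens D i)"
    if "e \<in> edges C" for e
    using that reach C'(1) sub lab_eq unfolding labelled_graph_def subgraph_def by (metis subsetD)
  then show ?thesis using reach lab_eq unfolding subgraph_def by auto
qed

lemma subgraph_antisym: "subgraph C C' \<Longrightarrow> subgraph C' C \<Longrightarrow> C = C'"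
  by (auto simp: subgraph_def intro!: lgraph.equality)

text \<open>A connected subgraph labelled over one side is contained in the part reachable from any of its
  vertices; so these parts are maximal, and every component is one of them.\<close>

lemma mono_component_iff:
  "mono_component D \<Gamma> i C \<longleftrightarrow>
    (\<exists>v\<in>verts \<Gamma>. has_edge (gens D i) \<Gamma> v \<and> C = mono_part (gens D i) \<Gamma> v)"
proof
  assume C: "mono_component D \<Gamma> i C"
  then have mc: "mono_connected D \<Gamma> i C" by (simp add: mono_component_def)
  then have sub: "subgraph C \<Gamma>" and C': "labelled_graph (gens D i) C"
    and ne: "edges C \<noteq> {}" by (auto simp: mono_connected_def)
  obtain e where e: "e \<in> edges C" using ne by blast
  have v: "ini C e \<in> verts C" "lab C e \<in> letters (gens D i)"
    using C' e unfolding labelled_graph_def by metis+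
  then have v\<Gamma>: "ini C e \<in> verts \<Gamma>" "has_edge (gens D i) \<Gamma> (ini C e)"
    using sub e by (auto simp: subgraph_def has_edge_def)
  have "mono_part (gens D i) \<Gamma> (ini C e) = C"
    using C mono_connected_comp[OF v\<Gamma>] mono_connected_le_comp[OF mc v(1)]
    unfolding mono_component_def by blast
  then show "\<exists>v\<in>verts \<Gamma>. has_edge (gens D i) \<Gamma> v \<and> C = mono_part (gens D i) \<Gamma> v"
    using v\<Gamma> by metis
next
  assume "\<exists>v\<in>verts \<Gamma>. has_edge (gens D i) \<Gamma> v \<and> C = mono_part (gens D i) \<Gamma> v"
  then obtain v where v: "v \<in> verts \<Gamma>" "has_edge (gens D i) \<Gamma> v" "C = mono_part (gens D i) \<Gamma> v" by blast
  show "mono_component D \<Gamma> i C"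
    unfolding mono_component_def
  proof (intro conjI allI impI)
    show "mono_connected D \<Gamma> i C" using mono_connected_comp v by blast
    fix C' assume C': "mono_connected D \<Gamma> i C' \<and> subgraph C C'"
    then have "reach (gens D i) \<Gamma> v \<subseteq> verts C'" using v(3) by (simp add: subgraph_def)
    then have "v \<in> verts C'" using reach_self[OF v(1)] by blast
    then have "subgraph C' C" using mono_connected_le_comp C' v by blast
    then show "C' = C" using subgraph_antisym C' by blast
  qed
qed

end

section \<open>Graphs of cosets\<close>

locale amalgam_cosets = presented_amalgam D for D :: "('x, 'a) amalgam_data" +
  fixes H :: "'x word set set"
  assumes subgroup_H: "subgroup H GG"
begin

sublocale amalgam_with_subgroup GG FF "amal_img D" H
  by (intro amalgam_with_subgroup.intro amalgam_with_subgroup_axioms.intro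
      amalgamated_product_axioms subgroup_H)

end

text \<open>A labelled graph realized by \<open>f\<close> as a union of full components of \<open>Cayley(G,H)\<close>. This covers both
  graphs to be compared, the normal core with \<open>f = id\<close> and an arbitrary precover, so that the
  notions of the theorem are translated into sets of cosets once for both.\<close>

locale graph_of_cosets = amalgam_cosets D H for D :: "('x, 'a) amalgam_data" and H +
  fixes \<Gamma> :: "('v, 'e, 'x) lgraph" and v0 :: 'v and f :: "'v \<Rightarrow> 'x word set set"
  assumes labelled: "labelled_graph (all_gens D) \<Gamma>"
    and v0_vert: "v0 \<in> verts \<Gamma>"
    and f_inj: "inj_on f (verts \<Gamma>)"
    and f_carrier: "v \<in> verts \<Gamma> \<Longrightarrow> f v \<subseteq> carrier GG"
    and f_v0: "f v0 = H"
    and f_ter: "e \<in> edges \<Gamma> \<Longrightarrow> f (ter \<Gamma> e) = f (ini \<Gamma> e) \<cdot> gelt D [lab \<Gamma> e]"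
    and full: "v \<in> verts \<Gamma> \<Longrightarrow> has_edge (gens D i) \<Gamma> v \<Longrightarrow> l \<in> letters (gens D i) \<Longrightarrow>
      \<exists>e\<in>edges \<Gamma>. ini \<Gamma> e = v \<and> lab \<Gamma> e = l"
    and well_labelled: "e \<in> edges \<Gamma> \<Longrightarrow> e' \<in> edges \<Gamma> \<Longrightarrow> ini \<Gamma> e = ini \<Gamma> e' \<Longrightarrow>
      lab \<Gamma> e = lab \<Gamma> e' \<Longrightarrow> e = e'"
begin

abbreviation colored :: "side \<Rightarrow> 'v \<Rightarrow> bool" where
  "colored i v \<equiv> v \<in> verts \<Gamma> \<and> has_edge (gens D i) \<Gamma> v"

abbreviation cmp :: "side \<Rightarrow> 'v \<Rightarrow> ('v, 'e, 'x) lgraph" where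
  "cmp i v \<equiv> mono_part (gens D i) \<Gamma> v"

text \<open>This is the system of orbits that encodes the graph.\<close>

definition colors :: "side \<Rightarrow> 'x word set set set" where
  "colors i = f ` {v. colored i v}"

lemma edgeD:
  assumes "e \<in> edges \<Gamma>"
  shows "ini \<Gamma> e \<in> verts \<Gamma>" "ter \<Gamma> e \<in> verts \<Gamma>" "lab \<Gamma> e \<in> letters (all_gens D)"
    "erev \<Gamma> e \<in> edges \<Gamma>" "lab \<Gamma> (erev \<Gamma> e) = linv (lab \<Gamma> e)" "ini \<Gamma> (erev \<Gamma> e) = ter \<Gamma> e"
  using labelled assms ter_in_verts[OF labelled assms]
  unfolding labelled_graph_def ter_def by metis+

lemma f_eq_iff: "u \<in> verts \<Gamma> \<Longrightarrow> v \<in> verts \<Gamma> \<Longrightarrow> f u = f v \<longleftrightarrow> u = v"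
  using f_inj by (auto dest: inj_onD)

lemma path_f: "path \<Gamma> u p v \<Longrightarrow> f v = f u \<cdot> gelt D (plab \<Gamma> p)"
proof (induction p arbitrary: u)
  case Nil
  then have "v = u" "f u \<subseteq> carrier GG" using f_carrier by auto
  then show ?case by (simp add: gelt_Nil)
next
  case (Cons e p)
  then have e: "e \<in> edges \<Gamma>" "ini \<Gamma> e = u" and p: "path \<Gamma> (ter \<Gamma> e) p v" by auto
  have w: "[lab \<Gamma> e] \<in> words (all_gens D)" "plab \<Gamma> p \<in> words (all_gens D)"
    using edgeD[OF e(1)] path_words[OF labelled p] by auto
  have "f v = f u \<cdot> gelt D [lab \<Gamma> e] \<cdot> gelt D (plab \<Gamma> p)"
    using Cons.IH[OF p] f_ter[OF e(1)] e by simp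
  also have "\<dots> = f u \<cdot> gelt D ([lab \<Gamma> e] @ plab \<Gamma> p)"
    using w f_carrier[OF edgeD(1)[OF e(1)]] e
    by (simp only: gelt_append GG.coset_mult_assoc gelt_closed)
  finally show ?case by simp
qed

lemma colored_ter:
  assumes "e \<in> edges \<Gamma>" "lab \<Gamma> e \<in> letters (gens D i)"
  shows "colored i (ter \<Gamma> e)"
proof -
  have "lab \<Gamma> (erev \<Gamma> e) \<in> letters (gens D i)" using edgeD[OF assms(1)] assms(2) linv_letters by metis
  then show ?thesis using edgeD[OF assms(1)] unfolding has_edge_def by metis
qed

lemma colored_path:
  assumes "colored i u" "path \<Gamma> u p v" "plab \<Gamma> p \<in> words (gens D i)"
  shows "colored i v"
  using assms
proof (induction p arbitrary: u)
  case (Cons e p)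
  then show ?case using colored_ter[of e i] by simp
qed simp

lemma read_word:
  assumes "colored i v" "w \<in> words (gens D i)"
  shows "\<exists>p u. path \<Gamma> v p u \<and> plab \<Gamma> p = w"
  using assms
proof (induction w arbitrary: v)
  case Nil
  then show ?case by (intro exI[of _ "[]"]) simp
next
  case (Cons l w)
  then have l: "l \<in> letters (gens D i)" "w \<in> words (gens D i)" by auto
  obtain e where e: "e \<in> edges \<Gamma>" "ini \<Gamma> e = v" "lab \<Gamma> e = l"
    using full Cons.prems(1) l(1) by blast
  then have "colored i (ter \<Gamma> e)" using colored_ter l by simp
  then obtain p u where "path \<Gamma> (ter \<Gamma> e) p u" "plab \<Gamma> p = w" using Cons.IH l(2) by blast
  then show ?case using e by (intro exI[of _ "e # p"] exI[of _ u]) simp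
qed

lemma act_vertex:
  assumes "colored i v" "g \<in> FF i"
  obtains p u where "path \<Gamma> v p u" "plab \<Gamma> p \<in> words (gens D i)" "gelt D (plab \<Gamma> p) = g"
    "colored i u" "u \<in> reach (gens D i) \<Gamma> v" "f u = f v \<cdot> g"
proof -
  obtain w where w: "w \<in> words (gens D i)" "g = gelt D w" using assms(2) by (auto simp: FF_def)
  obtain p u where p: "path \<Gamma> v p u" "plab \<Gamma> p = w" using read_word[OF assms(1) w(1)] by blast
  then have "colored i u" using colored_path[OF assms(1)] w by metis
  moreover have "u \<in> reach (gens D i) \<Gamma> v" using p w by (auto simp: reach_def)
  moreover have "f u = f v \<cdot> g" using path_f[OF p(1)] p w by simp
  ultimately show thesis using that p w by metis
qed

lemma colored_iff_colors: "v \<in> verts \<Gamma> \<Longrightarrow> f v \<in> colors i \<longleftrightarrow> colored i v"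
  unfolding colors_def using f_eq_iff by blast

lemma saturated_colors: "saturated colors"
  unfolding saturated_def
proof (intro allI ballI conjI)
  fix i c assume "c \<in> colors i"
  then obtain v where v: "colored i v" "c = f v" by (auto simp: colors_def)
  then show "c \<subseteq> carrier GG" using f_carrier by blast
  fix g assume "g \<in> FF i"
  then obtain u where "colored i u" "f u = c \<cdot> g" using act_vertex[OF v(1)] v(2) by metis
  then show "c \<cdot> g \<in> colors i" unfolding colors_def by (metis imageI mem_Collect_eq)
qed

lemma reach_iff:
  assumes "colored i v"
  shows "u \<in> reach (gens D i) \<Gamma> v \<longleftrightarrow> u \<in> verts \<Gamma> \<and> (\<exists>g\<in>FF i. f u = f v \<cdot> g)"
proof
  assume "u \<in> reach (gens D i) \<Gamma> v"
  then obtain p where p: "path \<Gamma> v p u" "plab \<Gamma> p \<in> words (gens D i)" by (auto simp: reach_def)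
  then have "gelt D (plab \<Gamma> p) \<in> FF i" by (simp add: FF_def)
  then show "u \<in> verts \<Gamma> \<and> (\<exists>g\<in>FF i. f u = f v \<cdot> g)"
    using path_f[OF p(1)] path_in_verts[OF p(1) labelled] by blast
next
  assume u: "u \<in> verts \<Gamma> \<and> (\<exists>g\<in>FF i. f u = f v \<cdot> g)"
  then obtain g where g: "g \<in> FF i" "f u = f v \<cdot> g" by blast
  obtain u' where "colored i u'" "u' \<in> reach (gens D i) \<Gamma> v" "f u' = f v \<cdot> g"
    using act_vertex[OF assms g(1)] by metis
  then show "u \<in> reach (gens D i) \<Gamma> v" using u g f_eq_iff by metis
qed

lemma colored_reach:
  assumes "colored i v" "u \<in> reach (gens D i) \<Gamma> v"
  shows "colored i u"
  using assms colored_path unfolding reach_def by blast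

lemma Lab_comp:
  assumes "colored i v" "u \<in> reach (gens D i) \<Gamma> v"
  shows "Lab D (cmp i v) u = {g \<in> FF i. f u \<cdot> g = f u}"
proof (intro Set.set_eqI iffI)
  fix g assume "g \<in> Lab D (cmp i v) u"
  then obtain p where p: "path \<Gamma> u p u" "plab \<Gamma> p \<in> words (gens D i)" "g = gelt D (plab \<Gamma> p)"
    unfolding Lab_def using path_comp_iff[OF labelled assms(2)] by auto
  then show "g \<in> {g \<in> FF i. f u \<cdot> g = f u}" using path_f[OF p(1)] by (simp add: FF_def)
next
  fix g assume "g \<in> {g \<in> FF i. f u \<cdot> g = f u}"
  then have g: "g \<in> FF i" "f u \<cdot> g = f u" by auto
  have u: "colored i u" using colored_reach assms by blast
  obtain p u' where p: "path \<Gamma> u p u'" "plab \<Gamma> p \<in> words (gens D i)" "gelt D (plab \<Gamma> p) = g"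
      "colored i u'" "f u' = f u \<cdot> g"
    using act_vertex[OF u g(1)] by metis
  then have "u' = u" using g u f_eq_iff by metis
  then have "path (cmp i v) u p u" using p path_comp_iff[OF labelled assms(2)] by blast
  then show "g \<in> Lab D (cmp i v) u" unfolding Lab_def using p by auto
qed

lemma bichromatic_iff:
  "bichromatic D \<Gamma> v \<longleftrightarrow> colored i v \<and> colored (other i) v"
proof -
  have "(\<forall>j. P j) \<longleftrightarrow> P i \<and> P (other i)" for P
  proof (intro iffI allI)
    fix j assume "P i \<and> P (other i)"
    then show "P j" using neq_iff_other[of j i] by (cases "j = i") simp_all
  qed simp
  from this[of "\<lambda>i. has_edge (gens D i) \<Gamma> v"] show ?thesis
    unfolding bichromatic_def has_edge_def[symmetric] by auto
qed

lemma A_orbit_comp: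
  assumes "colored i \<theta>"
  shows "w \<in> A_orbit D i (cmp i \<theta>) \<theta> \<longleftrightarrow>
    w \<in> verts \<Gamma> \<and> f w \<in> (\<lambda>a. f \<theta> \<cdot> a) ` amal_img D"
proof
  have self: "\<theta> \<in> reach (gens D i) \<Gamma> \<theta>" using assms by (intro reach_self) simp
  {
    assume "w \<in> A_orbit D i (cmp i \<theta>) \<theta>"
    then obtain a p where p: "a \<in> carrier (amal D)" "path \<Gamma> \<theta> p w" "plab \<Gamma> p \<in> emb D i a"
      unfolding A_orbit_def using path_comp_iff[OF labelled self] by auto
    then have "gelt D (plab \<Gamma> p) \<in> amal_img D" unfolding amal_img_def by blast
    then show "w \<in> verts \<Gamma> \<and> f w \<in> (\<lambda>a. f \<theta> \<cdot> a) ` amal_img D"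
      using path_f[OF p(2)] path_in_verts[OF p(2) labelled] by simp
  next
    assume w: "w \<in> verts \<Gamma> \<and> f w \<in> (\<lambda>a. f \<theta> \<cdot> a) ` amal_img D"
    then obtain g where g: "g \<in> amal_img D" "f w = f \<theta> \<cdot> g" by blast
    obtain a u where a: "a \<in> carrier (amal D)" "u \<in> emb D i a" "g = gelt D u"
      using g(1) amal_img_iff[of g i] by blast
    have u: "u \<in> words (gens D i)" using emb_memD a by blast
    obtain p w' where p: "path \<Gamma> \<theta> p w'" "plab \<Gamma> p = u" using read_word[OF assms u] by blast
    then have "w' = w" using path_f[OF p(1)] g a path_in_verts[OF p(1) labelled] w f_eq_iff by metis
    then have "path (cmp i \<theta>) \<theta> p w" using p u path_comp_iff[OF labelled self] by auto
    then show "w \<in> A_orbit D i (cmp i \<theta>) \<theta>"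
      unfolding A_orbit_def using a p by auto
  }
qed

lemma component_iff:
  "mono_component D \<Gamma> i C \<longleftrightarrow> (\<exists>v. colored i v \<and> C = cmp i v)"
  using mono_component_iff[OF labelled] by blast

lemma G_based: "G_based D \<Gamma>"
  unfolding G_based_def
proof (intro allI impI)
  fix u p v assume p: "path \<Gamma> u p v" "gelt D (plab \<Gamma> p) = \<one>\<^bsub>amalg_gp D\<^esub>"
  then have "u \<in> verts \<Gamma>" "v \<in> verts \<Gamma>" using path_in_verts labelled by metis+
  then show "u = v" using path_f[OF p(1)] p(2) f_carrier f_eq_iff GG.coset_mult_one by metis
qed

lemma walk_path:
  assumes "walk colors (f v) p" "v \<in> verts \<Gamma>"
  shows "\<exists>q u. path \<Gamma> v q u \<and> gelt D (plab \<Gamma> q) = eval p"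
  using assms
proof (induction p arbitrary: v)
  case Nil
  then show ?case by (intro exI[of _ "[]"] exI[of _ v]) (simp add: gelt_Nil)
next
  case (Cons s p)
  obtain i g where s: "s = (i, g)" by (cases s)
  have "colored i v" "g \<in> FF i" using Cons.prems s colored_iff_colors by auto
  then obtain q u where q: "path \<Gamma> v q u" "gelt D (plab \<Gamma> q) = g" "colored i u"
      "f u = f v \<cdot> g"
    using act_vertex by metis
  then obtain r w where r: "path \<Gamma> u r w" "gelt D (plab \<Gamma> r) = eval p"
    using Cons.IH[of u] Cons.prems s by auto
  have "path \<Gamma> v (q @ r) w" using q r path_append[OF labelled] by blast
  moreover have "gelt D (plab \<Gamma> (q @ r)) = g \<odot> eval p"
    using q r path_words[OF labelled] by (simp add: gelt_append)
  ultimately show ?case using s by (metis eval.simps(2) snd_conv)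
qed

lemma path_walk:
  assumes "path \<Gamma> v q u"
  shows "\<exists>p. walk colors (f v) p \<and> eval p = gelt D (plab \<Gamma> q)"
  using assms
proof (induction q arbitrary: v)
  case Nil
  then show ?case by (intro exI[of _ "[]"]) (simp add: gelt_Nil)
next
  case (Cons e q)
  then have e: "e \<in> edges \<Gamma>" "ini \<Gamma> e = v" and q: "path \<Gamma> (ter \<Gamma> e) q u" by auto
  obtain p where p: "walk colors (f (ter \<Gamma> e)) p" "eval p = gelt D (plab \<Gamma> q)"
    using Cons.IH[OF q] by blast
  obtain i where i: "lab \<Gamma> e \<in> letters (gens D i)"
    using edgeD(3)[OF e(1)] letters_all[of "lab \<Gamma> e"] by metis
  have "colored i v" using e i edgeD(1)[OF e(1)] unfolding has_edge_def by metis
  then have "f v \<in> colors i" using colored_iff_colors by simp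
  then have "walk colors (f v) ((i, gelt D [lab \<Gamma> e]) # p)"
    using p f_ter[OF e(1)] e letter_FF[OF i] by simp
  moreover have "eval ((i, gelt D [lab \<Gamma> e]) # p) = gelt D (plab \<Gamma> (e # q))"
    using p gelt_Cons[OF edgeD(3)[OF e(1)] path_words[OF labelled q]] by simp
  ultimately show ?case by blast
qed

lemma closed_path_iff:
  assumes "path \<Gamma> v0 p u"
  shows "gelt D (plab \<Gamma> p) \<in> H \<longleftrightarrow> u = v0"
proof -
  have "gelt D (plab \<Gamma> p) \<in> carrier GG" using path_words[OF labelled assms] by simp
  then have "gelt D (plab \<Gamma> p) \<in> H \<longleftrightarrow> f u = f v0"
    using path_f[OF assms] f_v0 H_act_iff by simp
  then show ?thesis using f_eq_iff v0_vert path_in_verts[OF assms labelled] by simp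
qed

lemma Lab_eq_iff: "Lab D \<Gamma> v0 = H \<longleftrightarrow> spans colors"
proof -
  have sub: "Lab D \<Gamma> v0 \<subseteq> H"
    unfolding Lab_def using closed_path_iff by blast
  have "H \<subseteq> Lab D \<Gamma> v0 \<longleftrightarrow> spans colors"
  proof
    assume le: "H \<subseteq> Lab D \<Gamma> v0"
    show "spans colors"
      unfolding spans_def
    proof
      fix h assume "h \<in> H"
      then obtain p where "path \<Gamma> v0 p v0" "h = gelt D (plab \<Gamma> p)" using le unfolding Lab_def by blast
      then show "\<exists>p. walk colors H p \<and> eval p = h" using path_walk[of v0 p v0] f_v0 by metis
    qed
  next
    assume sp: "spans colors"
    show "H \<subseteq> Lab D \<Gamma> v0"
    proof
      fix h assume h: "h \<in> H"
      then obtain p where "walk colors H p" "eval p = h" using sp unfolding spans_def by blast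
      then obtain q u where q: "path \<Gamma> v0 q u" "gelt D (plab \<Gamma> q) = h"
        using walk_path[of v0 p] f_v0 v0_vert by metis
      then have "u = v0" using closed_path_iff h by blast
      then show "h \<in> Lab D \<Gamma> v0" unfolding Lab_def using q by blast
    qed
  qed
  then show ?thesis using sub by blast
qed

lemma connected_reachable: "connected_graph \<Gamma> \<Longrightarrow> reachable colors"
  unfolding reachable_def
proof (intro allI ballI)
  fix i c assume c: "connected_graph \<Gamma>" "c \<in> colors i"
  then obtain u where u: "u \<in> verts \<Gamma>" "c = f u" by (auto simp: colors_def)
  then obtain p where p: "path \<Gamma> v0 p u" using c(1) v0_vert unfolding connected_graph_def by blast
  then show "\<exists>p. walk colors H p \<and> H \<cdot> eval p = c"
    using path_walk[OF p] path_f[OF p] f_v0 u by metis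
qed

lemma reachable_connected:
  assumes "reachable colors" "\<And>v. v \<in> verts \<Gamma> \<Longrightarrow> v = v0 \<or> (\<exists>i. colored i v)"
  shows "connected_graph \<Gamma>"
proof -
  have from_v0: "\<exists>p. path \<Gamma> v0 p u" if u: "u \<in> verts \<Gamma>" for u
  proof (cases "u = v0")
    case True
    then show ?thesis using v0_vert by (intro exI[of _ "[]"]) simp
  next
    case False
    then obtain i where "colored i u" using assms(2) u by blast
    then have "f u \<in> colors i" using colored_iff_colors by blast
    then obtain p where p: "walk colors H p" "H \<cdot> eval p = f u"
      using assms(1) unfolding reachable_def by blast
    then obtain q w where q: "path \<Gamma> v0 q w" "gelt D (plab \<Gamma> q) = eval p"
      using walk_path[of v0 p] f_v0 v0_vert by metis
    then have "f w = f u" using path_f[OF q(1)] p f_v0 by metis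
    then show ?thesis using q u f_eq_iff path_in_verts[OF q(1) labelled] by metis
  qed
  show ?thesis unfolding connected_graph_def
  proof (intro ballI)
    fix u w assume "u \<in> verts \<Gamma>" "w \<in> verts \<Gamma>"
    then obtain p q where "path \<Gamma> v0 p u" "path \<Gamma> v0 q w" using from_v0 by meson
    then have "path \<Gamma> u (path_rev \<Gamma> p @ q) w"
      using path_append[OF labelled] path_path_rev[OF labelled] by blast
    then show "\<exists>p. path \<Gamma> u p w" by blast
  qed
qed


text \<open>Orbit and stabilizer: if \<open>S\<close> is the set of elements of the factor that fix the vertex \<open>v\<close>, then
  the endpoint of the path from \<open>v\<close> with label \<open>w\<close> corresponds to the coset \<open>Sw\<close>. As the group \<open>S\<close> is taken
  in the factor, it contains the kernel of the map to the amalgam.\<close>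

lemma component_is_cover:
  assumes v: "colored i v"
  shows "is_cover D i (cmp i v)"
proof -
  let ?X = "gens D i" and ?K = "factor D i" and ?R = "reach (gens D i) \<Gamma> v"
  define el where "el w = elt (gens D i) (rels D i) w" for w
  define S where "S = {el w | w. w \<in> words ?X \<and> f v \<cdot> gelt D w = f v}"
  have fv: "f v \<subseteq> carrier GG" using f_carrier v by simp
  have gw: "gelt D w \<in> carrier GG" if "w \<in> words ?X" for w using that words_all by simp
  have el_closed [simp]: "el w \<in> carrier ?K" if "w \<in> words ?X" for w
    using that by (simp add: el_def)
  have el_append: "el (u @ w) = el u \<otimes>\<^bsub>?K\<^esub> el w" if "u \<in> words ?X" "w \<in> words ?X" for u w
    using that by (simp add: el_def factor_def)
  have el_winv: "el (winv w) = inv\<^bsub>?K\<^esub> el w" if "w \<in> words ?X" for w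
    using that by (simp add: el_def factor_def inv_gp)
  have carrier_K: "carrier ?K = el ` words ?X"
    unfolding el_def[abs_def] factor_def by (rule carrier_gp)
  have el_S: "el w \<in> S \<longleftrightarrow> f v \<cdot> gelt D w = f v" if "w \<in> words ?X" for w
  proof
    assume "el w \<in> S"
    then obtain u where u: "u \<in> words ?X" "el w = el u" "f v \<cdot> gelt D u = f v"
      unfolding S_def by blast
    have "gelt D w = gelt D u" using elt_factor[OF that] u(2) unfolding el_def by metis
    then show "f v \<cdot> gelt D w = f v" using u by simp
  qed (use that S_def in blast)
  have act_winv: "f v \<cdot> gelt D (u @ winv w) = f v \<longleftrightarrow> f v \<cdot> gelt D u = f v \<cdot> gelt D w"
    if "u \<in> words ?X" "w \<in> words ?X" for u w
  proof -
    have c: "gelt D u \<in> carrier GG" "gelt D w \<in> carrier GG" using gw that by auto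
    have e: "gelt D (u @ winv w) = gelt D u \<odot> inv\<^bsub>GG\<^esub> gelt D w"
      using that words_all by (simp add: gelt_append gelt_winv)
    show ?thesis unfolding e using GG.coset_mult_inv1[OF _ c fv] GG.coset_mult_inv2[OF _ c fv] by blast
  qed
  have S: "subgroup S ?K"
  proof (rule vdW.K.subgroupI)
    show "S \<subseteq> carrier ?K" by (auto simp: S_def)
    have "el [] \<in> S" using el_S[of "[]"] fv by (simp add: gelt_Nil)
    then show "S \<noteq> {}" by blast
    show "inv\<^bsub>?K\<^esub> k \<in> S" if k: "k \<in> S" for k
    proof -
      obtain w where w: "w \<in> words ?X" "k = el w" "f v \<cdot> gelt D w = f v"
        using k unfolding S_def by blast
      have "f v \<cdot> gelt D [] = f v \<cdot> gelt D w" using w fv by (simp add: gelt_Nil)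
      then have "f v \<cdot> gelt D (winv w) = f v" using act_winv[of "[]" w] w by simp
      then show ?thesis using w el_S[of "winv w"] el_winv by simp
    qed
    show "k \<otimes>\<^bsub>?K\<^esub> k' \<in> S" if k: "k \<in> S" "k' \<in> S" for k k'
    proof -
      obtain w where w: "w \<in> words ?X" "k = el w" "f v \<cdot> gelt D w = f v"
        using k(1) unfolding S_def by blast
      obtain u where u: "u \<in> words ?X" "k' = el u" "f v \<cdot> gelt D u = f v"
        using k(2) unfolding S_def by blast
      have "f v \<cdot> gelt D (w @ u) = f v \<cdot> gelt D w \<cdot> gelt D u"
        using w(1) u(1) fv words_all by (simp add: gelt_append GG.coset_mult_assoc)
      then show ?thesis using w u el_S[of "w @ u"] el_append by simp
    qed
  qed
  have coset_eq: "S #>\<^bsub>?K\<^esub> el u = S #>\<^bsub>?K\<^esub> el w \<longleftrightarrow> f v \<cdot> gelt D u = f v \<cdot> gelt D w"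
    if "u \<in> words ?X" "w \<in> words ?X" for u w
  proof -
    have Sc: "S \<subseteq> carrier ?K" using S subgroup.subset by blast
    have c: "el u \<in> carrier ?K" "el w \<in> carrier ?K" using that by auto
    have cc: "el u \<otimes>\<^bsub>?K\<^esub> inv\<^bsub>?K\<^esub> el w \<in> carrier ?K" using c by simp
    have "S #>\<^bsub>?K\<^esub> el u = S #>\<^bsub>?K\<^esub> el w \<longleftrightarrow> S #>\<^bsub>?K\<^esub> (el u \<otimes>\<^bsub>?K\<^esub> inv\<^bsub>?K\<^esub> el w) = S"
      using vdW.K.coset_mult_inv1[OF _ c Sc] vdW.K.coset_mult_inv2[OF _ c Sc] by blast
    also have "\<dots> \<longleftrightarrow> el u \<otimes>\<^bsub>?K\<^esub> inv\<^bsub>?K\<^esub> el w \<in> S"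
      using vdW.K.coset_join1[OF _ cc S] vdW.K.coset_join2[OF cc S] by blast
    also have "\<dots> \<longleftrightarrow> el (u @ winv w) \<in> S" using that el_append el_winv by simp
    also have "\<dots> \<longleftrightarrow> f v \<cdot> gelt D u = f v \<cdot> gelt D w"
      using el_S[of "u @ winv w"] act_winv[OF that] that by simp
    finally show ?thesis .
  qed
  define wd where "wd u = (SOME w. w \<in> words ?X \<and> f u = f v \<cdot> gelt D w)" for u
  define h where "h u = S #>\<^bsub>?K\<^esub> el (wd u)" for u
  have wd: "wd u \<in> words ?X" "f u = f v \<cdot> gelt D (wd u)" if u: "u \<in> ?R" for u
  proof -
    obtain g where "g \<in> FF i" "f u = f v \<cdot> g" using reach_iff[OF v] u by blast
    then have "\<exists>w. w \<in> words ?X \<and> f u = f v \<cdot> gelt D w" unfolding FF_def by blast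
    from someI_ex[OF this] show "wd u \<in> words ?X" "f u = f v \<cdot> gelt D (wd u)"
      unfolding wd_def by blast+
  qed
  have h_eq: "h u = S #>\<^bsub>?K\<^esub> el w" if "u \<in> ?R" "w \<in> words ?X" "f u = f v \<cdot> gelt D w" for u w
    unfolding h_def using coset_eq[OF wd(1)[OF that(1)] that(2)] wd(2)[OF that(1)] that(3) by simp
  have R_verts: "u \<in> verts \<Gamma>" if "u \<in> ?R" for u using that reach_verts[OF labelled] by blast
  have h_bij: "bij_betw h ?R (rcosets\<^bsub>?K\<^esub> S)"
    unfolding bij_betw_def
  proof
    show "inj_on h ?R"
    proof (rule inj_onI)
      fix u w assume uw: "u \<in> ?R" "w \<in> ?R" "h u = h w"
      then have "f u = f w"
        using coset_eq[OF wd(1) wd(1)] wd(2) unfolding h_def by metis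
      then show "u = w" using f_eq_iff R_verts uw by blast
    qed
    show "h ` ?R = rcosets\<^bsub>?K\<^esub> S"
    proof
      show "h ` ?R \<subseteq> rcosets\<^bsub>?K\<^esub> S"
      proof
        fix c assume "c \<in> h ` ?R"
        then obtain u where "u \<in> ?R" "c = h u" by blast
        then show "c \<in> rcosets\<^bsub>?K\<^esub> S"
          using el_closed[OF wd(1)] unfolding h_def RCOSETS_def by blast
      qed
      show "rcosets\<^bsub>?K\<^esub> S \<subseteq> h ` ?R"
      proof
        fix c assume "c \<in> rcosets\<^bsub>?K\<^esub> S"
        then obtain w where w: "w \<in> words ?X" "c = S #>\<^bsub>?K\<^esub> el w"
          unfolding RCOSETS_def carrier_K by blast
        obtain p u where p: "path \<Gamma> v p u" "plab \<Gamma> p = w" using read_word[OF v w(1)] by blast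
        then have "u \<in> ?R" using w unfolding reach_def by blast
        moreover have "f u = f v \<cdot> gelt D w" using path_f p by metis
        ultimately have "c = h u" using h_eq w by metis
        then show "c \<in> h ` ?R" using \<open>u \<in> ?R\<close> by blast
      qed
    qed
  qed
  define he where "he e = (h (ini \<Gamma> e), lab \<Gamma> e)" for e
  have h_ter: "h (ter \<Gamma> e) = h (ini \<Gamma> e) #>\<^bsub>?K\<^esub> el [lab \<Gamma> e]"
    if e: "e \<in> edges \<Gamma>" "ini \<Gamma> e \<in> ?R" "lab \<Gamma> e \<in> letters ?X" for e
  proof -
    let ?w = "wd (ini \<Gamma> e)"
    have w: "?w \<in> words ?X" "[lab \<Gamma> e] \<in> words ?X" using wd e by auto
    have "f (ter \<Gamma> e) = f v \<cdot> gelt D ?w \<cdot> gelt D [lab \<Gamma> e]"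
      using f_ter[OF e(1)] wd(2)[OF e(2)] by simp
    also have "\<dots> = f v \<cdot> gelt D (?w @ [lab \<Gamma> e])"
      using fv gelt_append[OF words_all[OF w(1)] words_all[OF w(2)]] gw[OF w(1)] gw[OF w(2)]
      by (simp only: GG.coset_mult_assoc)
    finally have "h (ter \<Gamma> e) = S #>\<^bsub>?K\<^esub> el (?w @ [lab \<Gamma> e])"
      using h_eq[OF ter_reach[OF labelled e(2,1,3)], of "?w @ [lab \<Gamma> e]"] w by simp
    also have "\<dots> = h (ini \<Gamma> e) #>\<^bsub>?K\<^esub> el [lab \<Gamma> e]"
      unfolding h_def el_append[OF w]
      using vdW.K.coset_mult_assoc[of S i "el ?w" "el [lab \<Gamma> e]"] w S subgroup.subset by fastforce
    finally show ?thesis .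
  qed
  have he_bij: "bij_betw he (edges (cmp i v)) ((rcosets\<^bsub>?K\<^esub> S) \<times> letters ?X)"
    unfolding bij_betw_def
  proof
    have hR: "h ` ?R = rcosets\<^bsub>?K\<^esub> S" and h_inj: "inj_on h ?R" using h_bij by (auto simp: bij_betw_def)
    show "inj_on he (edges (cmp i v))"
    proof (rule inj_onI)
      fix e e' assume e: "e \<in> edges (cmp i v)" "e' \<in> edges (cmp i v)" "he e = he e'"
      then have "ini \<Gamma> e = ini \<Gamma> e'" using inj_onD[OF h_inj] by (simp add: he_def)
      then show "e = e'" using e well_labelled by (simp add: he_def)
    qed
    show "he ` edges (cmp i v) = (rcosets\<^bsub>?K\<^esub> S) \<times> letters ?X"
    proof
      show "he ` edges (cmp i v) \<subseteq> (rcosets\<^bsub>?K\<^esub> S) \<times> letters ?X"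
        using hR unfolding he_def by auto
      show "(rcosets\<^bsub>?K\<^esub> S) \<times> letters ?X \<subseteq> he ` edges (cmp i v)"
      proof
        fix x assume "x \<in> (rcosets\<^bsub>?K\<^esub> S) \<times> letters ?X"
        then obtain u l where ul: "u \<in> ?R" "l \<in> letters ?X" "x = (h u, l)"
          unfolding hR[symmetric] by blast
        have "colored i u" using colored_reach v ul(1) by blast
        then obtain e where "e \<in> edges \<Gamma>" "ini \<Gamma> e = u" "lab \<Gamma> e = l"
          using full ul(2) by metis
        then have "e \<in> edges (cmp i v)" "x = he e" using ul by (simp_all add: he_def)
        then show "x \<in> he ` edges (cmp i v)" by blast
      qed
    qed
  qed
  let ?C = "cayley (gens D i) (rels D i) S"
  have C: "verts ?C = rcosets\<^bsub>?K\<^esub> S" "edges ?C = (rcosets\<^bsub>?K\<^esub> S) \<times> letters ?X"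
    "ini ?C = fst" "lab ?C = snd"
    "erev ?C = (\<lambda>(V, l). (V #>\<^bsub>?K\<^esub> el [l], linv l))"
    by (simp_all add: cayley_def factor_def el_def)
  have "graph_iso h he (cmp i v) ?C"
    unfolding graph_iso_def graph_morphism_def
  proof (intro conjI ballI)
    show "h ` verts (cmp i v) \<subseteq> verts ?C" using h_bij by (simp add: C bij_betw_def)
    show "he ` edges (cmp i v) \<subseteq> edges ?C" using he_bij by (simp add: C bij_betw_def)
    show "bij_betw h (verts (cmp i v)) (verts ?C)" using h_bij by (simp add: C)
    show "bij_betw he (edges (cmp i v)) (edges ?C)" using he_bij by (simp only: C)
    fix e assume "e \<in> edges (cmp i v)"
    then have e: "e \<in> edges \<Gamma>" "ini \<Gamma> e \<in> ?R" "lab \<Gamma> e \<in> letters ?X" by auto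
    show "ini ?C (he e) = h (ini (cmp i v) e)" "lab ?C (he e) = lab (cmp i v) e"
      by (simp_all add: C he_def)
    show "ter ?C (he e) = h (ter (cmp i v) e)"
      using h_ter[OF e] by (simp add: ter_def[of ?C] C he_def)
    show "he (erev (cmp i v) e) = erev ?C (he e)"
      using h_ter[OF e] edgeD(5,6)[OF e(1)] by (simp add: C he_def)
  qed
  then show ?thesis unfolding is_cover_def isomorphic_def using S by blast
qed

lemma f_reach: "colored i v \<Longrightarrow> f ` reach (gens D i) \<Gamma> v = (\<lambda>g. f v \<cdot> g) ` FF i"
proof (intro Set.equalityI subsetI)
  fix c assume v: "colored i v" and "c \<in> f ` reach (gens D i) \<Gamma> v"
  then show "c \<in> (\<lambda>g. f v \<cdot> g) ` FF i" using reach_iff[OF v] by auto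
next
  fix c assume v: "colored i v" and "c \<in> (\<lambda>g. f v \<cdot> g) ` FF i"
  then obtain g where "g \<in> FF i" "c = f v \<cdot> g" by blast
  then show "c \<in> f ` reach (gens D i) \<Gamma> v" using act_vertex[OF v, of g] by (metis imageI)
qed

lemma finite_type_iff: "finite_type D \<Gamma> \<longleftrightarrow> finite_orbits colors"
proof -
  define comps where "comps i = {C. mono_component D \<Gamma> i C}" for i
  have img: "(\<lambda>C. f ` verts C) ` comps i = (\<lambda>c. (\<lambda>g. c \<cdot> g) ` FF i) ` colors i" for i
  proof -
    have "(\<lambda>C. f ` verts C) ` comps i = (\<lambda>v. f ` reach (gens D i) \<Gamma> v) ` {v. colored i v}"
    proof -
      have "comps i = cmp i ` {v. colored i v}" unfolding comps_def component_iff by blast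
      then show ?thesis by (simp only: image_image mono_part_simps)
    qed
    also have "\<dots> = (\<lambda>v. (\<lambda>g. f v \<cdot> g) ` FF i) ` {v. colored i v}"
      by (intro image_cong HOL.refl f_reach) simp
    finally show ?thesis unfolding colors_def image_image .
  qed
  have inj: "inj_on (\<lambda>C. f ` verts C) (comps i)" for i
  proof (rule inj_onI)
    fix C C' assume "C \<in> comps i" "C' \<in> comps i" and eq: "f ` verts C = f ` verts C'"
    then obtain u v where C: "C = cmp i u" "C' = cmp i v"
      unfolding comps_def component_iff by blast
    have "reach (gens D i) \<Gamma> u = reach (gens D i) \<Gamma> v"
      using eq inj_on_image_eq_iff[OF f_inj reach_verts[OF labelled] reach_verts[OF labelled]]
      unfolding C by simp
    then show "C = C'" unfolding C mono_part_def by simp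
  qed
  have "finite (comps i) \<longleftrightarrow> finite ((\<lambda>c. (\<lambda>g. c \<cdot> g) ` FF i) ` colors i)" for i
    unfolding img[symmetric] using finite_image_iff[OF inj] by blast
  moreover have "mono_components D \<Gamma> = comps F1 \<union> comps F2"
    unfolding mono_components_def comps_def side_ex by (rule Collect_disj_eq)
  ultimately have "finite_type D \<Gamma> \<longleftrightarrow>
      finite ((\<lambda>c. (\<lambda>g. c \<cdot> g) ` FF F1) ` colors F1) \<and> finite ((\<lambda>c. (\<lambda>g. c \<cdot> g) ` FF F2) ` colors F2)"
    unfolding finite_type_def by simp
  also have "\<dots> \<longleftrightarrow> finite_orbits colors"
    unfolding finite_orbits_def side_all ..
  finally show ?thesis .
qed

section \<open>Reducedness in terms of cosets\<close>

lemma cmp_eq: "u \<in> reach (gens D i) \<Gamma> v \<Longrightarrow> cmp i u = cmp i v"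
  by (rule comp_eq[OF labelled])

lemma reach_refl: "colored i v \<Longrightarrow> v \<in> reach (gens D i) \<Gamma> v"
  by (intro reach_self) simp

lemma VB_comp_iff:
  assumes "colored i \<theta>"
  shows "u \<in> VB D \<Gamma> (cmp i \<theta>) \<longleftrightarrow> u \<in> reach (gens D i) \<Gamma> \<theta> \<and> f u \<in> colors (other i)"
proof -
  have "u \<in> reach (gens D i) \<Gamma> \<theta> \<Longrightarrow> colored i u" using colored_reach assms by blast
  then show ?thesis unfolding VB_def using bichromatic_iff[of u i] colored_iff_colors[of u "other i"] by auto
qed

lemma VB_eq_A_orbit_iff:
  assumes "colored i \<theta>" "colored (other i) \<theta>"
  shows "VB D \<Gamma> (cmp i \<theta>) = A_orbit D i (cmp i \<theta>) \<theta> \<longleftrightarrow>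
    (\<forall>g\<in>FF i. f \<theta> \<cdot> g \<in> colors (other i) \<longrightarrow> f \<theta> \<cdot> g \<in> (\<lambda>a. f \<theta> \<cdot> a) ` amal_img D)"
    (is "?L \<longleftrightarrow> ?R")
proof
  assume L: ?L
  show ?R
  proof (intro ballI impI)
    fix g assume g: "g \<in> FF i" "f \<theta> \<cdot> g \<in> colors (other i)"
    obtain u where u: "u \<in> reach (gens D i) \<Gamma> \<theta>" "f u = f \<theta> \<cdot> g"
      using act_vertex[OF assms(1) g(1)] by metis
    then have "u \<in> A_orbit D i (cmp i \<theta>) \<theta>" using VB_comp_iff[OF assms(1)] g L by simp
    then have "f u \<in> (\<lambda>a. f \<theta> \<cdot> a) ` amal_img D" using A_orbit_comp[OF assms(1)] by simp
    then show "f \<theta> \<cdot> g \<in> (\<lambda>a. f \<theta> \<cdot> a) ` amal_img D" by (simp only: u(2))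
  qed
next
  assume R: ?R
  have "u \<in> VB D \<Gamma> (cmp i \<theta>) \<longleftrightarrow> u \<in> A_orbit D i (cmp i \<theta>) \<theta>" for u
  proof
    assume "u \<in> VB D \<Gamma> (cmp i \<theta>)"
    then have u: "u \<in> reach (gens D i) \<Gamma> \<theta>" "f u \<in> colors (other i)" using VB_comp_iff[OF assms(1)] by auto
    then obtain g where g: "g \<in> FF i" "f u = f \<theta> \<cdot> g" "u \<in> verts \<Gamma>" using reach_iff[OF assms(1)] by blast
    then have "f u \<in> (\<lambda>a. f \<theta> \<cdot> a) ` amal_img D" using bspec[OF R g(1)] u(2) by simp
    then show "u \<in> A_orbit D i (cmp i \<theta>) \<theta>" using A_orbit_comp[OF assms(1)] g(3) by simp
  next
    assume "u \<in> A_orbit D i (cmp i \<theta>) \<theta>"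
    then have "u \<in> verts \<Gamma>" "f u \<in> (\<lambda>a. f \<theta> \<cdot> a) ` amal_img D"
      using A_orbit_comp[OF assms(1)] by auto
    then obtain a where a: "a \<in> amal_img D" "f u = f \<theta> \<cdot> a" "u \<in> verts \<Gamma>" by blast
    have "f \<theta> \<in> colors (other i)" using colored_iff_colors assms(2) by simp
    then have "f u \<in> colors (other i)" unfolding a(2) using a(1) saturated_colors by (intro saturated_act) simp_all
    moreover have "u \<in> reach (gens D i) \<Gamma> \<theta>" using reach_iff[OF assms(1)] a A_F[OF a(1), of i] by blast
    ultimately show "u \<in> VB D \<Gamma> (cmp i \<theta>)" using VB_comp_iff[OF assms(1)] by simp
  qed
  then show ?L by (rule Set.set_eqI)
qed

lemma two_components:
  assumes "colored i \<theta>" "colored (other i) \<theta>"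
  shows "\<exists>C1\<in>mono_components D \<Gamma>. \<exists>C2\<in>mono_components D \<Gamma>. C1 \<noteq> C2"
proof -
  obtain e where e: "e \<in> edges \<Gamma>" "ini \<Gamma> e = \<theta>" "lab \<Gamma> e \<in> letters (gens D i)"
    using assms(1) unfolding has_edge_def by metis
  have "lab \<Gamma> e \<notin> letters (gens D (other i))" using letter_sides[OF e(3), of "other i"] by auto
  then have "e \<in> edges (cmp i \<theta>)" "e \<notin> edges (cmp (other i) \<theta>)"
    using e reach_refl[OF assms(1)] by simp_all
  then have "cmp i \<theta> \<noteq> cmp (other i) \<theta>" by metis
  moreover have "cmp i \<theta> \<in> mono_components D \<Gamma>" "cmp (other i) \<theta> \<in> mono_components D \<Gamma>"
    unfolding mono_components_def using component_iff assms by blast+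
  ultimately show ?thesis by blast
qed

text \<open>For a bichromatic vertex \<open>\<theta>\<close>, which lies in two components, this is the second case of
  \<open>redundant\<close>.\<close>

definition prunable :: "side \<Rightarrow> 'v \<Rightarrow> bool" where
  "prunable i \<theta> \<longleftrightarrow> Lab D (cmp i \<theta>) \<theta> \<subseteq> amal_img D \<and>
     VB D \<Gamma> (cmp i \<theta>) = A_orbit D i (cmp i \<theta>) \<theta> \<and>
     (v0 \<notin> verts (cmp i \<theta>) \<or> v0 \<in> VB D \<Gamma> (cmp i \<theta>) \<and> Lab D (cmp i \<theta>) \<theta> = {\<one>\<^bsub>GG\<^esub>})"

lemma prunable_iff:
  assumes "colored i \<theta>" "colored (other i) \<theta>"
  shows "prunable i \<theta> \<longleftrightarrow> {g \<in> FF i. f \<theta> \<cdot> g = f \<theta>} \<subseteq> amal_img D \<and>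
    (\<forall>g\<in>FF i. f \<theta> \<cdot> g \<in> colors (other i) \<longrightarrow> f \<theta> \<cdot> g \<in> (\<lambda>a. f \<theta> \<cdot> a) ` amal_img D) \<and>
    \<not> ((\<exists>g\<in>FF i. H = f \<theta> \<cdot> g) \<and> (H \<in> colors (other i) \<longrightarrow> {g \<in> FF i. f \<theta> \<cdot> g = f \<theta>} \<noteq> {\<one>\<^bsub>GG\<^esub>}))"
proof -
  have L: "Lab D (cmp i \<theta>) \<theta> = {g \<in> FF i. f \<theta> \<cdot> g = f \<theta>}"
    using Lab_comp[OF assms(1) reach_refl[OF assms(1)]] .
  have v: "v0 \<in> verts (cmp i \<theta>) \<longleftrightarrow> (\<exists>g\<in>FF i. H = f \<theta> \<cdot> g)"
    using reach_iff[OF assms(1), of v0] v0_vert f_v0 by simp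
  have b: "v0 \<in> VB D \<Gamma> (cmp i \<theta>) \<longleftrightarrow> v0 \<in> verts (cmp i \<theta>) \<and> H \<in> colors (other i)"
    using VB_comp_iff[OF assms(1), of v0] f_v0 by simp
  have logic: "P \<and> Q \<and> (\<not> V \<or> (V \<and> B) \<and> T) \<longleftrightarrow> P \<and> Q \<and> \<not> (V \<and> (B \<longrightarrow> \<not> T))" for P Q V B T
    by blast
  show ?thesis unfolding prunable_def VB_eq_A_orbit_iff[OF assms] L b v by (rule logic)
qed

lemma redundant_component_iff:
  "(\<exists>C. mono_component D \<Gamma> i C \<and> redundant D \<Gamma> v0 i C) \<longleftrightarrow>
    (colored i v0 \<and> \<Gamma> = cmp i v0 \<and> Lab D (cmp i v0) v0 = {\<one>\<^bsub>GG\<^esub>}) \<or>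
    (\<exists>\<theta>. colored i \<theta> \<and> colored (other i) \<theta> \<and> prunable i \<theta>)" (is "?L \<longleftrightarrow> ?R1 \<or> ?R2")
proof
  assume ?L
  then obtain v where v: "colored i v" "redundant D \<Gamma> v0 i (cmp i v)" unfolding component_iff by blast
  then consider (all) "\<Gamma> = cmp i v" "Lab D (cmp i v) v0 = {\<one>\<^bsub>GG\<^esub>}"
    | (prunable) \<theta> where "\<theta> \<in> VB D \<Gamma> (cmp i v)" "Lab D (cmp i v) \<theta> \<subseteq> amal_img D"
      "VB D \<Gamma> (cmp i v) = A_orbit D i (cmp i v) \<theta>"
      "v0 \<notin> verts (cmp i v) \<or> v0 \<in> VB D \<Gamma> (cmp i v) \<and> Lab D (cmp i v) \<theta> = {\<one>\<^bsub>GG\<^esub>}"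
    unfolding redundant_def by blast
  then show "?R1 \<or> ?R2"
  proof cases
    case all
    have "verts \<Gamma> = reach (gens D i) \<Gamma> v" using all(1) mono_part_simps(1) by metis
    then have "v0 \<in> reach (gens D i) \<Gamma> v" using v0_vert by simp
    then have "colored i v0" "cmp i v0 = cmp i v" using colored_reach[OF v(1)] cmp_eq by blast+
    then show ?thesis using all by metis
  next
    case prunable
    have "\<theta> \<in> reach (gens D i) \<Gamma> v" "f \<theta> \<in> colors (other i)" using VB_comp_iff[OF v(1)] prunable(1) by auto
    then have \<theta>: "colored i \<theta>" "cmp i \<theta> = cmp i v" using colored_reach[OF v(1)] cmp_eq by blast+
    then have "colored (other i) \<theta>" using \<open>f \<theta> \<in> colors (other i)\<close> colored_iff_colors by blast
    moreover have "prunable i \<theta>" unfolding prunable_def \<theta>(2) using prunable by blast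
    ultimately show ?thesis using \<theta>(1) by blast
  qed
next
  assume "?R1 \<or> ?R2"
  then show ?L
  proof
    assume ?R1
    then have "redundant D \<Gamma> v0 i (cmp i v0)" unfolding redundant_def by blast
    then show ?L using \<open>?R1\<close> component_iff by blast
  next
    assume ?R2
    then obtain \<theta> where \<theta>: "colored i \<theta>" "colored (other i) \<theta>" "prunable i \<theta>" by blast
    have "f \<theta> \<in> colors (other i)" using colored_iff_colors \<theta>(2) by simp
    then have "\<theta> \<in> VB D \<Gamma> (cmp i \<theta>)" using VB_comp_iff[OF \<theta>(1)] reach_refl[OF \<theta>(1)] by simp
    then have "redundant D \<Gamma> v0 i (cmp i \<theta>)"
      unfolding redundant_def using two_components[OF \<theta>(1,2)] \<theta>(3) unfolding prunable_def by blast
    then show ?L using \<theta>(1) component_iff by blast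
  qed
qed

lemma single_component_iff:
  assumes "connected_graph \<Gamma>"
  shows "colored i v0 \<and> \<Gamma> = cmp i v0 \<longleftrightarrow> H \<in> colors i \<and> colors (other i) = {}"
proof -
  have i: "H \<in> colors i \<longleftrightarrow> colored i v0" using colored_iff_colors[OF v0_vert] f_v0 by simp
  have "\<Gamma> = cmp i v0 \<longleftrightarrow> colors (other i) = {}" if c: "colored i v0"
  proof
    assume eq: "\<Gamma> = cmp i v0"
    have E: "edges \<Gamma> = {e \<in> edges \<Gamma>. ini \<Gamma> e \<in> reach (gens D i) \<Gamma> v0 \<and> lab \<Gamma> e \<in> letters (gens D i)}"
      using arg_cong[OF eq, of edges] by simp
    have "\<not> colored (other i) u" for u
    proof
      assume "colored (other i) u"
      then obtain e where e: "e \<in> edges \<Gamma>" "lab \<Gamma> e \<in> letters (gens D (other i))"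
        unfolding has_edge_def by metis
      have "lab \<Gamma> e \<in> letters (gens D i)" using e(1) E by blast
      from letter_sides[OF this e(2)] show False by simp
    qed
    then show "colors (other i) = {}" unfolding colors_def by blast
  next
    assume empty: "colors (other i) = {}"
    have lab_i: "lab \<Gamma> e \<in> letters (gens D i)" if e: "e \<in> edges \<Gamma>" for e
    proof -
      obtain j where j: "lab \<Gamma> e \<in> letters (gens D j)"
        using edgeD(3)[OF e] letters_all[of "lab \<Gamma> e"] by metis
      have "colored j (ini \<Gamma> e)" using e j edgeD(1)[OF e] unfolding has_edge_def by metis
      then have "colors j \<noteq> {}" unfolding colors_def by blast
      then have "j = i" using empty neq_iff_other[of j i] by metis
      then show ?thesis using j by simp
    qed
    have "u \<in> reach (gens D i) \<Gamma> v0" if u: "u \<in> verts \<Gamma>" for u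
    proof -
      obtain p where p: "path \<Gamma> v0 p u" using assms v0_vert u unfolding connected_graph_def by blast
      have "set p \<subseteq> edges \<Gamma>" if "path \<Gamma> w p u" for w p using that by (induction p arbitrary: w) auto
      then have "set p \<subseteq> edges \<Gamma>" using p by blast
      then have "plab \<Gamma> p \<in> words (gens D i)" using lab_i by (auto simp: in_lists_conv_set)
      then show ?thesis using p unfolding reach_def by blast
    qed
    then have R: "reach (gens D i) \<Gamma> v0 = verts \<Gamma>" using reach_verts[OF labelled] by blast
    have "verts \<Gamma> = verts (cmp i v0)" using R by simp
    moreover have "edges \<Gamma> = edges (cmp i v0)" using R lab_i edgeD(1) by auto
    ultimately show "\<Gamma> = cmp i v0" by (intro lgraph.equality) simp_all
  qed
  then show ?thesis using i by blast
qed

lemma stabilizer_H: "{g \<in> FF i. H \<cdot> g = H} = H \<inter> FF i"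
proof (rule Set.set_eqI)
  fix g
  show "g \<in> {g \<in> FF i. H \<cdot> g = H} \<longleftrightarrow> g \<in> H \<inter> FF i"
    by (cases "g \<in> FF i") (simp_all add: H_act_iff)
qed

lemma base_condition_iff:
  "(\<forall>C. mono_component D \<Gamma> i C \<and> v0 \<in> verts C \<and> Lab D C v0 \<inter> amal_img D \<noteq> {\<one>\<^bsub>GG\<^esub>} \<longrightarrow>
      (\<exists>E. mono_component D \<Gamma> (other i) E \<and> v0 \<in> verts E \<and>
        Lab D C v0 \<inter> amal_img D = Lab D E v0 \<inter> amal_img D)) \<longleftrightarrow>
   (H \<in> colors i \<longrightarrow> H \<inter> amal_img D \<noteq> {\<one>\<^bsub>GG\<^esub>} \<longrightarrow> H \<in> colors (other i))" (is "?L \<longleftrightarrow> ?R")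
proof -
  have i: "H \<in> colors j \<longleftrightarrow> colored j v0" for j using colored_iff_colors[OF v0_vert] f_v0 by simp
  have meet: "Lab D C v0 \<inter> amal_img D = H \<inter> amal_img D" if "mono_component D \<Gamma> j C" "v0 \<in> verts C" for j C
  proof -
    obtain v where v: "colored j v" "C = cmp j v" using \<open>mono_component D \<Gamma> j C\<close> component_iff by blast
    then have "v0 \<in> reach (gens D j) \<Gamma> v" using \<open>v0 \<in> verts C\<close> by simp
    then have "Lab D C v0 = {g \<in> FF j. H \<cdot> g = H}" using Lab_comp[OF v(1)] v(2) f_v0 by simp
    also have "\<dots> = H \<inter> FF j" by (rule stabilizer_H)
    finally show ?thesis using amal_img_FF by blast
  qed
  have comp_v0: "mono_component D \<Gamma> j C \<and> v0 \<in> verts C \<longleftrightarrow> colored j v0 \<and> C = cmp j v0" for j C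
  proof
    assume C: "mono_component D \<Gamma> j C \<and> v0 \<in> verts C"
    then obtain v where v: "colored j v" "C = cmp j v" using component_iff by blast
    then have "v0 \<in> reach (gens D j) \<Gamma> v" using C by simp
    then show "colored j v0 \<and> C = cmp j v0" using colored_reach[OF v(1)] cmp_eq v(2) by metis
  next
    assume c: "colored j v0 \<and> C = cmp j v0"
    then have "v0 \<in> verts C" using reach_refl[where i = j and v = v0] by simp
    then show "mono_component D \<Gamma> j C \<and> v0 \<in> verts C" using component_iff c by blast
  qed
  show ?thesis
  proof
    assume L: ?L
    show ?R
    proof (intro impI)
      assume "H \<in> colors i" and ne: "H \<inter> amal_img D \<noteq> {\<one>\<^bsub>GG\<^esub>}"
      then have "colored i v0" using i by simp
      then have C: "mono_component D \<Gamma> i (cmp i v0)" "v0 \<in> verts (cmp i v0)" using comp_v0 by blast+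
      then have "Lab D (cmp i v0) v0 \<inter> amal_img D \<noteq> {\<one>\<^bsub>GG\<^esub>}" using meet ne by metis
      then obtain E where "mono_component D \<Gamma> (other i) E" "v0 \<in> verts E" using L C by blast
      then have "colored (other i) v0" using comp_v0 by blast
      then show "H \<in> colors (other i)" using i by simp
    qed
  next
    assume R: ?R
    show ?L
    proof (intro allI impI)
      fix C assume C: "mono_component D \<Gamma> i C \<and> v0 \<in> verts C \<and> Lab D C v0 \<inter> amal_img D \<noteq> {\<one>\<^bsub>GG\<^esub>}"
      then have m: "Lab D C v0 \<inter> amal_img D = H \<inter> amal_img D" using meet by blast
      have "colored i v0" using comp_v0 C by blast
      then have "H \<in> colors i" using i by simp
      then have "H \<in> colors (other i)" using R C m by metis
      then have "colored (other i) v0" using i by simp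
      then have E: "mono_component D \<Gamma> (other i) (cmp (other i) v0)" "v0 \<in> verts (cmp (other i) v0)"
        using comp_v0 by blast+
      then show "\<exists>E. mono_component D \<Gamma> (other i) E \<and> v0 \<in> verts E \<and>
          Lab D C v0 \<inter> amal_img D = Lab D E v0 \<inter> amal_img D"
        using meet m by metis
    qed
  qed
qed

text \<open>Apart from connectedness, the requirements on a precover hold in every graph of cosets; the
  remaining ones are clause by clause those of \<open>reduced_system\<close>.\<close>

theorem reduced_precover_iff:
  "reduced_precover D \<Gamma> v0 \<longleftrightarrow> connected_graph \<Gamma> \<and> reduced_system colors"
proof (cases "connected_graph \<Gamma>")
  case True
  have pre: "precover D \<Gamma> v0"
    unfolding precover_def using labelled v0_vert True G_based component_is_cover component_iff by metis
  have i: "H \<in> colors j \<longleftrightarrow> colored j v0" for j using colored_iff_colors[OF v0_vert] f_v0 by simp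
  have a: "colored i v0 \<and> \<Gamma> = cmp i v0 \<and> Lab D (cmp i v0) v0 = {\<one>\<^bsub>GG\<^esub>} \<longleftrightarrow>
      H \<in> colors i \<and> colors (other i) = {} \<and> H \<inter> FF i = {\<one>\<^bsub>GG\<^esub>}" for i
  proof (cases "colored i v0")
    case c: True
    have "Lab D (cmp i v0) v0 = H \<inter> FF i"
      using Lab_comp[OF c reach_refl[OF c]] stabilizer_H f_v0 by simp
    then show ?thesis using single_component_iff[OF True, of i] c by metis
  next
    case False
    moreover from this have "H \<notin> colors i" using i by simp
    ultimately show ?thesis by metis
  qed
  have "(\<forall>i C. mono_component D \<Gamma> i C \<longrightarrow> \<not> redundant D \<Gamma> v0 i C) \<longleftrightarrow>
     (\<forall>i. \<not> (\<exists>C. mono_component D \<Gamma> i C \<and> redundant D \<Gamma> v0 i C))" by blast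
  also have "\<dots> \<longleftrightarrow> (\<forall>i. \<not> (H \<in> colors i \<and> colors (other i) = {} \<and> H \<inter> FF i = {\<one>\<^bsub>GG\<^esub>})) \<and>
     (\<forall>i. \<forall>\<theta>. colored i \<theta> \<and> colored (other i) \<theta> \<longrightarrow> \<not> prunable i \<theta>)"
    unfolding redundant_component_iff a by blast
  also have "(\<forall>i. \<forall>\<theta>. colored i \<theta> \<and> colored (other i) \<theta> \<longrightarrow> \<not> prunable i \<theta>) \<longleftrightarrow>
    (\<forall>i. \<forall>v \<in> colors i \<inter> colors (other i).
        {g \<in> FF i. v \<cdot> g = v} \<subseteq> amal_img D \<longrightarrow>
        (\<forall>g\<in>FF i. v \<cdot> g \<in> colors (other i) \<longrightarrow> v \<cdot> g \<in> (\<cdot>) v ` amal_img D) \<longrightarrow>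
        (\<exists>g\<in>FF i. H = v \<cdot> g) \<and> (H \<in> colors (other i) \<longrightarrow> {g \<in> FF i. v \<cdot> g = v} \<noteq> {\<one>\<^bsub>GG\<^esub>}))"
    (is "(\<forall>i. \<forall>\<theta>. ?c i \<theta> \<longrightarrow> _) \<longleftrightarrow> (\<forall>i. \<forall>v\<in>_. ?Q i v)")
  proof -
    have logic: "\<not> (P \<and> Q \<and> \<not> R) \<longleftrightarrow> (P \<longrightarrow> Q \<longrightarrow> R)" for P Q R by blast
    have q: "\<not> prunable i \<theta> \<longleftrightarrow> ?Q i (f \<theta>)" if c: "?c i \<theta>" for i \<theta>
      unfolding prunable_iff[OF conjunct1[OF c] conjunct2[OF c]] by (rule logic)
    have s: "(\<forall>v \<in> colors i \<inter> colors (other i). P v) \<longleftrightarrow> (\<forall>\<theta>. ?c i \<theta> \<longrightarrow> P (f \<theta>))" for i and P :: "'x word set set \<Rightarrow> bool"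
    proof
      assume all: "\<forall>v \<in> colors i \<inter> colors (other i). P v"
      show "\<forall>\<theta>. ?c i \<theta> \<longrightarrow> P (f \<theta>)"
      proof (intro allI impI)
        fix \<theta> assume "?c i \<theta>"
        then have "f \<theta> \<in> colors i \<inter> colors (other i)" using colored_iff_colors by simp
        then show "P (f \<theta>)" using all by blast
      qed
    next
      assume all: "\<forall>\<theta>. ?c i \<theta> \<longrightarrow> P (f \<theta>)"
      show "\<forall>v \<in> colors i \<inter> colors (other i). P v"
      proof
        fix v assume v: "v \<in> colors i \<inter> colors (other i)"
        then obtain \<theta> where \<theta>: "colored i \<theta>" "v = f \<theta>" unfolding colors_def[of i] by blast
        then have "?c i \<theta>" using v colored_iff_colors[of \<theta> "other i"] by simp
        then show "P v" using all \<theta>(2) by simp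
      qed
    qed
    show ?thesis unfolding s by (intro all_cong1 imp_cong HOL.refl q)
  qed
  also note 1 = calculation
  have 2: "(\<forall>i. \<not> (H \<in> colors i \<and> colors (other i) = {} \<and> H \<inter> FF i = {\<one>\<^bsub>GG\<^esub>})) \<longleftrightarrow>
     (\<forall>i. H \<in> colors i \<longrightarrow> colors (other i) = {} \<longrightarrow> H \<inter> FF i \<noteq> {\<one>\<^bsub>GG\<^esub>})" by blast
  have 3: "(\<forall>i C. mono_component D \<Gamma> i C \<and> v0 \<in> verts C \<and> Lab D C v0 \<inter> amal_img D \<noteq> {\<one>\<^bsub>GG\<^esub>} \<longrightarrow>
      (\<exists>E. mono_component D \<Gamma> (other i) E \<and> v0 \<in> verts E \<and>
        Lab D C v0 \<inter> amal_img D = Lab D E v0 \<inter> amal_img D)) \<longleftrightarrow>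
   (\<forall>i. H \<in> colors i \<longrightarrow> H \<inter> amal_img D \<noteq> {\<one>\<^bsub>GG\<^esub>} \<longrightarrow> H \<in> colors (other i))"
    unfolding base_condition_iff ..
  show ?thesis
    unfolding reduced_precover_def reduced_system_def 1 2 3
    by (simp only: pre True simp_thms conj_assoc)
next
  case False
  then show ?thesis by (auto simp: reduced_precover_def precover_def)
qed

end


section \<open>The normal core\<close>

context amalgam_cosets begin

abbreviation CG where "CG \<equiv> cayley_amalg D H"

lemma cayley_simps [simp]:
  "verts CG = rcosets\<^bsub>GG\<^esub> H" "edges CG = (rcosets\<^bsub>GG\<^esub> H) \<times> letters (all_gens D)"
  "ini CG = fst" "lab CG = snd"
  "erev CG = (\<lambda>(v, l). (v \<cdot> gelt D [l], linv l))"
  "ter CG = (\<lambda>(v, l). v \<cdot> gelt D [l])"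
  by (auto simp: cayley_amalg_def cayley_def amalg_gp_def gelt_def ter_def fun_eq_iff)

lemma basepoint_eq: "basepoint D H = H"
  by (simp add: basepoint_def)

lemma rcosets_H: "H \<in> rcosets\<^bsub>GG\<^esub> H"
  using GG.rcosetsI[OF H_carrier GG.one_closed] by simp

lemma rcosets_carrier: "v \<in> rcosets\<^bsub>GG\<^esub> H \<Longrightarrow> v \<subseteq> carrier GG"
  unfolding RCOSETS_def using coset_closed[OF H_carrier] by blast

lemma rcosets_act:
  assumes "v \<in> rcosets\<^bsub>GG\<^esub> H" "g \<in> carrier GG"
  shows "v \<cdot> g \<in> rcosets\<^bsub>GG\<^esub> H"
proof -
  obtain x where "x \<in> carrier GG" "v = H \<cdot> x" using assms(1) unfolding RCOSETS_def by blast
  then show ?thesis using assms(2) GG.rcosetsI[OF H_carrier] by (simp add: GG.coset_mult_assoc)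
qed

text \<open>A path in the Cayley graph is determined by its initial vertex and its label.\<close>

primrec cpath :: "'x word set set \<Rightarrow> 'x word \<Rightarrow> ('x word set set \<times> 'x letter) list" where
  "cpath v [] = []"
| "cpath v (l # w) = (v, l) # cpath (v \<cdot> gelt D [l]) w"

lemma map_snd_cpath [simp]: "map snd (cpath v w) = w"
  by (induction w arbitrary: v) simp_all

lemma act_Cons:
  assumes "v \<subseteq> carrier GG" "l \<in> letters (all_gens D)" "w \<in> words (all_gens D)"
  shows "v \<cdot> gelt D [l] \<cdot> gelt D w = v \<cdot> gelt D (l # w)"
  using assms gelt_Cons[OF assms(2,3)] by (simp add: GG.coset_mult_assoc)

lemma act_append:
  assumes "v \<subseteq> carrier GG" "u \<in> words (all_gens D)" "w \<in> words (all_gens D)"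
  shows "v \<cdot> gelt D u \<cdot> gelt D w = v \<cdot> gelt D (u @ w)"
  using assms gelt_append[OF assms(2,3)] by (simp add: GG.coset_mult_assoc)

lemma cpath_append:
  "v \<subseteq> carrier GG \<Longrightarrow> u \<in> words (all_gens D) \<Longrightarrow>
    cpath v (u @ w) = cpath v u @ cpath (v \<cdot> gelt D u) w"
proof (induction u arbitrary: v)
  case (Cons l u)
  then have "l \<in> letters (all_gens D)" "u \<in> words (all_gens D)" "gelt D [l] \<in> carrier GG" by auto
  then show ?case using Cons act_Cons[of v l u] by simp
qed (simp add: gelt_Nil)

lemma path_cayley_iff:
  assumes "u \<in> rcosets\<^bsub>GG\<^esub> H"
  shows "path CG u p v \<longleftrightarrow> map snd p \<in> words (all_gens D) \<and> p = cpath u (map snd p) \<and>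
    v = u \<cdot> gelt D (map snd p)"
  using assms
proof (induction p arbitrary: u)
  case Nil
  then show ?case using rcosets_carrier[of u] by (auto simp: gelt_Nil)
next
  case (Cons e p)
  obtain x l where e: "e = (x, l)" by (cases e)
  show ?case
  proof (cases "x = u \<and> l \<in> letters (all_gens D)")
    case True
    then have "gelt D [l] \<in> carrier GG" by simp
    then have IH: "path CG (u \<cdot> gelt D [l]) p v \<longleftrightarrow> map snd p \<in> words (all_gens D) \<and>
        p = cpath (u \<cdot> gelt D [l]) (map snd p) \<and> v = u \<cdot> gelt D [l] \<cdot> gelt D (map snd p)"
      using Cons.IH rcosets_act[OF Cons.prems] by blast
    have "path CG u (e # p) v \<longleftrightarrow> path CG (u \<cdot> gelt D [l]) p v"
      using True e Cons.prems by simp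
    also have "\<dots> \<longleftrightarrow> map snd (e # p) \<in> words (all_gens D) \<and> e # p = cpath u (map snd (e # p)) \<and>
        v = u \<cdot> gelt D (map snd (e # p))"
      unfolding IH using True e act_Cons[OF rcosets_carrier[OF Cons.prems], of l "map snd p"] by auto
    finally show ?thesis .
  next
    case False
    then show ?thesis using e by auto
  qed
qed

text \<open>Nonempty words determine their sides, so that the conditions on sides in \<open>normal_form\<close> and
  \<open>mono_decomp\<close> become conditions on the recorded sides.\<close>

definition syllable_words :: "(side \<times> 'x word) list \<Rightarrow> bool" where
  "syllable_words ss \<longleftrightarrow> (\<forall>s\<in>set ss. snd s \<in> words (gens D (fst s)) \<and> snd s \<noteq> [])"

lemma syllable_wordsD: "syllable_words ss \<Longrightarrow> s \<in> set ss \<Longrightarrow> snd s \<in> words (gens D (fst s))"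
  by (simp add: syllable_words_def)

lemma same_side_iff:
  assumes "syllable_words ss" "s \<in> set ss" "t \<in> set ss"
  shows "(\<exists>i. snd s \<in> words (gens D i) \<and> snd t \<in> words (gens D i)) \<longleftrightarrow> fst s = fst t"
  using assms word_sides unfolding syllable_words_def by metis

lemma normal_form_iff:
  assumes "syllable_words ss"
  shows "normal_form D (map snd ss) \<longleftrightarrow> normal_seq (spelled ss)"
proof -
  have succ: "successively (\<lambda>g g'. \<not> (\<exists>i. g \<in> words (gens D i) \<and> g' \<in> words (gens D i))) (map snd ss)
      \<longleftrightarrow> successively (\<lambda>s t. fst s \<noteq> fst t) (spelled ss)"
    unfolding spelled_def successively_map fst_conv
    by (rule successively_cong) (use same_side_iff[OF assms] in simp_all)
  have words: "\<exists>i. snd s \<in> words (gens D i)" if "s \<in> set ss" for s using syllable_wordsD[OF assms that] by blast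
  have syl: "gelt D (snd s) \<in> FF (fst s)" if "s \<in> set ss" for s
    using syllable_wordsD[OF assms that] by (simp add: FF_def)
  have alternating: "alternating (spelled ss) \<longleftrightarrow> (\<forall>s\<in>set ss. gelt D (snd s) \<notin> amal_img D) \<and>
      successively (\<lambda>s t. fst s \<noteq> fst t) (spelled ss)"
    unfolding alternating_def spelled_def using syl by auto
  show ?thesis
  proof (cases "length ss = 1")
    case True
    then obtain s where s: "ss = [s]" by (metis length_0_conv length_Suc_conv One_nat_def)
    have "normal_seq (spelled ss) \<longleftrightarrow> gelt D (snd s) \<noteq> \<one>\<^bsub>GG\<^esub>"
      using syl[of s] A_one unfolding normal_seq_def alternating by (auto simp: spelled_def s)
    then show ?thesis unfolding normal_form_def s using words[of s] s by simp
  next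
    case False
    have "normal_seq (spelled ss) \<longleftrightarrow> alternating (spelled ss)"
      unfolding normal_seq_def using False by (auto simp: spelled_def length_Suc_conv)
    moreover have "gelt D (snd s) \<noteq> \<one>\<^bsub>GG\<^esub>" if "gelt D (snd s) \<notin> amal_img D" for s using that A_one by metis
    ultimately show ?thesis unfolding normal_form_def succ alternating using False words by auto
  qed
qed

lemma cpath_split:
  assumes "u \<subseteq> carrier GG" "syllable_words ss"
  shows "\<exists>ps. concat ps = cpath u (concat (map snd ss)) \<and> map (map snd) ps = map snd ss"
  using assms
proof (induction ss arbitrary: u)
  case (Cons s ss)
  have w: "snd s \<in> words (all_gens D)" using syllable_wordsD[OF Cons.prems(2), of s] words_all by simp
  have "syllable_words ss" using Cons.prems(2) by (simp add: syllable_words_def)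
  then obtain ps where "concat ps = cpath (u \<cdot> gelt D (snd s)) (concat (map snd ss))"
      "map (map snd) ps = map snd ss"
    using Cons.IH[of "u \<cdot> gelt D (snd s)"] Cons.prems(1) w by auto
  then show ?case using cpath_append[OF Cons.prems(1) w]
    by (intro exI[of _ "cpath u (snd s) # ps"]) simp
qed simp

text \<open>From a normal path, recording the side of each monochromatic piece gives the sequence; conversely
  the pieces of the path along a normal sequence of words are the required decomposition.\<close>

lemma normal_closed_path_iff:
  "normal_path D CG H p H \<longleftrightarrow>
    (\<exists>ss. syllable_words ss \<and> normal_seq (spelled ss) \<and> eval (spelled ss) \<in> H \<and> p = cpath H (concat (map snd ss)))"
proof
  assume "normal_path D CG H p H"
  then obtain ps where p: "path CG H p H" and ps: "concat ps = p"
      "\<And>q. q \<in> set ps \<Longrightarrow> q \<noteq> [] \<and> (\<exists>i. map snd q \<in> words (gens D i))"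
      "normal_form D (map (map snd) ps)"
    unfolding normal_path_def mono_decomp_def by auto
  have pw: "map snd p \<in> words (all_gens D)" "p = cpath H (map snd p)" "H = H \<cdot> gelt D (map snd p)"
    using p path_cayley_iff[OF rcosets_H] by auto
  define ss where "ss = map (\<lambda>q. (SOME i. map snd q \<in> words (gens D i), map snd q)) ps"
  have syllable_words: "syllable_words ss"
    unfolding syllable_words_def
  proof
    fix s assume "s \<in> set ss"
    then obtain q where q: "q \<in> set ps" "s = (SOME i. map snd q \<in> words (gens D i), map snd q)"
      unfolding ss_def by auto
    show "snd s \<in> words (gens D (fst s)) \<and> snd s \<noteq> []"
      using someI_ex[of "\<lambda>i. map snd q \<in> words (gens D i)"] ps(2)[OF q(1)] q(2) by simp
  qed
  have m: "map snd ss = map (map snd) ps" by (simp add: ss_def)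
  then have c: "concat (map snd ss) = map snd p" unfolding ps(1)[symmetric] by (simp add: map_concat)
  have "normal_seq (spelled ss)" using normal_form_iff[OF syllable_words] ps(3) m by simp
  moreover have "eval (spelled ss) = gelt D (map snd p)"
    using eval_spelled(2)[of ss] syllable_wordsD[OF syllable_words] c by simp
  moreover have "gelt D (map snd p) \<in> H" using pw H_act_iff by (metis gelt_closed)
  ultimately show "\<exists>ss. syllable_words ss \<and> normal_seq (spelled ss) \<and> eval (spelled ss) \<in> H \<and> p = cpath H (concat (map snd ss))"
    using syllable_words pw(2) c by metis
next
  assume "\<exists>ss. syllable_words ss \<and> normal_seq (spelled ss) \<and> eval (spelled ss) \<in> H \<and> p = cpath H (concat (map snd ss))"
  then obtain ss where ss: "syllable_words ss" "normal_seq (spelled ss)" "eval (spelled ss) \<in> H"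
      "p = cpath H (concat (map snd ss))" by blast
  obtain ps where ps: "concat ps = p" "map (map snd) ps = map snd ss"
    using cpath_split[OF H_carrier ss(1)] ss(4) by blast
  have w: "map snd p \<in> words (all_gens D)" "eval (spelled ss) = gelt D (map snd p)"
    using eval_spelled[of ss] syllable_wordsD[OF ss(1)] ss(4) by simp_all
  then have "H \<cdot> gelt D (map snd p) = H" using ss(3) H_act_iff by simp
  then have path: "path CG H p H" using path_cayley_iff[OF rcosets_H] w ss(4) by simp
  have nform: "normal_form D (map (map snd) ps)" using normal_form_iff[OF ss(1)] ss(2) ps(2) by simp
  have "q \<noteq> [] \<and> (\<exists>i. map snd q \<in> words (gens D i))" if "q \<in> set ps" for q
  proof -
    have "map snd q \<in> set (map snd ss)" using that unfolding ps(2)[symmetric] by simp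
    then obtain s where "s \<in> set ss" "map snd q = snd s" by auto
    then show ?thesis using ss(1) unfolding syllable_words_def by auto
  qed
  moreover have "successively (\<lambda>q q'. \<not> (\<exists>i. map snd q \<in> words (gens D i) \<and> map snd q' \<in> words (gens D i))) ps"
    using nform unfolding normal_form_def successively_map by simp
  ultimately have "mono_decomp D CG p ps" using ps(1) unfolding mono_decomp_def by simp
  then show "normal_path D CG H p H"
    using path nform unfolding normal_path_def by auto
qed

lemma cpath_factor_edges:
  assumes "saturated E" "u \<in> E i" "w \<in> words (gens D i)" "(v, l) \<in> set (cpath u w)"
  shows "v \<in> E i \<and> l \<in> letters (gens D i)"
  using assms(2-)
proof (induction w arbitrary: u)
  case (Cons k w)
  then have k: "k \<in> letters (gens D i)" "w \<in> words (gens D i)" by auto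
  have "u \<cdot> gelt D [k] \<in> E i" using saturated_act[OF assms(1) Cons.prems(1) letter_FF[OF k(1)]] .
  then show ?case using Cons k by auto
qed simp

lemma cpath_walk_edges:
  assumes "saturated E" "u \<subseteq> carrier GG" "syllable_words ss" "walk E u (spelled ss)"
    "(v, l) \<in> set (cpath u (concat (map snd ss)))"
  shows "\<exists>i. v \<in> E i \<and> l \<in> letters (gens D i)"
  using assms(2-)
proof (induction ss arbitrary: u)
  case (Cons s ss)
  have w: "snd s \<in> words (gens D (fst s))" using syllable_wordsD[OF Cons.prems(2), of s] by simp
  have syllable_words: "syllable_words ss" using Cons.prems(2) by (simp add: syllable_words_def)
  have walk: "u \<in> E (fst s)" "walk E (u \<cdot> gelt D (snd s)) (spelled ss)"
    using Cons.prems(3) by (auto simp: spelled_def)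
  have "(v, l) \<in> set (cpath u (snd s)) \<union> set (cpath (u \<cdot> gelt D (snd s)) (concat (map snd ss)))"
    using Cons.prems(4) cpath_append[OF Cons.prems(1) words_all[OF w]] by simp
  then show ?case
  proof
    assume "(v, l) \<in> set (cpath u (snd s))"
    then show ?thesis using cpath_factor_edges[OF assms(1) walk(1) w] by blast
  next
    assume "(v, l) \<in> set (cpath (u \<cdot> gelt D (snd s)) (concat (map snd ss)))"
    then show ?thesis
      using Cons.IH[OF _ syllable_words walk(2)] Cons.prems(1) words_all[OF w] by simp
  qed
qed simp

lemma normal_path_edge_core:
  assumes "normal_path D CG H p H" "(v, l) \<in> set p"
  shows "\<exists>i. v \<in> core i \<and> l \<in> letters (gens D i)"
proof -
  obtain ss where ss: "syllable_words ss" "normal_seq (spelled ss)" "eval (spelled ss) \<in> H" "p = cpath H (concat (map snd ss))"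
    using assms(1) normal_closed_path_iff by blast
  have "walk core H (spelled ss)" using normal_seq_core_walk[OF ss(2,3), of "[]"] by simp
  then show ?thesis using cpath_walk_edges[OF saturated_core H_carrier ss(1)] assms(2) ss(4) by blast
qed

lemma normal_seq_nontrivial:
  assumes "normal_seq p" "s \<in> set p"
  shows "snd s \<noteq> \<one>\<^bsub>GG\<^esub>"
proof (cases "alternating p")
  case True
  then have "snd s \<notin> amal_img D" using assms(2) unfolding alternating_def by blast
  then show ?thesis using A_one by metis
next
  case False
  then obtain i g where g: "p = [(i, g)]" "g \<noteq> \<one>\<^bsub>GG\<^esub>"
    using assms(1) unfolding normal_seq_def by metis
  then have "s = (i, g)" using assms(2) by simp
  then show ?thesis using g(2) by simp
qed

lemma spelled_append: "spelled (ss @ ts) = spelled ss @ spelled ts"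
  by (simp add: spelled_def)

text \<open>The orbit of \<open>v\<close> contains a syllable \<open>g\<close> of a closed normal sequence, starting at \<open>u\<close> say, and
  \<open>v = ub\<close>. Spelling \<open>g\<close> by the word \<open>b l l\<^sup>-\<^sup>1 b\<^sup>-\<^sup>1 g\<close> leads the path through the edge \<open>l\<close> at \<open>v\<close>
  and back. The reverse edge is recorded since its terminal vertex is \<open>v\<close>, and \<open>path_verts\<close> collects
  terminal vertices.\<close>

lemma core_edge_normal_path:
  assumes v: "v \<in> core i" and l: "l \<in> letters (gens D i)"
  shows "\<exists>p. normal_path D CG H p H \<and> (v, l) \<in> set p \<and> (v \<cdot> gelt D [l], linv l) \<in> set p"
proof -
  obtain p g q b where r: "normal_seq (p @ (i, g) # q)" "eval (p @ (i, g) # q) \<in> H" and b: "b \<in> FF i"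
    and vb: "v = H \<cdot> eval p \<cdot> b"
    using v unfolding core_def by blast
  have S: "set p \<subseteq> syllables" "set q \<subseteq> syllables" "g \<in> FF i" using normal_seq_syllables[OF r(1)] by auto
  obtain sp where sp: "spelled sp = p" "\<And>s. s \<in> set sp \<Longrightarrow> snd s \<in> words (gens D (fst s))"
    using spell[OF S(1)] by blast
  obtain sq where sq: "spelled sq = q" "\<And>s. s \<in> set sq \<Longrightarrow> snd s \<in> words (gens D (fst s))"
    using spell[OF S(2)] by blast
  obtain wg where wg: "wg \<in> words (gens D i)" "g = gelt D wg" using S(3) by (auto simp: FF_def)
  obtain wb where wb: "wb \<in> words (gens D i)" "b = gelt D wb" using b by (auto simp: FF_def)
  define w where "w = wb @ [l, linv l] @ winv wb @ wg"
  have w: "w \<in> words (gens D i)" "w \<noteq> []" using wb wg l by (auto simp: w_def)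
  have L: "[l] \<in> words (all_gens D)" "[linv l] \<in> words (all_gens D)" "wb \<in> words (all_gens D)"
      "wg \<in> words (all_gens D)"
    using l words_all[of "[l]" i] words_all[of "[linv l]" i] wb wg words_all by simp_all
  have gl: "gelt D [linv l] = inv\<^bsub>GG\<^esub> gelt D [l]"
    using gelt_winv[OF L(1)] by (simp add: winv_Cons)
  have "gelt D w = gelt D (wb @ [l] @ [linv l] @ winv wb @ wg)" by (simp add: w_def)
  also have "\<dots> = gelt D wb \<odot> (gelt D [l] \<odot> (inv\<^bsub>GG\<^esub> gelt D [l] \<odot>
      (inv\<^bsub>GG\<^esub> gelt D wb \<odot> gelt D wg)))"
    unfolding gl[symmetric] gelt_winv[OF L(3), symmetric] using L
    by (subst gelt_append, simp, simp)+ (rule HOL.refl)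
  also have "\<dots> = g" using L by (simp add: wg GG.m_assoc[symmetric])
  finally have gw: "gelt D w = g" .
  define ss where "ss = sp @ (i, w) # sq"
  have sps: "spelled ss = p @ (i, g) # q" 
    using spelled_append[of sp "(i, w) # sq"] sp(1) sq(1) gw by (simp add: ss_def spelled_def)
  have words: "snd s \<in> words (gens D (fst s))" if "s \<in> set ss" for s
    using that sp(2) sq(2) w by (auto simp: ss_def)
  have "snd s \<noteq> []" if "s \<in> set ss" for s
  proof
    assume "snd s = []"
    have "(fst s, gelt D (snd s)) \<in> set (spelled ss)" using that by (auto simp: spelled_def)
    then have "gelt D (snd s) \<noteq> \<one>\<^bsub>GG\<^esub>" 
      using normal_seq_nontrivial[OF r(1), of "(fst s, gelt D (snd s))"] unfolding sps by simp
    then show False using \<open>snd s = []\<close> by (simp add: gelt_Nil)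
  qed
  then have syllable_words: "syllable_words ss" using words by (simp add: syllable_words_def)
  define P where "P = cpath H (concat (map snd ss))"
  have normal: "normal_path D CG H P H"
    using normal_closed_path_iff syllable_words r sps unfolding P_def by metis
  have wsp: "concat (map snd sp) \<in> words (all_gens D)" "gelt D (concat (map snd sp)) = eval p"
    using eval_spelled[of sp] sp by simp_all
  have pc: "eval p \<in> carrier GG" using S by simp
  define x y where "x = concat (map snd sp) @ wb" and "y = [l, linv l] @ winv wb @ wg @ concat (map snd sq)"
  have xy: "concat (map snd ss) = x @ y"
    by (simp add: ss_def w_def x_def y_def)
  have "x \<in> words (all_gens D)" using wsp L by (simp add: x_def)
  moreover have "H \<cdot> gelt D x = v"
    using act_append[OF H_carrier wsp(1) L(3)] wsp(2) wb vb by (simp add: x_def)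
  ultimately have "P = cpath H x @ cpath v y"
    unfolding P_def xy using cpath_append[OF H_carrier, of x y] by simp
  moreover have "(v, l) \<in> set (cpath v y)" "(v \<cdot> gelt D [l], linv l) \<in> set (cpath v y)"
    by (simp_all add: y_def)
  ultimately show ?thesis using normal by (intro exI[of _ P]) simp
qed

text \<open>A syllable of a normal sequence is nontrivial, so a factor without generators has none.\<close>

lemma core_gens:
  assumes "v \<in> core i"
  obtains l where "l \<in> letters (gens D i)"
proof -
  obtain p g q where r: "normal_seq (p @ (i, g) # q)" using assms unfolding core_def by blast
  have g: "g \<in> FF i" "g \<noteq> \<one>\<^bsub>GG\<^esub>"
    using normal_seq_syllables[OF r] normal_seq_nontrivial[OF r, of "(i, g)"] by simp_all
  obtain w where w: "w \<in> words (gens D i)" "g = gelt D w" using g(1) unfolding FF_def by blast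
  then have "w \<noteq> []" using g(2) gelt_Nil by metis
  with w(1) have "w \<in> words (gens D i)" "w \<noteq> []" by simp_all
  then show thesis using that by (cases w) auto
qed

abbreviation NC where "NC \<equiv> normal_core D H"

lemma core_step: "v \<in> core i \<Longrightarrow> l \<in> letters (gens D i) \<Longrightarrow> v \<cdot> gelt D [l] \<in> core i"
  using saturated_act[OF saturated_core] letter_FF by blast

lemma core_subset: "v \<in> core i \<Longrightarrow> v \<subseteq> carrier GG"
  using saturated_core unfolding saturated_def by blast

lemma act_letter_inv:
  assumes "v \<subseteq> carrier GG" "l \<in> letters (all_gens D)"
  shows "v \<cdot> gelt D [l] \<cdot> gelt D [linv l] = v"
proof -
  have "gelt D [linv l] = inv\<^bsub>GG\<^esub> gelt D [l]" "gelt D [l] \<in> carrier GG"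
    using gelt_winv[of "[l]"] assms(2) by (simp_all add: winv_Cons)
  then show ?thesis using assms(1) by (simp add: GG.coset_mult_assoc)
qed

lemma normal_core_edges: "edges NC = {(v, l). \<exists>i. v \<in> core i \<and> l \<in> letters (gens D i)}"
proof (rule Set.set_eqI)
  fix e :: "'x word set set \<times> 'x letter"
  obtain v l where e: "e = (v, l)" by (cases e)
  have "e \<in> edges NC \<longleftrightarrow> (\<exists>p. normal_path D CG H p H \<and> (e \<in> set p \<or> e \<in> erev CG ` set p))"
    by (simp add: normal_core_def basepoint_eq)
  also have "\<dots> \<longleftrightarrow> (\<exists>i. v \<in> core i \<and> l \<in> letters (gens D i))"
  proof
    assume "\<exists>p. normal_path D CG H p H \<and> (e \<in> set p \<or> e \<in> erev CG ` set p)"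
    then obtain p where p: "normal_path D CG H p H" "e \<in> set p \<or> e \<in> erev CG ` set p" by blast
    show "\<exists>i. v \<in> core i \<and> l \<in> letters (gens D i)"
    proof (cases "e \<in> set p")
      case True
      then show ?thesis using normal_path_edge_core[OF p(1)] e by blast
    next
      case False
      then obtain u k where u: "(u, k) \<in> set p" "v = u \<cdot> gelt D [k]" "l = linv k"
        using p(2) e by auto
      then obtain i where "u \<in> core i" "k \<in> letters (gens D i)"
        using normal_path_edge_core[OF p(1)] by blast
      then show ?thesis unfolding u(2,3) using core_step linv_letters by blast
    qed
  next
    assume "\<exists>i. v \<in> core i \<and> l \<in> letters (gens D i)"
    then show "\<exists>p. normal_path D CG H p H \<and> (e \<in> set p \<or> e \<in> erev CG ` set p)"
      using core_edge_normal_path e by blast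
  qed
  finally show "e \<in> edges NC \<longleftrightarrow> e \<in> {(v, l). \<exists>i. v \<in> core i \<and> l \<in> letters (gens D i)}"
    using e by simp
qed

lemma normal_core_verts: "verts NC = insert H (core F1 \<union> core F2)"
proof (rule Set.set_eqI)
  fix v
  have "v \<in> verts NC \<longleftrightarrow> (\<exists>p. normal_path D CG H p H \<and> (v = H \<or> (\<exists>(u, l)\<in>set p. v = u \<cdot> gelt D [l])))"
    by (auto simp: normal_core_def essential_def basepoint_eq path_verts_def)
  also have "\<dots> \<longleftrightarrow> v = H \<or> (\<exists>i. v \<in> core i)"
  proof
    assume "\<exists>p. normal_path D CG H p H \<and> (v = H \<or> (\<exists>(u, l)\<in>set p. v = u \<cdot> gelt D [l]))"
    then consider "v = H" | p u l where "normal_path D CG H p H" "(u, l) \<in> set p" "v = u \<cdot> gelt D [l]"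
      by auto
    then show "v = H \<or> (\<exists>i. v \<in> core i)"
    proof cases
      case 2
      then obtain i where "u \<in> core i" "l \<in> letters (gens D i)"
        using normal_path_edge_core by blast
      then show ?thesis unfolding 2(3) using core_step by blast
    qed simp
  next
    assume "v = H \<or> (\<exists>i. v \<in> core i)"
    then show "\<exists>p. normal_path D CG H p H \<and> (v = H \<or> (\<exists>(u, l)\<in>set p. v = u \<cdot> gelt D [l]))"
    proof
      assume "v = H"
      moreover have "normal_path D CG H [] H"
        unfolding normal_closed_path_iff using subgroup.one_closed[OF subgroup_H]
        by (intro exI[of _ "[]"]) (simp add: syllable_words_def spelled_def normal_seq_def)
      ultimately show ?thesis by blast
    next
      assume "\<exists>i. v \<in> core i"
      then obtain i where i: "v \<in> core i" by blast
      obtain l where l: "l \<in> letters (gens D i)" using core_gens[OF i] by blast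
      then have "l \<in> letters (all_gens D)" using letters_all[of l] by metis
      then have v: "v = v \<cdot> gelt D [l] \<cdot> gelt D [linv l]"
        using act_letter_inv[OF core_subset[OF i]] by simp
      obtain p where p: "normal_path D CG H p H" "(v \<cdot> gelt D [l], linv l) \<in> set p"
        using core_edge_normal_path[OF i l] by blast
      have "\<exists>(u, l)\<in>set p. v = u \<cdot> gelt D [l]"
        using v by (intro bexI[OF _ p(2)]) simp
      then show ?thesis using p(1) by blast
    qed
  qed
  finally show "v \<in> verts NC \<longleftrightarrow> v \<in> insert H (core F1 \<union> core F2)" by (simp add: side_ex)
qed

lemma normal_core_simps [simp]:
  "ini NC = fst" "lab NC = snd" "erev NC = (\<lambda>(v, l). (v \<cdot> gelt D [l], linv l))"
  "ter NC = (\<lambda>(v, l). v \<cdot> gelt D [l])"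
  by (simp_all add: normal_core_def ter_def fun_eq_iff)

lemma normal_core_vert_iff: "v \<in> verts NC \<longleftrightarrow> v = H \<or> (\<exists>i. v \<in> core i)"
  by (simp add: normal_core_verts side_ex)

lemma linv_neq [simp]: "linv l \<noteq> l"
  by (cases l) (simp add: linv_def)

lemma normal_core_has_edge: "has_edge (gens D i) NC v \<longleftrightarrow> v \<in> core i"
proof
  assume "has_edge (gens D i) NC v"
  then obtain l j where "v \<in> core j" "l \<in> letters (gens D j)" "l \<in> letters (gens D i)"
    unfolding has_edge_def normal_core_edges by auto
  then show "v \<in> core i" using letter_sides[of l j i] by simp
next
  assume v: "v \<in> core i"
  then obtain l where "l \<in> letters (gens D i)" using core_gens by blast
  then show "has_edge (gens D i) NC v"
    unfolding has_edge_def normal_core_edges using v by (intro bexI[of _ "(v, l)"]) auto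
qed

lemma normal_core_graph: "graph_of_cosets D H NC H id"
proof (unfold_locales)
  show "labelled_graph (all_gens D) NC"
    unfolding labelled_graph_def
  proof
    fix e assume "e \<in> edges NC"
    then obtain v l i where e: "e = (v, l)" "v \<in> core i" "l \<in> letters (gens D i)"
      unfolding normal_core_edges by blast
    have l: "l \<in> letters (all_gens D)" using e(3) letters_all[of l] by metis
    have "erev NC e \<in> edges NC"
      unfolding normal_core_edges using e core_step[OF e(2,3)] linv_letters[of l] by auto
    then show "ini NC e \<in> verts NC \<and> erev NC e \<in> edges NC \<and>
        erev NC e \<noteq> e \<and> erev NC (erev NC e) = e \<and>
        lab NC e \<in> letters (all_gens D) \<and> lab NC (erev NC e) = linv (lab NC e)"
      using e l act_letter_inv[OF core_subset[OF e(2)] l] normal_core_vert_iff by auto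
  qed
  show "id v \<subseteq> carrier GG" if "v \<in> verts NC" for v
    using that core_subset normal_core_vert_iff by auto
qed (auto simp: normal_core_vert_iff normal_core_has_edge normal_core_edges core_subset)

end

section \<open>Precovers as graphs of cosets\<close>

lemma cover_full:
  assumes "is_cover D i C" "labelled_graph X C" "v \<in> verts C" "l \<in> letters (gens D i)"
  shows "\<exists>e\<in>edges C. ini C e = v \<and> lab C e = l"
proof -
  obtain S f g where iso: "graph_iso f g C (cayley (gens D i) (rels D i) S)"
    using assms(1) unfolding is_cover_def isomorphic_def by blast
  let ?K = "cayley (gens D i) (rels D i) S"
  have "f v \<in> verts ?K" using iso assms(3) unfolding graph_iso_def bij_betw_def by blast
  then have "(f v, l) \<in> edges ?K" using assms(4) by (simp add: cayley_def)
  then obtain e where e: "e \<in> edges C" "g e = (f v, l)"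
    using iso unfolding graph_iso_def bij_betw_def by (metis imageE)
  have "ini ?K (g e) = f (ini C e)" "lab ?K (g e) = lab C e"
    using iso e(1) unfolding graph_iso_def graph_morphism_def by blast+
  then have "f v = f (ini C e)" "lab C e = l" using e(2) by (simp_all add: cayley_def)
  moreover have "ini C e \<in> verts C" using assms(2) e(1) unfolding labelled_graph_def by blast
  ultimately show ?thesis
    using e(1) iso assms(3) unfolding graph_iso_def bij_betw_def by (metis inj_onD)
qed

lemma cover_well_labelled:
  assumes "is_cover D i C" "e \<in> edges C" "e' \<in> edges C" "ini C e = ini C e'" "lab C e = lab C e'"
  shows "e = e'"
proof -
  obtain S f g where iso: "graph_iso f g C (cayley (gens D i) (rels D i) S)"
    using assms(1) unfolding is_cover_def isomorphic_def by blast
  have "g x = (f (ini C x), lab C x)" if "x \<in> edges C" for x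
  proof -
    have "ini (cayley (gens D i) (rels D i) S) (g x) = f (ini C x)"
      "lab (cayley (gens D i) (rels D i) S) (g x) = lab C x"
      using iso that unfolding graph_iso_def graph_morphism_def by blast+
    then show ?thesis by (simp add: cayley_def prod_eq_iff)
  qed
  then have "g e = g e'" using assms by simp
  then show ?thesis using iso assms(2,3) unfolding graph_iso_def bij_betw_def by (metis inj_onD)
qed

context amalgam_cosets begin

text \<open>The coset of a vertex is \<open>H\<close> times the label of a path to it. Two such labels for one vertex differ by
  the label of a closed path, hence by an element of \<open>H\<close>. If two vertices have the same coset, the
  element of \<open>H\<close> by which their labels differ is read along a closed path, which connects the two
  vertices by a path with trivial label.\<close>

lemma precover_graph_of_cosets:
  fixes \<Gamma> :: "('v, 'e, 'x) lgraph"
  assumes pre: "precover D \<Gamma> v0" and Lab: "Lab D \<Gamma> v0 = H"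
  shows "\<exists>f. graph_of_cosets D H \<Gamma> v0 f"
proof -
  have lg: "labelled_graph (all_gens D) \<Gamma>" and v0: "v0 \<in> verts \<Gamma>" and con: "connected_graph \<Gamma>"
    and based: "G_based D \<Gamma>" and cover: "\<And>i C. mono_component D \<Gamma> i C \<Longrightarrow> is_cover D i C"
    using pre unfolding precover_def by auto
  define pt where "pt v = (SOME p. path \<Gamma> v0 p v)" for v
  define f where "f v = H \<cdot> gelt D (plab \<Gamma> (pt v))" for v
  have pt: "path \<Gamma> v0 (pt v) v" if v: "v \<in> verts \<Gamma>" for v
  proof -
    have "\<exists>p. path \<Gamma> v0 p v" using con v0 v unfolding connected_graph_def by blast
    then show ?thesis unfolding pt_def by (rule someI_ex)
  qed
  have words: "plab \<Gamma> p \<in> words (all_gens D)" if "path \<Gamma> u p v" for u p v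
    using path_words[OF lg that] .
  have closed: "gelt D (plab \<Gamma> p) \<odot> inv\<^bsub>GG\<^esub> gelt D (plab \<Gamma> q) \<in> H"
    if p: "path \<Gamma> v0 p v" and q: "path \<Gamma> v0 q v" for p q v
  proof -
    have "path \<Gamma> v0 (p @ path_rev \<Gamma> q) v0"
      using path_append[OF lg] p path_path_rev[OF lg q] by blast
    then have "gelt D (plab \<Gamma> (p @ path_rev \<Gamma> q)) \<in> H" unfolding Lab[symmetric] Lab_def by blast
    then show ?thesis
      using words[OF p] words[OF q] by (simp add: plab_path_rev[OF lg q] gelt_append gelt_winv)
  qed
  have f_eq: "f v = H \<cdot> gelt D (plab \<Gamma> p)" if p: "path \<Gamma> v0 p v" for p v
  proof -
    have q: "path \<Gamma> v0 (pt v) v" using pt path_in_verts[OF p lg] by blast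
    have "H \<cdot> (gelt D (plab \<Gamma> (pt v)) \<odot> inv\<^bsub>GG\<^esub> gelt D (plab \<Gamma> p)) = H"
      using closed[OF q p] H_act_iff by simp
    then show ?thesis
      unfolding f_def using words[OF p] words[OF q] by (intro GG.coset_mult_inv1) simp_all
  qed
  have f_inj: "inj_on f (verts \<Gamma>)"
  proof (rule inj_onI)
    fix u v assume uv: "u \<in> verts \<Gamma>" "v \<in> verts \<Gamma>" "f u = f v"
    have p: "path \<Gamma> v0 (pt u) u" "path \<Gamma> v0 (pt v) v" using pt uv by auto
    define x y where "x = gelt D (plab \<Gamma> (pt u))" and "y = gelt D (plab \<Gamma> (pt v))"
    have c: "x \<in> carrier GG" "y \<in> carrier GG" using words[OF p(1)] words[OF p(2)] by (auto simp: x_def y_def)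
    have "H \<cdot> x = H \<cdot> y" using uv(3) unfolding f_def x_def y_def .
    then have "H \<cdot> (x \<odot> inv\<^bsub>GG\<^esub> y) = H" using c by (intro GG.coset_mult_inv2) simp_all
    then have "x \<odot> inv\<^bsub>GG\<^esub> y \<in> Lab D \<Gamma> v0" using H_act_iff c Lab by simp
    then obtain r where r: "path \<Gamma> v0 r v0" "gelt D (plab \<Gamma> r) = x \<odot> inv\<^bsub>GG\<^esub> y"
      unfolding Lab_def by auto
    have path: "path \<Gamma> u (path_rev \<Gamma> (pt u) @ r @ pt v) v"
      using path_append[OF lg] path_path_rev[OF lg p(1)] r(1) p(2) by blast
    have "gelt D (plab \<Gamma> (path_rev \<Gamma> (pt u) @ r @ pt v)) = inv\<^bsub>GG\<^esub> x \<odot> (x \<odot> inv\<^bsub>GG\<^esub> y \<odot> y)"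
      using words[OF p(1)] words[OF p(2)] words[OF r(1)] r(2)
      by (simp add: plab_path_rev[OF lg p(1)] gelt_append gelt_winv x_def y_def)
    also have "\<dots> = \<one>\<^bsub>GG\<^esub>" using c by (simp add: GG.m_assoc)
    finally show "u = v" using based path unfolding G_based_def by blast
  qed
  have component: "mono_component D \<Gamma> i (mono_part (gens D i) \<Gamma> v)"
    if "v \<in> verts \<Gamma>" "has_edge (gens D i) \<Gamma> v" for i v
    using that mono_component_iff[OF lg] by blast
  have "graph_of_cosets D H \<Gamma> v0 f"
  proof (unfold_locales)
    show "labelled_graph (all_gens D) \<Gamma>" "v0 \<in> verts \<Gamma>" "inj_on f (verts \<Gamma>)" by fact+
    show "f v \<subseteq> carrier GG" if "v \<in> verts \<Gamma>" for v
      unfolding f_def using words[OF pt[OF that]] by (intro coset_closed H_carrier) simp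
    show "f v0 = H" using f_eq[of "[]" v0] v0 by (simp add: gelt_Nil)
    show "f (ter \<Gamma> e) = f (ini \<Gamma> e) \<cdot> gelt D [lab \<Gamma> e]" if e: "e \<in> edges \<Gamma>" for e
    proof -
      have ends: "ini \<Gamma> e \<in> verts \<Gamma>" "ter \<Gamma> e \<in> verts \<Gamma>"
        using lg e ter_in_verts[OF lg e] unfolding labelled_graph_def by auto
      then have edge: "path \<Gamma> (ini \<Gamma> e) [e] (ter \<Gamma> e)" using e by simp
      have p: "path \<Gamma> v0 (pt (ini \<Gamma> e)) (ini \<Gamma> e)" using pt ends by blast
      then have "path \<Gamma> v0 (pt (ini \<Gamma> e) @ [e]) (ter \<Gamma> e)" using path_append[OF lg] edge by blast
      then have "f (ter \<Gamma> e) = H \<cdot> gelt D (plab \<Gamma> (pt (ini \<Gamma> e)) @ [lab \<Gamma> e])"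
        using f_eq by simp
      also have "\<dots> = f (ini \<Gamma> e) \<cdot> gelt D [lab \<Gamma> e]"
        unfolding f_def using act_append[OF H_carrier words[OF p] words[OF edge]] by simp
      finally show ?thesis .
    qed
    show "\<exists>e\<in>edges \<Gamma>. ini \<Gamma> e = v \<and> lab \<Gamma> e = l"
      if v: "v \<in> verts \<Gamma>" "has_edge (gens D i) \<Gamma> v" and l: "l \<in> letters (gens D i)" for v i l
    proof -
      have "v \<in> verts (mono_part (gens D i) \<Gamma> v)" using reach_self[OF v(1)] by simp
      from cover_full[OF cover[OF component[OF v]] labelled_comp[OF lg] this l]
      show ?thesis by auto
    qed
    show "e = e'" if e: "e \<in> edges \<Gamma>" "e' \<in> edges \<Gamma>" "ini \<Gamma> e = ini \<Gamma> e'" "lab \<Gamma> e = lab \<Gamma> e'" for e e'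
    proof -
      have v: "ini \<Gamma> e \<in> verts \<Gamma>" and l: "lab \<Gamma> e \<in> letters (all_gens D)"
        using lg e(1) unfolding labelled_graph_def by auto
      obtain i where i: "lab \<Gamma> e \<in> letters (gens D i)" using l letters_all[of "lab \<Gamma> e"] by metis
      have he: "has_edge (gens D i) \<Gamma> (ini \<Gamma> e)" using e(1) i unfolding has_edge_def by metis
      show ?thesis
        using cover_well_labelled[OF cover[OF component[OF v he]], of e e'] e i reach_self[OF v] by simp
    qed
  qed
  then show ?thesis by blast
qed

end

context graph_of_cosets begin

lemma connected_colored:
  assumes "connected_graph \<Gamma>" "v \<in> verts \<Gamma>"
  shows "v = v0 \<or> (\<exists>i. colored i v)"
proof -
  obtain p where p: "path \<Gamma> v p v0" using assms v0_vert unfolding connected_graph_def by blast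
  show ?thesis
  proof (cases p)
    case Nil
    then show ?thesis using p by simp
  next
    case (Cons e q)
    then have e: "e \<in> edges \<Gamma>" "ini \<Gamma> e = v" using p by auto
    obtain i where "lab \<Gamma> e \<in> letters (gens D i)"
      using edgeD(3)[OF e(1)] letters_all[of "lab \<Gamma> e"] by metis
    then have "colored i v" using e assms(2) unfolding has_edge_def by metis
    then show ?thesis by blast
  qed
qed

text \<open>A connected graph of cosets is recovered from its sets of cosets: every vertex other than the base
  vertex has an edge, and edges are determined by initial vertex and label.\<close>

lemma iso_normal_core:
  assumes con: "connected_graph \<Gamma>" and colors: "colors = core"
  shows "pointed_isomorphic \<Gamma> v0 (normal_core D H) (basepoint D H)"
proof -
  define g where "g e = (f (ini \<Gamma> e), lab \<Gamma> e)" for e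
  have verts: "f v \<in> verts NC" if v: "v \<in> verts \<Gamma>" for v
  proof -
    have "v = v0 \<or> (\<exists>i. f v \<in> core i)"
      using connected_colored[OF con v] colored_iff_colors[OF v] unfolding colors by blast
    then show ?thesis using normal_core_vert_iff f_v0 by metis
  qed
  have f_bij: "bij_betw f (verts \<Gamma>) (verts NC)"
    unfolding bij_betw_def
  proof (intro conjI f_inj Set.equalityI)
    show "f ` verts \<Gamma> \<subseteq> verts NC" using verts by blast
    show "verts NC \<subseteq> f ` verts \<Gamma>"
    proof
      fix c assume "c \<in> verts NC"
      then consider "c = H" | i where "c \<in> colors i" unfolding colors normal_core_vert_iff by blast
      then show "c \<in> f ` verts \<Gamma>"
      proof cases
        case 1
        then show ?thesis using f_v0 v0_vert by (metis imageI)
      next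
        case 2
        then show ?thesis unfolding colors_def by blast
      qed
    qed
  qed
  have edge: "g e \<in> edges NC" if e: "e \<in> edges \<Gamma>" for e
  proof -
    obtain i where i: "lab \<Gamma> e \<in> letters (gens D i)"
      using edgeD(3)[OF e] letters_all[of "lab \<Gamma> e"] by metis
    have "colored i (ini \<Gamma> e)" using e edgeD(1)[OF e] i unfolding has_edge_def by metis
    then have "f (ini \<Gamma> e) \<in> core i" using colored_iff_colors unfolding colors by blast
    with i have "\<exists>i. f (ini \<Gamma> e) \<in> core i \<and> lab \<Gamma> e \<in> letters (gens D i)"
      by (intro exI conjI)
    then show ?thesis by (simp only: g_def normal_core_edges mem_Collect_eq case_prod_conv)
  qed
  have g_bij: "bij_betw g (edges \<Gamma>) (edges NC)"
    unfolding bij_betw_def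
  proof (intro conjI Set.equalityI inj_onI)
    fix e e' assume e: "e \<in> edges \<Gamma>" "e' \<in> edges \<Gamma>" "g e = g e'"
    then have "ini \<Gamma> e = ini \<Gamma> e'" using f_eq_iff edgeD(1) by (simp add: g_def)
    then show "e = e'" using well_labelled e by (simp add: g_def)
  next
    show "g ` edges \<Gamma> \<subseteq> edges NC" using edge by blast
    show "edges NC \<subseteq> g ` edges \<Gamma>"
    proof
      fix x assume "x \<in> edges NC"
      then obtain c l i where x: "x = (c, l)" "c \<in> core i" "l \<in> letters (gens D i)"
        unfolding normal_core_edges by blast
      then have "c \<in> colors i" by (simp only: colors)
      then obtain v where v: "colored i v" "c = f v" unfolding colors_def by blast
      then obtain e where e: "e \<in> edges \<Gamma>" "ini \<Gamma> e = v" "lab \<Gamma> e = l" using full x(3) by metis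
      then have "x = g e" using x(1) v(2) by (simp add: g_def)
      then show "x \<in> g ` edges \<Gamma>" using e(1) by (rule image_eqI)
    qed
  qed
  have "graph_iso f g \<Gamma> NC"
    unfolding graph_iso_def graph_morphism_def
  proof (intro conjI ballI f_bij g_bij)
    show "f ` verts \<Gamma> \<subseteq> verts NC" "g ` edges \<Gamma> \<subseteq> edges NC" using verts edge by blast+
    fix e assume e: "e \<in> edges \<Gamma>"
    show "ini NC (g e) = f (ini \<Gamma> e)" "lab NC (g e) = lab \<Gamma> e" by (simp_all add: g_def)
    show "ter NC (g e) = f (ter \<Gamma> e)" using f_ter[OF e] by (simp add: g_def)
    show "g (erev \<Gamma> e) = erev NC (g e)" using f_ter[OF e] edgeD(5,6)[OF e] by (simp add: g_def)
  qed
  then show ?thesis unfolding pointed_isomorphic_def using f_v0 basepoint_eq by metis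
qed

end

section \<open>Existence and uniqueness of the reduced precover\<close>

theorem theorem7p1:
  fixes D :: "('x, 'a) amalgam_data"
    and H :: "'x word set set"
  assumes "amalgam D"
    and "subgroup H (amalg_gp D)"
    and "fin_gen (amalg_gp D) H"
  shows "(reduced_precover D (normal_core D H) (basepoint D H) \<and>
          finite_type D (normal_core D H) \<and>
          Lab D (normal_core D H) (basepoint D H) = H) \<and>
         (\<forall>(\<Gamma> :: ('v, 'e, 'x) lgraph) v0.
            reduced_precover D \<Gamma> v0 \<and> finite_type D \<Gamma> \<and> Lab D \<Gamma> v0 = H \<longrightarrow>
            pointed_isomorphic \<Gamma> v0 (normal_core D H) (basepoint D H))"
proof -
  interpret amalgam_cosets D H
    using assms(1,2) by (intro amalgam_cosets.intro presented_amalgam.intro amalgam_cosets_axioms.intro)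
  interpret N: graph_of_cosets D H "normal_core D H" H id
    by (rule normal_core_graph)
  have N_colors: "N.colors = core"
  proof
    fix i
    show "N.colors i = core i"
      unfolding N.colors_def using normal_core_has_edge normal_core_vert_iff by auto
  qed
  have "connected_graph (normal_core D H)"
  proof (rule N.reachable_connected)
    show "reachable N.colors" unfolding N_colors by (rule reachable_core)
    show "v = H \<or> (\<exists>i. v \<in> verts NC \<and> has_edge (gens D i) NC v)" if "v \<in> verts NC" for v
      using that normal_core_vert_iff normal_core_has_edge by metis
  qed
  then have core: "reduced_precover D (normal_core D H) H \<and> finite_type D (normal_core D H) \<and>
      Lab D (normal_core D H) H = H"
    using N.reduced_precover_iff N.finite_type_iff N.Lab_eq_iff reduced_core spans_core
      finite_orbits_core[OF assms(3)] unfolding N_colors by blast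
  have unique: "pointed_isomorphic \<Gamma> v0 (normal_core D H) (basepoint D H)"
    if red: "reduced_precover D \<Gamma> v0" and fin: "finite_type D \<Gamma>" and Lab: "Lab D \<Gamma> v0 = H"
    for \<Gamma> :: "('v, 'e, 'x) lgraph" and v0
  proof -
    have pre: "precover D \<Gamma> v0" using red unfolding reduced_precover_def by blast
    obtain f where f: "graph_of_cosets D H \<Gamma> v0 f"
      using precover_graph_of_cosets[OF pre Lab] by (elim exE)
    interpret P: graph_of_cosets D H \<Gamma> v0 f by (rule f)
    have con: "connected_graph \<Gamma>" and colors: "reduced_system P.colors"
      using red P.reduced_precover_iff by blast+
    have "P.colors = core"
    proof (rule system_eq_core)
      show "spans P.colors" using P.Lab_eq_iff Lab by simp
      show "finite_orbits P.colors" using P.finite_type_iff fin by simp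
    qed (fact P.saturated_colors P.connected_reachable[OF con] colors)+
    then show ?thesis by (rule P.iso_normal_core[OF con])
  qed
  show ?thesis using core unique basepoint_eq by metis
qed

end
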